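(* Let $I$ be a homogeneous Artinian ideal of $R=k[x_1,x_2,x_3]$. If $R/I$ has the strong Lefschetz property, then the minimal system of generators of $\mathrm{gin}(I)$ is determined by the graded Betti numbers of $I$. In particular, if $J$ is a homogeneous ideal of $R$ such that $\beta_{i,j}(J)=\beta_{i,j}(I)$ for all $i,j$, and if $R/J$ has the strong Lefschetz property, then $\mathrm{gin}(I)=\mathrm{gin}(J)$.
   Context: $k$ is a field of characteristic $0$, $R=k[x_1,x_2,x_3]$ with the standard grading. A homogeneous ideal $I\subsetneq R$ is called Artinian if $R/I$ is Artinian. $\mathrm{gin}(I)$ denotes the generic initial ideal of $I$ with respect to the reverse lexicographic order (with $x_1>x_2>x_3$): $\mathrm{gin}(I)=\mathrm{in}(gI)$ for $g$ in a nonempty Zariski open subset of $GL_3(k)$. The minimal system of generators of a monomial ideal means its minimal monomial generators. The graded Betti numbers of a homogeneous ideal $K$ are $\beta_{q,i}(K)=\dim_k\mathrm{Tor}^R_q(K,k)_i$. Strong Lefschetz property of $A=R/I$: there is a linear form $L\in R$ such that $\times L^i:A_d\to A_{d+i}$ has maximal rank (is injective or surjective) for each $d\ge 0$ and each $i\ge 1$. *)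

theory Defs
  imports
    "HOL-Analysis.Cartesian_Space"
    "HOL-Algebra.QuotRing"
    "HOL-Library.Poly_Mapping"
begin

abbreviation "lookup \<equiv> Poly_Mapping.lookup"
abbreviation "keys \<equiv> Poly_Mapping.keys"

section \<open>Polynomials in three variables\<close>

text \<open>
  The variables \<open>x\<^sub>1, x\<^sub>2, x\<^sub>3\<close> are indexed by the elements \<open>0 < 1 < 2\<close> of the numeral type \<open>3\<close>
  (in which \<open>3 = 0\<close>). A monomial is its exponent vector; addition of exponent vectors and the
  convolution product of \<^theory>\<open>HOL-Library.Poly_Mapping\<close> give the usual polynomial ring.
\<close>

type_synonym mon3 = "3 \<Rightarrow>\<^sub>0 nat"

type_synonym 'k poly3 = "mon3 \<Rightarrow>\<^sub>0 'k"

definition R3 :: "('k::field) poly3 ring" where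
  "R3 = \<lparr>carrier = UNIV, mult = (*), one = 1, zero = 0, add = (+)\<rparr>"

definition mdeg :: "mon3 \<Rightarrow> nat" where
  "mdeg t = (\<Sum>i\<in>UNIV. lookup t i)"

definition homog :: "nat \<Rightarrow> ('k::field) poly3 set" where
  "homog d = {f. \<forall>t\<in>keys f. mdeg t = d}"

definition hom_component :: "nat \<Rightarrow> ('k::field) poly3 \<Rightarrow> 'k poly3" where
  "hom_component d f = (\<Sum>t | t \<in> keys f \<and> mdeg t = d. Poly_Mapping.single t (lookup f t))"

definition homogeneous_ideal :: "('k::field) poly3 set \<Rightarrow> bool" where
  "homogeneous_ideal I \<longleftrightarrow> ideal I R3 \<and> (\<forall>f\<in>I. \<forall>d. hom_component d f \<in> I)"

definition artinian_ring :: "('a, 'b) ring_scheme \<Rightarrow> bool" where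
  "artinian_ring A \<longleftrightarrow> ring A \<and>
     (\<forall>C :: nat \<Rightarrow> 'a set. (\<forall>n. ideal (C n) A \<and> C (Suc n) \<subseteq> C n) \<longrightarrow> (\<exists>N. \<forall>n\<ge>N. C n = C N))"

definition homogeneous_artinian_ideal :: "('k::field) poly3 set \<Rightarrow> bool" where
  "homogeneous_artinian_ideal I \<longleftrightarrow>
     homogeneous_ideal I \<and> I \<noteq> UNIV \<and> artinian_ring (R3 Quot I)"

section \<open>The strong Lefschetz property\<close>

definition quot_piece :: "('k::field) poly3 set \<Rightarrow> nat \<Rightarrow> 'k poly3 set set" where
  "quot_piece I d = (\<lambda>f. I +>\<^bsub>R3\<^esub> f) ` homog d"

definition strong_lefschetz :: "('k::field) poly3 set \<Rightarrow> bool" where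
  "strong_lefschetz I \<longleftrightarrow>
     (\<exists>L \<in> homog 1. \<forall>d. \<forall>i\<ge>1.
        let m = (\<lambda>a. (I +>\<^bsub>R3\<^esub> L ^ i) \<otimes>\<^bsub>R3 Quot I\<^esub> a) in
          inj_on m (quot_piece I d) \<or> m ` quot_piece I d = quot_piece I (d + i))"

section \<open>Generic initial ideals\<close>

text \<open>The graded reverse lexicographic order with \<open>x\<^sub>1 > x\<^sub>2 > x\<^sub>3\<close>.\<close>

definition revlex_less :: "mon3 \<Rightarrow> mon3 \<Rightarrow> bool" where
  "revlex_less s t \<longleftrightarrow> mdeg s < mdeg t \<or>
     (mdeg s = mdeg t \<and>
       (\<exists>i. lookup t i < lookup s i \<and> (\<forall>j>i. lookup s j = lookup t j)))"

definition is_lead_mon :: "('k::field) poly3 \<Rightarrow> mon3 \<Rightarrow> bool" where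
  "is_lead_mon f t \<longleftrightarrow> t \<in> keys f \<and> (\<forall>s\<in>keys f. s \<noteq> t \<longrightarrow> revlex_less s t)"

definition initial_ideal :: "('k::field) poly3 set \<Rightarrow> 'k poly3 set" where
  "initial_ideal I = genideal R3 {Poly_Mapping.single t 1 | t. \<exists>f\<in>I. is_lead_mon f t}"

text \<open>
  Evaluation of a polynomial: coefficients are mapped by \<open>c\<close>, the variable \<open>i\<close> goes to \<open>\<sigma> i\<close>.
\<close>

definition poly_eval ::
  "('k::zero \<Rightarrow> 'r::comm_semiring_1) \<Rightarrow> ('x \<Rightarrow> 'r) \<Rightarrow> (('x \<Rightarrow>\<^sub>0 nat) \<Rightarrow>\<^sub>0 'k) \<Rightarrow> 'r" where
  "poly_eval c \<sigma> f = (\<Sum>t\<in>keys f. c (lookup f t) * (\<Prod>i\<in>keys t. \<sigma> i ^ lookup t i))"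

text \<open>The matrix \<open>g\<close> acts by the substitution \<open>x\<^sub>j \<mapsto> \<Sum>\<^sub>i g\<^sub>i\<^sub>j x\<^sub>i\<close>.\<close>

definition act :: "('k::field)^3^3 \<Rightarrow> 'k poly3 \<Rightarrow> 'k poly3" where
  "act g = poly_eval (Poly_Mapping.single 0)
     (\<lambda>j. \<Sum>i\<in>UNIV. Poly_Mapping.single (Poly_Mapping.single i 1) (g $ i $ j))"

definition zariski_open_GL3 :: "(('k::field)^3^3) set \<Rightarrow> bool" where
  "zariski_open_GL3 U \<longleftrightarrow>
     (\<exists>S :: ((3 \<times> 3 \<Rightarrow>\<^sub>0 nat) \<Rightarrow>\<^sub>0 'k) set.
        U = {g. invertible g \<and> (\<exists>p\<in>S. poly_eval id (\<lambda>(i, j). g $ i $ j) p \<noteq> 0)})"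

definition gin :: "('k::field) poly3 set \<Rightarrow> 'k poly3 set" where
  "gin I = (THE G. \<exists>U. zariski_open_GL3 U \<and> U \<noteq> {} \<and> (\<forall>g\<in>U. initial_ideal (act g ` I) = G))"

definition is_minimal_monomial_generators :: "('k::field) poly3 set \<Rightarrow> 'k poly3 set \<Rightarrow> bool" where
  "is_minimal_monomial_generators S G \<longleftrightarrow>
     S \<subseteq> range (\<lambda>t. Poly_Mapping.single t 1) \<and> genideal R3 S = G \<and>
     (\<forall>T. T \<subset> S \<longrightarrow> genideal R3 T \<noteq> G)"

section \<open>Graded Betti numbers\<close>

text \<open>
  A graded free \<open>R\<close>-module with homogeneous basis \<open>B \<subseteq> \<nat>\<close> is realised as the set of finitely
  supported families of polynomials with support in \<open>B\<close>. A homomorphism between such modules is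
  given by the images of the basis elements; the same constructions over \<open>k\<close> instead of \<open>R\<close>
  describe the modules and maps after tensoring with \<open>k\<close>.
\<close>

definition smult_fam :: "'r::comm_ring_1 \<Rightarrow> (nat \<Rightarrow>\<^sub>0 'r) \<Rightarrow> (nat \<Rightarrow>\<^sub>0 'r)" where
  "smult_fam c v = Poly_Mapping.map ((*) c) v"

definition free_on :: "nat set \<Rightarrow> (nat \<Rightarrow>\<^sub>0 'r::comm_ring_1) set" where
  "free_on B = {v. keys v \<subseteq> B}"

definition lin_ext :: "(nat \<Rightarrow> (nat \<Rightarrow>\<^sub>0 'r)) \<Rightarrow> (nat \<Rightarrow>\<^sub>0 'r::comm_ring_1) \<Rightarrow> (nat \<Rightarrow>\<^sub>0 'r)" where
  "lin_ext \<phi> v = (\<Sum>b\<in>keys v. smult_fam (lookup v b) (\<phi> b))"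

text \<open>
  \<open>basis F q\<close> and \<open>bdeg F q\<close> are the basis of \<open>F\<^sub>q\<close> and its degrees; \<open>diff F q\<close> gives the map
  \<open>F\<^sub>q\<^sub>+\<^sub>1 \<rightarrow> F\<^sub>q\<close> on the basis of \<open>F\<^sub>q\<^sub>+\<^sub>1\<close>, and \<open>aug F\<close> the augmentation \<open>F\<^sub>0 \<rightarrow> K \<subseteq> R\<close>.
\<close>

record (overloaded) 'k graded_free_complex =
  basis :: "nat \<Rightarrow> nat set"
  bdeg :: "nat \<Rightarrow> nat \<Rightarrow> nat"
  diff :: "nat \<Rightarrow> nat \<Rightarrow> (nat \<Rightarrow>\<^sub>0 'k poly3)"
  aug :: "nat \<Rightarrow> 'k poly3"

definition free_mod :: "('k::field) graded_free_complex \<Rightarrow> nat \<Rightarrow> (nat \<Rightarrow>\<^sub>0 'k poly3) set" where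
  "free_mod F q = free_on (basis F q)"

definition free_mod_piece ::
  "('k::field) graded_free_complex \<Rightarrow> nat \<Rightarrow> nat \<Rightarrow> (nat \<Rightarrow>\<^sub>0 'k poly3) set" where
  "free_mod_piece F q d =
     {v \<in> free_mod F q. \<forall>b\<in>keys v. bdeg F q b \<le> d \<and> lookup v b \<in> homog (d - bdeg F q b)}"

definition aug_map :: "('k::field) graded_free_complex \<Rightarrow> (nat \<Rightarrow>\<^sub>0 'k poly3) \<Rightarrow> 'k poly3" where
  "aug_map F v = (\<Sum>b\<in>keys v. lookup v b * aug F b)"

text \<open>
  Resolutions need not be minimal, and \<open>F\<^sub>q\<close> is only required to have finitely many basis elements
  in each degree.
\<close>

definition graded_free_resolution ::
  "('k::field) graded_free_complex \<Rightarrow> 'k poly3 set \<Rightarrow> bool" where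
  "graded_free_resolution F K \<longleftrightarrow>
     (\<forall>q d. finite {b \<in> basis F q. bdeg F q b = d}) \<and>
     (\<forall>b\<in>basis F 0. aug F b \<in> homog (bdeg F 0 b)) \<and>
     (\<forall>q. \<forall>b\<in>basis F (Suc q). diff F q b \<in> free_mod_piece F q (bdeg F (Suc q) b)) \<and>
     aug_map F ` free_mod F 0 = K \<and>
     {v \<in> free_mod F 0. aug_map F v = 0} = lin_ext (diff F 0) ` free_mod F 1 \<and>
     (\<forall>q. {v \<in> free_mod F (Suc q). lin_ext (diff F q) v = 0}
          = lin_ext (diff F (Suc q)) ` free_mod F (Suc (Suc q)))"

text \<open>
  The complex \<open>F \<otimes>\<^sub>R k\<close>, where \<open>k = R/(x\<^sub>1, x\<^sub>2, x\<^sub>3)\<close>: in homological degree \<open>q\<close> and internal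
  degree \<open>d\<close> it is the \<open>k\<close>-vector space on the basis elements of \<open>F\<^sub>q\<close> of degree \<open>d\<close>, and the
  entries of the matrices of its differentials are the constant terms of those of \<open>F\<close>.
\<close>

definition tensor_piece ::
  "('k::field) graded_free_complex \<Rightarrow> nat \<Rightarrow> nat \<Rightarrow> (nat \<Rightarrow>\<^sub>0 'k) set" where
  "tensor_piece F q d = free_on {b \<in> basis F q. bdeg F q b = d}"

definition tensor_diff ::
  "('k::field) graded_free_complex \<Rightarrow> nat \<Rightarrow> (nat \<Rightarrow>\<^sub>0 'k) \<Rightarrow> (nat \<Rightarrow>\<^sub>0 'k)" where
  "tensor_diff F q = lin_ext (\<lambda>b. Poly_Mapping.map (\<lambda>p. lookup p 0) (diff F q b))"

definition tensor_cycles ::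
  "('k::field) graded_free_complex \<Rightarrow> nat \<Rightarrow> nat \<Rightarrow> (nat \<Rightarrow>\<^sub>0 'k) set" where
  "tensor_cycles F q d =
     (case q of 0 \<Rightarrow> tensor_piece F 0 d
      | Suc p \<Rightarrow> {v \<in> tensor_piece F (Suc p) d. tensor_diff F p v = 0})"

definition tensor_boundaries ::
  "('k::field) graded_free_complex \<Rightarrow> nat \<Rightarrow> nat \<Rightarrow> (nat \<Rightarrow>\<^sub>0 'k) set" where
  "tensor_boundaries F q d = tensor_diff F q ` tensor_piece F (Suc q) d"

text \<open>
  \<open>dim\<^sub>k Tor\<^sub>q(K, k)\<^sub>d\<close>, where \<open>Tor\<close> is computed from a chosen graded free resolution of \<open>K\<close> (it does
  not depend on the choice). Cycles and boundaries in a fixed degree are finite-dimensional, so the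
  dimension of the homology is the difference of their dimensions.
\<close>

definition graded_betti :: "('k::field) poly3 set \<Rightarrow> nat \<Rightarrow> nat \<Rightarrow> nat" where
  "graded_betti K q d =
     (let F = (SOME F. graded_free_resolution F K) in
        vector_space.dim smult_fam (tensor_cycles F q d)
        - vector_space.dim smult_fam (tensor_boundaries F q d))"

end

theory Submission
  imports Defs "HOL-Analysis.Determinants" "HOL-Computational_Algebra.Polynomial"
begin

text \<open>
  Both assertions hold because \<open>gin I\<close> can be written down explicitly in terms of the Hilbert
  function \<open>h d = dim I\<^sub>d\<close> when \<open>R/I\<close> has the strong Lefschetz property, and because the graded
  Betti numbers determine \<open>h\<close>.

  \<^bold>\<open>From the Hilbert function to the generic initial ideal.\<close> Among the monomials of degree \<open>d\<close>, the
  multiples of \<open>x\<^sub>3\<^sup>c\<close> are the smallest ones for the reverse lexicographic order. Hence the number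
  of initial monomials of \<open>g I\<close> of degree \<open>d\<close> that are divisible by \<open>x\<^sub>3\<^sup>c\<close> is the dimension of
  \<open>(g I)\<^sub>d \<inter> x\<^sub>3\<^sup>c R\<close>. If multiplication by \<open>x\<^sub>3\<^sup>c\<close> has maximal rank on \<open>R/g I\<close>, this dimension is
  a function of \<open>h\<close> (\<open>expected_tail_dim\<close>), and it is then the smallest possible one. The condition
  \<open>dim ((g I)\<^sub>d \<inter> T) \<le> n\<close>, for a space \<open>T\<close> spanned by monomials, is open in \<open>g\<close>, so for a general
  \<open>g\<close> all these dimensions are minimal at the same time (\<open>minimal_tails_generic\<close>). It remains to
  locate, among the monomials \<open>x\<^sub>1\<^sup>a x\<^sub>2\<^sup>b x\<^sub>3\<^sup>c\<close> of degree \<open>d\<close> with \<open>c\<close> fixed, the initial ones, of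
  which there are \<open>m\<close>, say. They are those with \<open>b < m\<close>: the coefficients of \<open>x\<^sub>3\<^sup>c\<close> in
  \<open>(g I)\<^sub>d \<inter> x\<^sub>3\<^sup>c R\<close> form an \<open>m\<close>-dimensional space of binary forms, and in characteristic zero no
  nonzero member of such a space vanishes to order \<open>m\<close> at a general point
  (\<open>finite_special_points\<close>). A shear of \<open>x\<^sub>1, x\<^sub>2\<close> moves a general point to \<open>x\<^sub>2 = 0\<close>
  (\<open>exists_shear_small_tail\<close>), and minimality transfers the conclusion to \<open>g\<close> itself
  (\<open>lead_mons_if_minimal_tails\<close>).

  \<^bold>\<open>From the Betti numbers to the Hilbert function.\<close> The Betti numbers are computed from an
  arbitrary resolution, which need be neither minimal nor finite, so that an alternating sum over all
  homological degrees is not available. Filter the resolution by the degrees of the basis elements.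
  In internal degree \<open>d\<close> the filtration is strict from homological degree \<open>d\<close> on
  (\<open>below_exact\<close>), and there the dimension of the boundaries can be read off from the complex
  tensored with \<open>k\<close>. Descending from that point, one obtains \<open>dim I\<^sub>d\<close> from the Betti numbers
  (\<open>hilbert_function_eq_if_betti_eq\<close>).
\<close>

section \<open>Finite-dimensional subspaces\<close>

definition fin_dim_subspace :: "('k::field \<Rightarrow> 'v::ab_group_add \<Rightarrow> 'v) \<Rightarrow> 'v set \<Rightarrow> bool" where
  "fin_dim_subspace s V \<longleftrightarrow>
     module.subspace s V \<and> (\<exists>B. finite B \<and> V \<subseteq> module.span s B)"

context vector_space
begin

lemma fin_dim_subspace_subspace: "fin_dim_subspace scale V \<Longrightarrow> subspace V"
  by (simp add: fin_dim_subspace_def)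

lemma fin_dim_subspace_mono:
  "fin_dim_subspace scale V \<Longrightarrow> subspace W \<Longrightarrow> W \<subseteq> V \<Longrightarrow> fin_dim_subspace scale W"
  unfolding fin_dim_subspace_def by blast

lemma fin_dim_independent_finite:
  assumes "fin_dim_subspace scale V" "independent B" "B \<subseteq> V"
  shows "finite B" "card B \<le> dim V"
proof -
  obtain C where C: "C \<subseteq> V" "independent C" "V \<subseteq> span C" "card C = dim V"
    using basis_exists by blast
  obtain E where E: "finite E" "V \<subseteq> span E"
    using assms(1) unfolding fin_dim_subspace_def by blast
  have "finite C"
    using independent_span_bound[OF E(1) C(2)] C(1) E(2) by blast
  then show "finite B" "card B \<le> dim V"
    using independent_span_bound[OF _ assms(2), of C] assms(3) C by auto
qed

lemma fin_dim_basis_extend: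
  assumes "fin_dim_subspace scale V" "independent C" "C \<subseteq> V"
  obtains B where "C \<subseteq> B" "B \<subseteq> V" "independent B" "span B = V" "finite B" "card B = dim V"
proof -
  obtain B where B: "C \<subseteq> B" "B \<subseteq> V" "independent B" "V \<subseteq> span B"
    using maximal_independent_subset_extend[OF assms(3,2)] by blast
  have "span B = V"
    using B fin_dim_subspace_subspace[OF assms(1)] by (simp add: span_subspace)
  then show ?thesis
    using that B fin_dim_independent_finite(1)[OF assms(1) B(3,2)] basis_card_eq_dim[OF B(2,4,3)] by blast
qed

lemma fin_dim_basis:
  assumes "fin_dim_subspace scale V"
  obtains B where "B \<subseteq> V" "independent B" "span B = V" "finite B" "card B = dim V"
  using fin_dim_basis_extend[OF assms independent_empty] by auto

lemma dim_mono_fin: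
  assumes "fin_dim_subspace scale V" "subspace W" "W \<subseteq> V"
  shows "dim W \<le> dim V"
proof -
  obtain B where "B \<subseteq> W" "independent B" "card B = dim W"
    using fin_dim_basis[OF fin_dim_subspace_mono[OF assms]] by blast
  then show ?thesis
    using fin_dim_independent_finite(2)[OF assms(1)] assms(3) by (metis subset_trans)
qed

lemma subspace_eq_of_dim_ge:
  assumes "fin_dim_subspace scale V" "subspace W" "W \<subseteq> V" "dim V \<le> dim W"
  shows "W = V"
proof -
  obtain B where B: "B \<subseteq> W" "independent B" "span B = W" "finite B" "card B = dim W"
    using fin_dim_basis[OF fin_dim_subspace_mono[OF assms(1-3)]] by blast
  obtain C where C: "B \<subseteq> C" "C \<subseteq> V" "span C = V" "finite C" "card C = dim V"
    using fin_dim_basis_extend[OF assms(1) B(2)] B(1) assms(3) by (metis subset_trans)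
  have "B = C"
    using card_seteq[OF C(4) C(1)] B(5) C(5) assms(4) by simp
  then show ?thesis
    using B(3) C(3) by simp
qed

lemma dim_zero_subspace [simp]: "dim {0} = 0"
  by (metis card.empty dim_unique empty_subsetI independent_empty span_empty subset_refl)

end

context vector_space_pair
begin

lemma fin_dim_subspace_image:
  assumes "Vector_Spaces.linear s1 s2 f" "fin_dim_subspace s1 V"
  shows "fin_dim_subspace s2 (f ` V)"
proof -
  interpret f: Vector_Spaces.linear s1 s2 f by fact
  obtain B where B: "finite B" "V \<subseteq> vs1.span B"
    using assms(2) unfolding fin_dim_subspace_def by blast
  have "vs2.subspace (f ` V)"
    using assms(2) f.subspace_image vs1.fin_dim_subspace_subspace by blast
  moreover have "f ` V \<subseteq> vs2.span (f ` B)"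
    using B(2) f.spans_image by blast
  ultimately show ?thesis
    unfolding fin_dim_subspace_def using B(1) by blast
qed

text \<open>The kernel is extended to a basis of \<open>V\<close>; the added vectors map to a basis of the image.\<close>

lemma rank_nullity:
  assumes "Vector_Spaces.linear s1 s2 f" "fin_dim_subspace s1 V"
  shows "vs1.dim V = vs2.dim (f ` V) + vs1.dim {x \<in> V. f x = 0}"
proof -
  interpret f: Vector_Spaces.linear s1 s2 f by fact
  let ?K = "{x \<in> V. f x = 0}"
  have V: "vs1.subspace V"
    using assms(2) vs1.fin_dim_subspace_subspace by blast
  have "?K = V \<inter> {x. f x = 0}" by blast
  then have K: "vs1.subspace ?K"
    using V f.subspace_kernel vs1.subspace_inter by metis
  then have "fin_dim_subspace s1 ?K"
    using assms(2) vs1.fin_dim_subspace_mono by blast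
  then obtain C where C: "C \<subseteq> ?K" "vs1.independent C" "vs1.span C = ?K" "finite C" "card C = vs1.dim ?K"
    using vs1.fin_dim_basis by blast
  then have "C \<subseteq> V" by blast
  then obtain B where B: "C \<subseteq> B" "B \<subseteq> V" "vs1.independent B" "vs1.span B = V" "finite B" "card B = vs1.dim V"
    using vs1.fin_dim_basis_extend[OF assms(2) C(2)] by blast
  have ind: "vs1.independent (B - C)"
    using B(3) vs1.independent_mono by blast
  have inj: "inj_on f (vs1.span (B - C))"
    unfolding f.inj_on_iff_eq_0[OF vs1.subspace_span]
  proof (intro ballI impI)
    fix x assume x: "x \<in> vs1.span (B - C)" "f x = 0"
    have "vs1.span (B - C) \<subseteq> V"
      using B(4) vs1.span_mono by (metis Diff_subset)
    then have "x \<in> ?K" using x by auto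
    then have xC: "x \<in> vs1.span C"
      using C(3) by simp
    have "vs1.representation B x = vs1.representation C x"
      using vs1.representation_extend[OF B(3) xC B(1)] .
    moreover have "vs1.representation B x = vs1.representation (B - C) x"
      using vs1.representation_extend[OF B(3) x(1)] by blast
    ultimately have "vs1.representation B x b = 0" for b
      using vs1.representation_ne_zero by (metis DiffD2)
    moreover have "x \<in> vs1.span B"
      using xC B(1) vs1.span_mono by blast
    ultimately show "x = 0"
      using vs1.sum_representation_eq[OF B(3) _ B(5)] by (metis (no_types, lifting) subset_refl sum.neutral vs1.scale_zero_left)
  qed
  have "vs2.independent (f ` (B - C))"
    by (rule f.independent_injective_image[OF ind inj])
  moreover have "f ` V \<subseteq> vs2.span (f ` (B - C))"
  proof -
    have "f b \<in> vs2.span (f ` (B - C))" if "b \<in> B" for b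
    proof (cases "b \<in> C")
      case True
      then have "f b = 0" using C(1) by blast
      then show ?thesis by (simp add: vs2.span_zero)
    next
      case False
      then show ?thesis using that by (intro vs2.span_base) blast
    qed
    then have "f ` B \<subseteq> vs2.span (f ` (B - C))" by blast
    then have "vs2.span (f ` B) \<subseteq> vs2.span (f ` (B - C))"
      using vs2.span_minimal by blast
    then show ?thesis
      using f.span_image B(4) by metis
  qed
  moreover have "f ` (B - C) \<subseteq> f ` V"
    using B(2) by blast
  ultimately have "vs2.dim (f ` V) = card (f ` (B - C))"
    using vs2.basis_card_eq_dim by metis
  also have "\<dots> = card (B - C)"
    using inj vs1.span_superset by (metis card_image inj_on_subset)
  finally show ?thesis
    using B C by (metis Diff_partition card_Diff_subset card_mono finite_subset le_add_diff_inverse2)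
qed

lemma dim_image_inj:
  assumes "Vector_Spaces.linear s1 s2 f" "fin_dim_subspace s1 V" "\<And>x. x \<in> V \<Longrightarrow> f x = 0 \<Longrightarrow> x = 0"
  shows "vs2.dim (f ` V) = vs1.dim V"
proof -
  interpret f: Vector_Spaces.linear s1 s2 f by fact
  have "{x \<in> V. f x = 0} = {0}"
    using assms(3) f.zero vs1.fin_dim_subspace_subspace[OF assms(2)] vs1.subspace_0 by auto
  then show ?thesis
    using rank_nullity[OF assms(1,2)] by simp
qed

text \<open>
  Each coordinate map \<open>\<kappa> t\<close> lowers the dimension by \<open>dim B\<close> on the common kernel of the coordinate
  maps treated before it, so the coordinates can be split off one at a time.
\<close>

lemma dim_split_off_coordinates:
  assumes "finite T" "fin_dim_subspace s1 X"
    and "\<And>t. t \<in> T \<Longrightarrow> Vector_Spaces.linear s1 s2 (\<kappa> t)"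
    and "\<And>t x. t \<in> T \<Longrightarrow> x \<in> X \<Longrightarrow> \<kappa> t x \<in> B"
    and "\<And>t w. t \<in> T \<Longrightarrow> w \<in> B \<Longrightarrow> \<exists>x\<in>X. \<kappa> t x = w \<and> (\<forall>u\<in>T - {t}. \<kappa> u x = 0)"
  shows "vs1.dim X = card T * vs2.dim B + vs1.dim {x \<in> X. \<forall>t\<in>T. \<kappa> t x = 0}
    \<and> fin_dim_subspace s1 {x \<in> X. \<forall>t\<in>T. \<kappa> t x = 0}"
  using assms
proof (induction T rule: finite_induct)
  case empty
  then show ?case by simp
next
  case (insert t T)
  let ?Y = "{x \<in> X. \<forall>u\<in>T. \<kappa> u x = 0}"
  have "\<exists>x\<in>X. \<kappa> u x = w \<and> (\<forall>v\<in>T - {u}. \<kappa> v x = 0)" if "u \<in> T" "w \<in> B" for u w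
    using insert.prems(4)[of u w] that by auto
  then have IH: "vs1.dim X = card T * vs2.dim B + vs1.dim ?Y" "fin_dim_subspace s1 ?Y"
    using insert.IH insert.prems(1-3) by blast+
  interpret t: Vector_Spaces.linear s1 s2 "\<kappa> t"
    using insert.prems(2) by simp
  have ker: "{x \<in> ?Y. \<kappa> t x = 0} = {x \<in> X. \<forall>u\<in>insert t T. \<kappa> u x = 0}"
    by blast
  have "\<kappa> t ` ?Y = B"
  proof
    show "\<kappa> t ` ?Y \<subseteq> B"
      using insert.prems(3) by auto
    show "B \<subseteq> \<kappa> t ` ?Y"
    proof
      fix w assume "w \<in> B"
      then obtain x where "x \<in> X" "\<kappa> t x = w" "\<forall>v\<in>insert t T - {t}. \<kappa> v x = 0"
        using insert.prems(4)[of t w] by auto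
      moreover have "insert t T - {t} = T"
        using insert.hyps by blast
      ultimately show "w \<in> \<kappa> t ` ?Y" by auto
    qed
  qed
  then have "vs1.dim ?Y = vs2.dim B + vs1.dim {x \<in> ?Y. \<kappa> t x = 0}"
    using rank_nullity[OF t.linear_axioms IH(2)] by simp
  moreover have "fin_dim_subspace s1 {x \<in> ?Y. \<kappa> t x = 0}"
  proof (rule vs1.fin_dim_subspace_mono[OF IH(2)])
    have "{x \<in> ?Y. \<kappa> t x = 0} = ?Y \<inter> {x. \<kappa> t x = 0}" by blast
    then show "vs1.subspace {x \<in> ?Y. \<kappa> t x = 0}"
      using vs1.subspace_inter[OF vs1.fin_dim_subspace_subspace[OF IH(2)] t.subspace_kernel] by simp
  qed blast
  ultimately show ?case
    using IH insert.hyps unfolding ker by simp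
qed

end

section \<open>Families of scalars\<close>

definition pscale :: "'k::field \<Rightarrow> ('a \<Rightarrow>\<^sub>0 'k) \<Rightarrow> ('a \<Rightarrow>\<^sub>0 'k)" where
  "pscale c f = Poly_Mapping.map ((*) c) f"

lemma lookup_map_zero: "g 0 = 0 \<Longrightarrow> lookup (Poly_Mapping.map g f) t = g (lookup f t)"
  by (simp add: Poly_Mapping.map.rep_eq when_def)

lemma lookup_pscale [simp]: "lookup (pscale c f) t = c * lookup f t"
  by (simp add: pscale_def lookup_map_zero)

global_interpretation ps: vector_space "pscale :: 'k::field \<Rightarrow> ('a \<Rightarrow>\<^sub>0 'k) \<Rightarrow> _"
  by unfold_locales (auto intro!: poly_mapping_eqI simp: lookup_add algebra_simps)

global_interpretation psps: vector_space_pair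
  "pscale :: 'k::field \<Rightarrow> ('a \<Rightarrow>\<^sub>0 'k) \<Rightarrow> _" "pscale :: 'k::field \<Rightarrow> ('b \<Rightarrow>\<^sub>0 'k) \<Rightarrow> _" ..

definition supported_on :: "'a set \<Rightarrow> ('a \<Rightarrow>\<^sub>0 'k::zero) set" where
  "supported_on T = {f. keys f \<subseteq> T}"

lemma supported_on_iff: "f \<in> supported_on T \<longleftrightarrow> (\<forall>t. t \<notin> T \<longrightarrow> lookup f t = 0)"
  unfolding supported_on_def by (auto simp: in_keys_iff)

lemma subspace_supported_on [simp]: "ps.subspace (supported_on T)"
  by (rule ps.subspaceI) (auto simp: supported_on_iff lookup_add)

lemma sum_single_keys:
  assumes "finite T" "keys f \<subseteq> T"
  shows "(\<Sum>t\<in>T. Poly_Mapping.single t (lookup f t)) = f"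
proof (rule poly_mapping_eqI)
  fix s
  have "lookup (\<Sum>t\<in>T. Poly_Mapping.single t (lookup f t)) s = (\<Sum>t\<in>T. if t = s then lookup f s else 0)"
    unfolding lookup_sum by (rule sum.cong) (auto simp: lookup_single)
  also have "\<dots> = lookup f s"
    using assms by (auto simp: in_keys_iff)
  finally show "lookup (\<Sum>t\<in>T. Poly_Mapping.single t (lookup f t)) s = lookup f s" .
qed

lemma pscale_single: "pscale c (Poly_Mapping.single t a) = Poly_Mapping.single t (c * a)"
  by (rule poly_mapping_eqI) (simp add: lookup_single when_def)

lemma
  assumes "finite T"
  shows fin_dim_supported_on: "fin_dim_subspace pscale (supported_on T :: ('a \<Rightarrow>\<^sub>0 'k::field) set)"
    and dim_supported_on: "ps.dim (supported_on T :: ('a \<Rightarrow>\<^sub>0 'k) set) = card T"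
proof -
  let ?e = "\<lambda>t. Poly_Mapping.single t (1::'k)"
  have inj: "inj_on ?e T"
    by (rule inj_onI) (metis lookup_single_eq lookup_single_not_eq zero_neq_one)
  have "f \<in> ps.span (?e ` T)" if "f \<in> supported_on T" for f
  proof -
    have "f = (\<Sum>t\<in>T. pscale (lookup f t) (?e t))"
      using sum_single_keys[OF assms, of f] that by (simp add: pscale_single supported_on_def)
    then show ?thesis
      by (metis (no_types, lifting) imageI ps.span_base ps.span_scale ps.span_sum)
  qed
  then have sp: "(supported_on T :: ('a \<Rightarrow>\<^sub>0 'k) set) \<subseteq> ps.span (?e ` T)" by blast
  then show "fin_dim_subspace pscale (supported_on T :: ('a \<Rightarrow>\<^sub>0 'k) set)"
    unfolding fin_dim_subspace_def using assms by auto
  have "ps.independent (?e ` T)"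
  proof (rule ps.independent_if_scalars_zero)
    fix u x assume s: "(\<Sum>x\<in>?e ` T. pscale (u x) x) = 0" and "x \<in> ?e ` T"
    then obtain t where t: "t \<in> T" "x = ?e t" by blast
    have "0 = lookup (\<Sum>x\<in>?e ` T. pscale (u x) x) t"
      by (simp add: s)
    also have "\<dots> = (\<Sum>y\<in>T. u (?e y) * (if y = t then 1 else 0))"
      by (simp add: sum.reindex[OF inj] lookup_sum lookup_single when_def)
    also have "\<dots> = u x"
      using assms t by (simp add: if_distrib cong: if_cong)
    finally show "u x = 0" by simp
  qed (use assms in simp)
  moreover have "?e ` T \<subseteq> supported_on T"
    by (auto simp: supported_on_def)
  ultimately have "ps.dim (supported_on T :: ('a \<Rightarrow>\<^sub>0 'k) set) = card (?e ` T)"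
    using sp ps.basis_card_eq_dim by metis
  then show "ps.dim (supported_on T :: ('a \<Rightarrow>\<^sub>0 'k) set) = card T"
    by (simp add: card_image[OF inj])
qed

section \<open>Graded pieces of the polynomial ring\<close>

definition mons :: "nat \<Rightarrow> mon3 set" where
  "mons d = {t. mdeg t = d}"

abbreviation mono_poly :: "mon3 \<Rightarrow> ('k::field) poly3" where
  "mono_poly t \<equiv> Poly_Mapping.single t 1"

lemma mdeg_zero [simp]: "mdeg 0 = 0"
  by (simp add: mdeg_def)

lemma mdeg_add [simp]: "mdeg (s + t) = mdeg s + mdeg t"
  by (simp add: mdeg_def lookup_add sum.distrib)

lemma mdeg_single [simp]: "mdeg (Poly_Mapping.single i n) = n"
  by (simp add: mdeg_def lookup_single when_def)

lemma mdeg_eq_zero_iff: "mdeg t = 0 \<longleftrightarrow> t = 0"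
  by (auto simp: mdeg_def poly_mapping_eq_iff fun_eq_iff)

lemma mons_zero [simp]: "mons 0 = {0}"
  by (auto simp: mons_def mdeg_eq_zero_iff)

lemma finite_mons [simp]: "finite (mons d)"
proof -
  have "lookup ` mons d \<subseteq> PiE UNIV (\<lambda>_. {..d})"
  proof
    fix f assume "f \<in> lookup ` mons d"
    then obtain t where t: "mdeg t = d" "f = lookup t" by (auto simp: mons_def)
    have "lookup t i \<le> d" for i
      unfolding t(1)[symmetric] mdeg_def by (rule member_le_sum) auto
    then show "f \<in> PiE UNIV (\<lambda>_. {..d})" unfolding t(2) by (simp add: PiE_UNIV_domain)
  qed
  moreover have "finite (PiE (UNIV :: 3 set) (\<lambda>_. {..d}))"
    by (rule finite_PiE) (rule finite, rule finite_atMost)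
  ultimately have "finite (lookup ` mons d)"
    by (rule finite_subset)
  moreover have "inj_on lookup (mons d)"
    by (simp add: inj_on_def lookup_inject)
  ultimately show ?thesis
    by (rule finite_imageD)
qed

lemma homog_eq_supported_on: "homog d = supported_on (mons d)"
  by (auto simp: homog_def supported_on_def mons_def)

lemma homog_iff: "f \<in> homog d \<longleftrightarrow> (\<forall>t. lookup f t \<noteq> 0 \<longrightarrow> mdeg t = d)"
  by (auto simp: homog_def in_keys_iff)

lemma fin_dim_homog [simp]: "fin_dim_subspace pscale (homog d)"
  and dim_homog: "ps.dim (homog d :: ('k::field) poly3 set) = card (mons d)"
  by (simp_all add: homog_eq_supported_on fin_dim_supported_on dim_supported_on)

lemma subspace_homog [simp]: "ps.subspace (homog d)"
  by (simp add: homog_eq_supported_on)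

lemma homog_add: "f \<in> homog d \<Longrightarrow> g \<in> homog d \<Longrightarrow> f + g \<in> homog d"
  using ps.subspace_add[OF subspace_homog] .

lemma homog_diff: "f \<in> homog d \<Longrightarrow> g \<in> homog d \<Longrightarrow> f - g \<in> homog d"
  using ps.subspace_diff[OF subspace_homog] .

lemma homog_sum: "(\<And>x. x \<in> A \<Longrightarrow> f x \<in> homog d) \<Longrightarrow> sum f A \<in> homog d"
  using ps.subspace_sum[OF subspace_homog] .

lemma homog_zero [simp]: "0 \<in> homog d"
  by (simp add: homog_def)

lemma homog_single: "mdeg t = d \<Longrightarrow> Poly_Mapping.single t c \<in> homog d"
  by (auto simp: homog_def)

lemma homog_mult: "f \<in> homog a \<Longrightarrow> g \<in> homog b \<Longrightarrow> f * g \<in> homog (a + b)"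
  unfolding homog_def using keys_mult[of f g] by (auto dest!: subsetD)

lemma homog_one: "1 \<in> homog 0"
  by (simp add: homog_def)

lemma homog_power: "f \<in> homog a \<Longrightarrow> f ^ n \<in> homog (n * a)"
  by (induction n) (simp_all add: homog_one homog_mult)

lemma pscale_eq_mult: "pscale c f = Poly_Mapping.single 0 c * f"
  by (simp add: pscale_def mult_map_scale_conv_mult)

lemma pscale_mult_right: "f * pscale c g = pscale c (f * g)" for f g :: "('k::field) poly3"
  by (simp add: pscale_eq_mult algebra_simps)

lemma single_mult_eq:
  "Poly_Mapping.single u c * f = (\<Sum>s\<in>keys f. Poly_Mapping.single (u + s) (c * lookup f s))"
  for f :: "'a::cancel_comm_monoid_add \<Rightarrow>\<^sub>0 'b::comm_semiring_1"
proof -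
  have "Poly_Mapping.single u c * (\<Sum>s\<in>keys f. Poly_Mapping.single s (lookup f s))
      = (\<Sum>s\<in>keys f. Poly_Mapping.single (u + s) (c * lookup f s))"
    by (simp add: sum_distrib_left mult_single)
  moreover have "(\<Sum>s\<in>keys f. Poly_Mapping.single s (lookup f s)) = f"
    by (rule sum_single_keys) auto
  ultimately show ?thesis by simp
qed

lemma lookup_single_mult_add [simp]:
  "lookup (Poly_Mapping.single u c * f) (u + t) = c * lookup f t"
  for f :: "'a::cancel_comm_monoid_add \<Rightarrow>\<^sub>0 'b::comm_semiring_1"
proof -
  have "lookup (Poly_Mapping.single u c * f) (u + t)
      = (\<Sum>s\<in>keys f. if s = t then c * lookup f t else 0)"
    unfolding single_mult_eq lookup_sum by (rule sum.cong) (auto simp: lookup_single when_def)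
  then show ?thesis by (auto simp: in_keys_iff)
qed

lemma lookup_single_mult_not_add:
  "(\<And>s. t \<noteq> u + s) \<Longrightarrow> lookup (Poly_Mapping.single u c * f) t = 0"
  for f :: "'a::cancel_comm_monoid_add \<Rightarrow>\<^sub>0 'b::comm_semiring_1"
  unfolding single_mult_eq lookup_sum
  by (rule sum.neutral) (auto simp: lookup_single when_def)

lemma lookup_single_mult_exists:
  "lookup (Poly_Mapping.single u c * f) t \<noteq> 0 \<Longrightarrow> \<exists>s. t = u + s \<and> lookup f s \<noteq> 0"
  for f :: "'a::cancel_comm_monoid_add \<Rightarrow>\<^sub>0 'b::comm_semiring_1"
  by (metis lookup_single_mult_add lookup_single_mult_not_add mult_zero_right)

lemma lookup_hom_component: "lookup (hom_component d f) t = (if mdeg t = d then lookup f t else 0)"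
proof -
  have "lookup (hom_component d f) t
      = (\<Sum>s | s \<in> keys f \<and> mdeg s = d. if s = t then lookup f t else 0)"
    unfolding hom_component_def lookup_sum by (rule sum.cong) (auto simp: lookup_single when_def)
  then show ?thesis by (auto simp: in_keys_iff)
qed

lemma hom_component_homog [simp]: "hom_component d f \<in> homog d"
  by (auto simp: homog_iff lookup_hom_component split: if_splits)

lemma hom_component_of_homog: "f \<in> homog e \<Longrightarrow> hom_component d f = (if d = e then f else 0)"
  by (rule poly_mapping_eqI) (auto simp: homog_iff lookup_hom_component)

lemma hom_component_zero [simp]: "hom_component d 0 = 0"
  by (rule poly_mapping_eqI) (auto simp: lookup_hom_component)

lemma hom_component_add: "hom_component d (f + g) = hom_component d f + hom_component d g"
  by (rule poly_mapping_eqI) (auto simp: lookup_hom_component lookup_add)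

lemma hom_component_diff: "hom_component d (f - g) = hom_component d f - hom_component d g"
  by (rule poly_mapping_eqI) (auto simp: lookup_hom_component lookup_minus)

lemma hom_component_sum: "hom_component d (sum f A) = (\<Sum>x\<in>A. hom_component d (f x))"
  by (induction A rule: infinite_finite_induct) (auto simp: hom_component_add)

lemma sum_hom_components:
  assumes "finite D" "mdeg ` keys f \<subseteq> D"
  shows "(\<Sum>d\<in>D. hom_component d f) = f"
proof (rule poly_mapping_eqI)
  fix t
  have "lookup (\<Sum>d\<in>D. hom_component d f) t = (\<Sum>d\<in>D. if d = mdeg t then lookup f t else 0)"
    unfolding lookup_sum by (rule sum.cong) (auto simp: lookup_hom_component)
  also have "\<dots> = lookup f t"
    using assms by (force simp: in_keys_iff)
  finally show "lookup (\<Sum>d\<in>D. hom_component d f) t = lookup f t" .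
qed

lemma hom_component_mult_homog:
  assumes "r \<in> homog e"
  shows "hom_component d (p * r) = (if e \<le> d then hom_component (d - e) p * r else 0)"
proof -
  let ?D = "insert (d - e) (mdeg ` keys p)"
  have "hom_component d (p * r) = hom_component d ((\<Sum>a\<in>?D. hom_component a p) * r)"
    by (subst sum_hom_components) auto
  also have "\<dots> = (\<Sum>a\<in>?D. hom_component d (hom_component a p * r))"
    by (simp only: sum_distrib_right hom_component_sum)
  also have "\<dots> = (\<Sum>a\<in>?D. if a = d - e then (if e \<le> d then hom_component (d - e) p * r else 0) else 0)"
    by (rule sum.cong) (auto simp: hom_component_of_homog[OF homog_mult[OF hom_component_homog assms]])
  also have "\<dots> = (if e \<le> d then hom_component (d - e) p * r else 0)"
    by (subst sum.delta) auto
  finally show ?thesis .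
qed

section \<open>Homogeneous ideals and their quotients\<close>

lemma cring_R3: "cring (R3 :: ('k::field) poly3 ring)"
proof (rule cringI)
  show "abelian_group (R3 :: ('k::field) poly3 ring)"
  proof (rule abelian_groupI)
    fix x :: "'k poly3"
    show "\<exists>y\<in>carrier R3. y \<oplus>\<^bsub>R3\<^esub> x = \<zero>\<^bsub>R3\<^esub>"
      by (rule bexI[of _ "- x"]) (auto simp: R3_def)
  qed (auto simp: R3_def algebra_simps)
  show "comm_monoid (R3 :: ('k::field) poly3 ring)"
    by (rule comm_monoidI) (auto simp: R3_def algebra_simps)
qed (auto simp: R3_def algebra_simps)

lemma ring_R3: "ring R3"
  using cring_R3 by (rule cring.axioms)

lemma R3_simps [simp]: "carrier R3 = UNIV" "monoid.mult R3 = (*)" "monoid.one R3 = 1"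
  "ring.zero R3 = 0" "ring.add R3 = (+)"
  by (simp_all add: R3_def)

lemma a_inv_R3 [simp]: "a_inv R3 f = - f"
proof -
  interpret cring R3 by (rule cring_R3)
  show ?thesis
    using minus_equality[of "- f" f] by simp
qed

lemma ideal_R3_iff:
  "ideal I (R3 :: ('k::field) poly3 ring) \<longleftrightarrow>
     0 \<in> I \<and> (\<forall>f\<in>I. \<forall>g\<in>I. f + g \<in> I) \<and> (\<forall>f\<in>I. \<forall>r. r * f \<in> I)"
proof
  assume "ideal I (R3 :: 'k poly3 ring)"
  then interpret ideal I R3 .
  show "0 \<in> I \<and> (\<forall>f\<in>I. \<forall>g\<in>I. f + g \<in> I) \<and> (\<forall>f\<in>I. \<forall>r. r * f \<in> I)"
    using additive_subgroup.zero_closed[OF is_additive_subgroup]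
      additive_subgroup.a_closed[OF is_additive_subgroup] I_l_closed by auto
next
  assume I: "0 \<in> I \<and> (\<forall>f\<in>I. \<forall>g\<in>I. f + g \<in> I) \<and> (\<forall>f\<in>I. \<forall>r. r * f \<in> I)"
  have neg: "- f \<in> I" if "f \<in> I" for f
    using I that by (metis mult_minus1)
  have "subgroup I (add_monoid (R3 :: 'k poly3 ring))"
  proof
    fix f assume "f \<in> I"
    then show "inv\<^bsub>add_monoid R3\<^esub> f \<in> I"
      using neg a_inv_R3[of f] by (simp add: a_inv_def)
  qed (use I in auto)
  then show "ideal I (R3 :: 'k poly3 ring)"
    using I by (intro idealI[OF ring_R3]) (auto simp: mult.commute)
qed

lemma coset_R3: "I +>\<^bsub>R3\<^esub> f = (\<lambda>i. i + f) ` I"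
  by (auto simp: a_r_coset_def r_coset_def)

lemma ideal_sum: "ideal I R3 \<Longrightarrow> (\<And>x. x \<in> A \<Longrightarrow> f x \<in> I) \<Longrightarrow> sum f A \<in> I"
  by (induction A rule: infinite_finite_induct) (auto simp: ideal_R3_iff)

lemma coset_R3_eq_iff:
  assumes "ideal I R3"
  shows "I +>\<^bsub>R3\<^esub> f = I +>\<^bsub>R3\<^esub> g \<longleftrightarrow> f - g \<in> I"
proof
  assume "I +>\<^bsub>R3\<^esub> f = I +>\<^bsub>R3\<^esub> g"
  moreover have "f \<in> I +>\<^bsub>R3\<^esub> f"
    using assms unfolding coset_R3 ideal_R3_iff by (metis add_0 image_eqI)
  ultimately show "f - g \<in> I" by (auto simp: coset_R3)
next
  assume *: "f - g \<in> I"
  then have **: "g - f \<in> I" using assms by (metis ideal_R3_iff minus_diff_eq mult_minus1)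
  have "I +>\<^bsub>R3\<^esub> p \<subseteq> I +>\<^bsub>R3\<^esub> q" if "p - q \<in> I" for p q
  proof
    fix x assume "x \<in> I +>\<^bsub>R3\<^esub> p"
    then obtain i where i: "i \<in> I" "x = (i + (p - q)) + q" by (auto simp: coset_R3)
    have "i + (p - q) \<in> I" using assms i(1) that by (simp add: ideal_R3_iff)
    then show "x \<in> I +>\<^bsub>R3\<^esub> q" unfolding coset_R3 i(2) by (rule imageI)
  qed
  then show "I +>\<^bsub>R3\<^esub> f = I +>\<^bsub>R3\<^esub> g"
    using * ** by blast
qed

lemma ideal_subspace: "ideal I R3 \<Longrightarrow> ps.subspace I"
  by (rule ps.subspaceI) (auto simp: ideal_R3_iff pscale_eq_mult)

lemma ideal_piece_fin_dim: "ideal I R3 \<Longrightarrow> fin_dim_subspace pscale (I \<inter> homog d)"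
  by (rule ps.fin_dim_subspace_mono[OF fin_dim_homog])
     (auto intro: ps.subspace_inter ideal_subspace)

lemma strong_lefschetz_iff:
  fixes I :: "('k::field) poly3 set"
  assumes I: "ideal I R3"
  shows "strong_lefschetz I \<longleftrightarrow> (\<exists>L\<in>homog 1. \<forall>d. \<forall>i\<ge>1.
    (\<forall>f\<in>homog d. L ^ i * f \<in> I \<longrightarrow> f \<in> I) \<or>
    (\<forall>h\<in>homog (d + i). \<exists>f\<in>homog d. h - L ^ i * f \<in> I))"
proof -
  have mult: "(I +>\<^bsub>R3\<^esub> p) \<otimes>\<^bsub>R3 Quot I\<^esub> (I +>\<^bsub>R3\<^esub> q) = I +>\<^bsub>R3\<^esub> (p * q)" for p q
    using ideal.rcoset_mult_add[OF I, of p q] by (simp add: FactRing_def)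
  have inj_iff: "inj_on (\<lambda>a. (I +>\<^bsub>R3\<^esub> P) \<otimes>\<^bsub>R3 Quot I\<^esub> a) (quot_piece I d) \<longleftrightarrow>
      (\<forall>f\<in>homog d. P * f \<in> I \<longrightarrow> f \<in> I)" (is "?L \<longleftrightarrow> ?R") for P d
  proof -
    have "?L \<longleftrightarrow> (\<forall>f\<in>homog d. \<forall>g\<in>homog d. P * f - P * g \<in> I \<longrightarrow> f - g \<in> I)"
      unfolding inj_on_def quot_piece_def by (simp add: mult coset_R3_eq_iff[OF I])
    also have "\<dots> \<longleftrightarrow> (\<forall>f\<in>homog d. \<forall>g\<in>homog d. P * (f - g) \<in> I \<longrightarrow> f - g \<in> I)"
      by (simp add: algebra_simps)
    also have "\<dots> \<longleftrightarrow> ?R"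
      by (metis diff_zero homog_diff homog_zero)
    finally show ?thesis .
  qed
  have surj_iff: "(\<lambda>a. (I +>\<^bsub>R3\<^esub> P) \<otimes>\<^bsub>R3 Quot I\<^esub> a) ` quot_piece I d = quot_piece I (d + i) \<longleftrightarrow>
      (\<forall>h\<in>homog (d + i). \<exists>f\<in>homog d. h - P * f \<in> I)" (is "?L \<longleftrightarrow> ?R") if P: "P \<in> homog i" for P d i
  proof -
    have im: "(\<lambda>a. (I +>\<^bsub>R3\<^esub> P) \<otimes>\<^bsub>R3 Quot I\<^esub> a) ` quot_piece I d = (\<lambda>f. I +>\<^bsub>R3\<^esub> (P * f)) ` homog d"
      unfolding quot_piece_def image_image mult ..
    have "(\<lambda>f. I +>\<^bsub>R3\<^esub> (P * f)) ` homog d \<subseteq> quot_piece I (d + i)"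
      unfolding quot_piece_def using homog_mult[OF P] by (auto simp: add.commute)
    then have "?L \<longleftrightarrow> quot_piece I (d + i) \<subseteq> (\<lambda>f. I +>\<^bsub>R3\<^esub> (P * f)) ` homog d"
      unfolding im by blast
    also have "\<dots> \<longleftrightarrow> (\<forall>h\<in>homog (d + i). \<exists>f\<in>homog d. I +>\<^bsub>R3\<^esub> h = I +>\<^bsub>R3\<^esub> (P * f))"
      unfolding quot_piece_def by blast
    finally show ?thesis by (simp add: coset_R3_eq_iff[OF I])
  qed
  have pow: "L ^ i \<in> homog i" if "L \<in> homog 1" for L :: "'k poly3" and i
    using homog_power[OF that, of i] by simp
  show ?thesis
    unfolding strong_lefschetz_def Let_def inj_iff
    by (rule bex_cong[OF refl]) (simp add: surj_iff[OF pow])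
qed

text \<open>
  The ideals \<open>I + R\<^sub>\<ge>\<^sub>n\<close> form a descending chain modulo \<open>I\<close>. Where it has become stationary, the
  component of degree \<open>n\<close> of \<open>I + R\<^sub>\<ge>\<^sub>n\<^sub>+\<^sub>1\<close>, which lies in \<open>I\<close>, is everything.
\<close>

lemma artinian_contains_high_degrees:
  fixes I :: "('k::field) poly3 set"
  assumes "homogeneous_artinian_ideal I"
  obtains D where "\<And>d. d \<ge> D \<Longrightarrow> homog d \<subseteq> I"
proof -
  have I: "ideal I R3" and hom: "\<And>f d. f \<in> I \<Longrightarrow> hom_component d f \<in> I"
    and art: "artinian_ring (R3 Quot I)"
    using assms unfolding homogeneous_artinian_ideal_def homogeneous_ideal_def by auto
  define M where "M n = {f + g | f g. f \<in> I \<and> (\<forall>t\<in>keys g. n \<le> mdeg t)}" for n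
  have M: "ideal (M n) R3" for n
    unfolding ideal_R3_iff
  proof (intro conjI ballI allI)
    have "0 + 0 \<in> M n"
      unfolding M_def using I unfolding ideal_R3_iff by fastforce
    then show "0 \<in> M n" by simp
  next
    fix p q assume "p \<in> M n" "q \<in> M n"
    then obtain f g f' g' where *: "p = f + g" "q = f' + g'" "f \<in> I" "f' \<in> I"
        "\<forall>t\<in>keys g. n \<le> mdeg t" "\<forall>t\<in>keys g'. n \<le> mdeg t"
      unfolding M_def by blast
    have "p + q = (f + f') + (g + g')" "f + f' \<in> I"
      using * I by (auto simp: ideal_R3_iff)
    moreover have "\<forall>t\<in>keys (g + g'). n \<le> mdeg t"
      using * keys_add[of g g'] by blast
    ultimately show "p + q \<in> M n" unfolding M_def by blast
  next
    fix p r assume "p \<in> M n"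
    then obtain f g where *: "p = f + g" "f \<in> I" "\<forall>t\<in>keys g. n \<le> mdeg t"
      unfolding M_def by blast
    have "r * p = r * f + r * g" "r * f \<in> I"
      using * I by (auto simp: ideal_R3_iff algebra_simps)
    moreover have "\<forall>t\<in>keys (r * g). n \<le> mdeg t"
      using * keys_mult[of r g] by fastforce
    ultimately show "r * p \<in> M n" unfolding M_def by blast
  qed
  define C where "C n = (\<lambda>f. I +>\<^bsub>R3\<^esub> f) ` M n" for n
  have "ideal (C n) (R3 Quot I)" for n
    unfolding C_def using ring.ring_ideal_imp_quot_ideal[OF ring_R3 I M] .
  moreover have "C (Suc n) \<subseteq> C n" for n
    unfolding C_def M_def by (fastforce dest: Suc_leD)
  ultimately obtain D where D: "\<And>n. n \<ge> D \<Longrightarrow> C n = C D"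
    using art unfolding artinian_ring_def by blast
  have "homog d \<subseteq> I" if "d \<ge> D" for d
  proof
    fix p :: "'k poly3" assume p: "p \<in> homog d"
    have "p = 0 + p" "0 \<in> I" "\<forall>t\<in>keys p. d \<le> mdeg t"
      using p I by (auto simp: homog_def ideal_R3_iff)
    then have "p \<in> M d" unfolding M_def by blast
    then have "I +>\<^bsub>R3\<^esub> p \<in> C (Suc d)"
      using D[of d] D[of "Suc d"] that unfolding C_def by auto
    then obtain f g where fg: "f \<in> I" "\<forall>t\<in>keys g. Suc d \<le> mdeg t" "p - (f + g) \<in> I"
      unfolding C_def M_def using coset_R3_eq_iff[OF I] by auto
    have "hom_component d g = 0"
    proof (rule poly_mapping_eqI)
      fix t
      have "t \<notin> keys g" if "mdeg t = d"
        using fg(2) that by auto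
      then show "lookup (hom_component d g) t = lookup 0 t"
        by (auto simp: lookup_hom_component in_keys_iff)
    qed
    then have "p = hom_component d (p - (f + g)) + hom_component d f"
      using p by (simp add: hom_component_diff hom_component_add hom_component_of_homog)
    moreover have "hom_component d (p - (f + g)) \<in> I" "hom_component d f \<in> I"
      using hom fg by blast+
    ultimately show "p \<in> I"
      using I unfolding ideal_R3_iff by metis
  qed
  then show ?thesis using that by blast
qed

section \<open>Free modules and their graded pieces\<close>

lemma lookup_smult_fam [simp]: "lookup (smult_fam c v) b = c * lookup v b"
  by (simp add: smult_fam_def lookup_map_zero)

lemma smult_fam_eq_pscale: "smult_fam = pscale"
  by (simp add: fun_eq_iff smult_fam_def pscale_def)

lemma lookup_lin_ext:
  assumes "finite A" "keys v \<subseteq> A"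
  shows "lookup (lin_ext \<phi> v) b = (\<Sum>a\<in>A. lookup v a * lookup (\<phi> a) b)"
proof -
  have "lookup (lin_ext \<phi> v) b = (\<Sum>a\<in>keys v. lookup v a * lookup (\<phi> a) b)"
    by (simp add: lin_ext_def lookup_sum)
  also have "\<dots> = (\<Sum>a\<in>A. lookup v a * lookup (\<phi> a) b)"
    using assms by (intro sum.mono_neutral_left) (auto simp: in_keys_iff)
  finally show ?thesis .
qed

lemma lin_ext_add: "lin_ext \<phi> (v + w) = lin_ext \<phi> v + lin_ext \<phi> w"
proof (rule poly_mapping_eqI)
  fix b
  let ?A = "keys v \<union> keys w"
  have k: "keys (v + w) \<subseteq> ?A" by (rule keys_add)
  show "lookup (lin_ext \<phi> (v + w)) b = lookup (lin_ext \<phi> v + lin_ext \<phi> w) b"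
    by (simp add: lookup_add lookup_lin_ext[OF _ k] lookup_lin_ext[of ?A v] lookup_lin_ext[of ?A w]
        algebra_simps sum.distrib)
qed

lemma lin_ext_smult: "lin_ext \<phi> (smult_fam r v) = smult_fam r (lin_ext \<phi> v)"
proof (rule poly_mapping_eqI)
  fix b
  have k: "keys (smult_fam r v) \<subseteq> keys v"
    by (auto simp: in_keys_iff)
  show "lookup (lin_ext \<phi> (smult_fam r v)) b = lookup (smult_fam r (lin_ext \<phi> v)) b"
    by (simp add: lookup_lin_ext[OF _ k] lookup_lin_ext[of "keys v" v] algebra_simps sum_distrib_left)
qed

lemma lin_ext_zero [simp]: "lin_ext \<phi> 0 = 0"
  by (simp add: lin_ext_def)

type_synonym 'k fam3 = "nat \<Rightarrow>\<^sub>0 'k poly3"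

definition fscale :: "'k::field \<Rightarrow> 'k fam3 \<Rightarrow> 'k fam3" where
  "fscale c v = smult_fam (Poly_Mapping.single 0 c) v"

lemma lookup_fscale [simp]: "lookup (fscale c v) b = pscale c (lookup v b)"
  by (simp add: fscale_def pscale_eq_mult)

global_interpretation fs: vector_space "fscale :: 'k::field \<Rightarrow> 'k fam3 \<Rightarrow> _"
  by unfold_locales
    (auto intro!: poly_mapping_eqI simp: lookup_add ps.scale_right_distrib ps.scale_left_distrib)

global_interpretation fsfs: vector_space_pair
  "fscale :: 'k::field \<Rightarrow> 'k fam3 \<Rightarrow> _" "fscale :: 'k::field \<Rightarrow> 'k fam3 \<Rightarrow> _" ..

global_interpretation fsps: vector_space_pair
  "fscale :: 'k::field \<Rightarrow> 'k fam3 \<Rightarrow> _" "pscale :: 'k::field \<Rightarrow> ('a \<Rightarrow>\<^sub>0 'k) \<Rightarrow> _" ..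

lemma linear_lin_ext: "Vector_Spaces.linear fscale fscale (lin_ext \<phi>)"
  by (rule Vector_Spaces.linear_iff[THEN iffD2])
     (auto simp: lin_ext_add fscale_def lin_ext_smult fs.vector_space_axioms)

lemma linear_lin_ext_scalar: "Vector_Spaces.linear pscale pscale (lin_ext \<phi>)"
  by (rule Vector_Spaces.linear_iff[THEN iffD2])
     (auto simp: lin_ext_add smult_fam_eq_pscale[symmetric] lin_ext_smult,
       auto simp: smult_fam_eq_pscale ps.vector_space_axioms)

text \<open>
  A free module is given by its basis \<open>B\<close> and the degrees \<open>\<delta>\<close> of the basis elements. The piece of
  degree \<open>d\<close> is filtered by the submodules spanned by the basis elements of degree less than \<open>i\<close>.
\<close>

definition piece :: "nat set \<Rightarrow> (nat \<Rightarrow> nat) \<Rightarrow> nat \<Rightarrow> ('k::field) fam3 set" where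
  "piece B \<delta> d = {v. \<forall>b\<in>keys v. b \<in> B \<and> \<delta> b \<le> d \<and> lookup v b \<in> homog (d - \<delta> b)}"

definition piece_below :: "nat set \<Rightarrow> (nat \<Rightarrow> nat) \<Rightarrow> nat \<Rightarrow> nat \<Rightarrow> ('k::field) fam3 set" where
  "piece_below B \<delta> i d = {v \<in> piece B \<delta> d. \<forall>b\<in>keys v. \<delta> b < i}"

lemma piece_iff:
  "v \<in> piece B \<delta> d \<longleftrightarrow> (\<forall>b. lookup v b \<noteq> 0 \<longrightarrow> b \<in> B \<and> \<delta> b \<le> d \<and> lookup v b \<in> homog (d - \<delta> b))"
  by (auto simp: piece_def in_keys_iff)

lemma piece_below_iff: "v \<in> piece_below B \<delta> i d \<longleftrightarrow> v \<in> piece B \<delta> d \<and> (\<forall>b. lookup v b \<noteq> 0 \<longrightarrow> \<delta> b < i)"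
  by (auto simp: piece_below_def in_keys_iff)

lemma piece_below_subset: "piece_below B \<delta> i d \<subseteq> piece B \<delta> d"
  by (auto simp: piece_below_def)

lemma piece_below_mono: "i \<le> j \<Longrightarrow> piece_below B \<delta> i d \<subseteq> piece_below B \<delta> j d"
  by (auto simp: piece_below_def)

lemma piece_below_Suc: "v \<in> piece_below B \<delta> i d \<Longrightarrow> v \<in> piece_below B \<delta> (Suc i) d"
  using piece_below_mono[of i "Suc i" B \<delta> d] by auto

lemma piece_below_zero [simp]: "piece_below B \<delta> 0 d = {0}"
  by (auto simp: piece_below_iff piece_iff intro!: poly_mapping_eqI)

lemma piece_below_all: "d < i \<Longrightarrow> piece_below B \<delta> i d = piece B \<delta> d"
  by (auto simp: piece_below_iff piece_iff) (meson le_less_trans)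

lemma homog_pscale: "f \<in> homog d \<Longrightarrow> pscale c f \<in> homog d"
  using ps.subspace_scale[OF subspace_homog] .

lemma subspace_piece: "fs.subspace (piece B \<delta> d)"
proof (rule fs.subspaceI)
  fix v w :: "'a fam3" assume "v \<in> piece B \<delta> d" "w \<in> piece B \<delta> d"
  then show "v + w \<in> piece B \<delta> d"
    unfolding piece_iff lookup_add by (metis add_0 add.right_neutral homog_add)
qed (auto simp: piece_iff homog_pscale)

lemma subspace_piece_below: "fs.subspace (piece_below B \<delta> i d)"
proof (rule fs.subspaceI)
  fix v w :: "'a fam3" assume "v \<in> piece_below B \<delta> i d" "w \<in> piece_below B \<delta> i d"
  then show "v + w \<in> piece_below B \<delta> i d"
    unfolding piece_below_iff using fs.subspace_add[OF subspace_piece]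
    by (metis add_0 lookup_add)
qed (use fs.subspace_0[OF subspace_piece] fs.subspace_scale[OF subspace_piece] in \<open>auto simp: piece_below_iff\<close>)

lemma fin_dim_piece:
  assumes "\<And>i. finite {b \<in> B. \<delta> b = i}"
  shows "fin_dim_subspace fscale (piece B \<delta> d :: ('k::field) fam3 set)"
proof -
  let ?A = "\<Union>i\<le>d. {b \<in> B. \<delta> b = i}"
  let ?G = "(\<lambda>(b, t). Poly_Mapping.single b (mono_poly t) :: 'k fam3) ` (SIGMA b:?A. mons (d - \<delta> b))"
  have "v \<in> fs.span ?G" if v: "v \<in> piece B \<delta> d" for v
  proof -
    have fA: "finite ?A" using assms by blast
    have kA: "keys v \<subseteq> ?A" using v by (auto simp: piece_def)
    have "v = (\<Sum>b\<in>?A. Poly_Mapping.single b (lookup v b))"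
      using sum_single_keys[OF fA kA] by simp
    also have "\<dots> = (\<Sum>b\<in>?A. \<Sum>t\<in>mons (d - \<delta> b). fscale (lookup (lookup v b) t) (Poly_Mapping.single b (mono_poly t)))"
    proof (rule sum.cong[OF refl])
      fix b assume "b \<in> ?A"
      have "lookup v b \<in> homog (d - \<delta> b)"
        using v by (cases "lookup v b = 0") (auto simp: piece_iff)
      then have "keys (lookup v b) \<subseteq> mons (d - \<delta> b)"
        by (simp add: homog_eq_supported_on supported_on_def)
      then have "lookup v b = (\<Sum>t\<in>mons (d - \<delta> b). Poly_Mapping.single t (lookup (lookup v b) t))"
        by (simp add: sum_single_keys)
      then have *: "Poly_Mapping.single b (lookup v b)
          = (\<Sum>t\<in>mons (d - \<delta> b). Poly_Mapping.single b (Poly_Mapping.single t (lookup (lookup v b) t)))"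
        by (metis (mono_tags, lifting) additive.sum additive_def single_add sum.cong)
      have "fscale c (Poly_Mapping.single b (mono_poly t)) = Poly_Mapping.single b (Poly_Mapping.single t c)"
        for c :: 'k and t
        by (rule poly_mapping_eqI) (simp add: lookup_single when_def pscale_single)
      then show "Poly_Mapping.single b (lookup v b) = (\<Sum>t\<in>mons (d - \<delta> b).
          fscale (lookup (lookup v b) t) (Poly_Mapping.single b (mono_poly t)))"
        using * by simp
    qed
    also have "\<dots> \<in> fs.span ?G"
      by (intro fs.span_sum fs.span_scale fs.span_base) auto
    finally show ?thesis .
  qed
  moreover have "finite ?G"
    using assms by (intro finite_imageI finite_SigmaI) auto
  ultimately show ?thesis
    unfolding fin_dim_subspace_def using subspace_piece by blast
qed

lemma fin_dim_piece_below:
  assumes "\<And>i. finite {b \<in> B. \<delta> b = i}"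
  shows "fin_dim_subspace fscale (piece_below B \<delta> i d :: ('k::field) fam3 set)"
  using fs.fin_dim_subspace_mono[OF fin_dim_piece[OF assms] subspace_piece_below piece_below_subset] .

text \<open>
  On elements supported on basis elements of degree at most \<open>i\<close>, a map of degree zero acts on these
  coordinates through the constant terms of its matrix alone; see \<open>tensor_diff_eq\<close> below.
\<close>

definition coords :: "(nat \<Rightarrow> nat) \<Rightarrow> nat \<Rightarrow> mon3 \<Rightarrow> ('k::field) fam3 \<Rightarrow> (nat \<Rightarrow>\<^sub>0 'k)" where
  "coords \<delta> i t v = Poly_Mapping.mapp (\<lambda>b p. if \<delta> b = i then lookup p t else 0) v"

definition lift_coords :: "mon3 \<Rightarrow> (nat \<Rightarrow>\<^sub>0 'k::field) \<Rightarrow> 'k fam3" where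
  "lift_coords t u = Poly_Mapping.map (Poly_Mapping.single t) u"

lemma lookup_coords [simp]: "lookup (coords \<delta> i t v) b = (if \<delta> b = i then lookup (lookup v b) t else 0)"
  by (auto simp: coords_def lookup_mapp when_def in_keys_iff)

lemma lookup_lift_coords [simp]: "lookup (lift_coords t u) b = Poly_Mapping.single t (lookup u b)"
  by (simp add: lift_coords_def lookup_map_zero)

lemma linear_coords: "Vector_Spaces.linear fscale pscale (coords \<delta> i t)"
  by (rule Vector_Spaces.linear_iff[THEN iffD2])
     (auto intro!: poly_mapping_eqI simp: lookup_add fs.vector_space_axioms ps.vector_space_axioms)

lemma coords_add: "coords \<delta> i t (v + w) = coords \<delta> i t v + coords \<delta> i t w"
  and coords_diff: "coords \<delta> i t (v - w) = coords \<delta> i t v - coords \<delta> i t w"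
  and coords_zero [simp]: "coords \<delta> i t 0 = 0"
  by (auto intro!: poly_mapping_eqI simp: lookup_add lookup_minus)

lemma coords_sum: "coords \<delta> i t (sum f A) = (\<Sum>x\<in>A. coords \<delta> i t (f x))"
  by (induction A rule: infinite_finite_induct) (auto simp: coords_add)

lemma coords_piece_below: "v \<in> piece_below B \<delta> i d \<Longrightarrow> coords \<delta> i t v = 0"
  by (rule poly_mapping_eqI) (metis lookup_coords lookup_zero less_irrefl piece_below_iff)

lemma coords_supported: "v \<in> piece B \<delta> d \<Longrightarrow> coords \<delta> i t v \<in> supported_on {b \<in> B. \<delta> b = i}"
  unfolding supported_on_iff by (metis (mono_tags, lifting) lookup_coords lookup_zero mem_Collect_eq piece_iff)

lemma piece_below_if_coords_zero:
  assumes "v \<in> piece_below B \<delta> (Suc i) d" "\<And>t. t \<in> mons (d - i) \<Longrightarrow> coords \<delta> i t v = 0"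
  shows "v \<in> piece_below B \<delta> i d"
proof -
  have "\<delta> b < i" if b: "lookup v b \<noteq> 0" for b
  proof (rule ccontr)
    assume "\<not> \<delta> b < i"
    then have e: "\<delta> b = i" using assms(1) b by (auto simp: piece_below_iff less_Suc_eq)
    have h: "lookup v b \<in> homog (d - i)"
      using assms(1) b e by (auto simp: piece_below_iff piece_iff)
    have "lookup (lookup v b) t = 0" for t
    proof (cases "t \<in> mons (d - i)")
      case True
      then show ?thesis using assms(2)[OF True] e by (metis lookup_coords lookup_zero)
    next
      case False
      then show ?thesis using h by (auto simp: homog_iff mons_def)
    qed
    then show False using b by (metis poly_mapping_eqI lookup_zero)
  qed
  then show ?thesis using assms(1) by (auto simp: piece_below_iff)
qed

lemma lift_coords_piece:
  assumes "u \<in> supported_on {b \<in> B. \<delta> b = i}" "mdeg t + i = d"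
  shows "lift_coords t u \<in> piece_below B \<delta> (Suc i) d"
proof -
  have "b \<in> B \<and> \<delta> b = i" if "lookup (lift_coords t u) b \<noteq> 0" for b
  proof -
    have "lookup u b \<noteq> 0" using that by auto
    then show ?thesis using assms(1) by (auto simp: supported_on_iff)
  qed
  then show ?thesis
    using assms(2) by (fastforce simp: piece_below_iff piece_iff intro: homog_single)
qed

lemma coords_lift_coords:
  assumes "u \<in> supported_on {b \<in> B. \<delta> b = i}"
  shows "coords \<delta> i s (lift_coords t u) = (if s = t then u else 0)"
  using assms by (auto intro!: poly_mapping_eqI simp: supported_on_iff lookup_single when_def)

lemma smult_piece:
  assumes "v \<in> piece B \<delta> e" "r \<in> homog m" "e + m = d"
  shows "smult_fam r v \<in> piece B \<delta> d"
  unfolding piece_iff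
proof (intro allI impI)
  fix b assume b: "lookup (smult_fam r v) b \<noteq> 0"
  then have v: "b \<in> B" "\<delta> b \<le> e" "lookup v b \<in> homog (e - \<delta> b)"
    using assms(1) by (auto simp: piece_iff)
  have "m + (e - \<delta> b) = d - \<delta> b" using v(2) assms(3) by simp
  then show "b \<in> B \<and> \<delta> b \<le> d \<and> lookup (smult_fam r v) b \<in> homog (d - \<delta> b)"
    using v assms(3) homog_mult[OF assms(2) v(3)] by auto
qed

lemma smult_piece_below:
  assumes "v \<in> piece_below B \<delta> i e" "r \<in> homog m" "e + m = d"
  shows "smult_fam r v \<in> piece_below B \<delta> i d"
  using smult_piece[OF _ assms(2,3)] assms(1) by (auto simp: piece_below_iff)

lemma dim_piece_below_Suc:
  assumes fin: "\<And>i. finite {b \<in> B. \<delta> b = i}" and "i \<le> d"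
  shows "fs.dim (piece_below B \<delta> (Suc i) d :: ('k::field) fam3 set)
    = card (mons (d - i)) * card {b \<in> B. \<delta> b = i} + fs.dim (piece_below B \<delta> i d :: 'k fam3 set)"
proof -
  let ?X = "piece_below B \<delta> (Suc i) d :: 'k fam3 set"
  have ker: "{x \<in> ?X. \<forall>t\<in>mons (d - i). coords \<delta> i t x = 0} = piece_below B \<delta> i d"
    using piece_below_if_coords_zero piece_below_mono[of i "Suc i"] coords_piece_below by fastforce
  have "fs.dim ?X = card (mons (d - i)) * ps.dim (supported_on {b \<in> B. \<delta> b = i} :: (nat \<Rightarrow>\<^sub>0 'k) set)
    + fs.dim {x \<in> ?X. \<forall>t\<in>mons (d - i). coords \<delta> i t x = 0}"
  proof (rule fsps.dim_split_off_coordinates[THEN conjunct1])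
    show "fin_dim_subspace fscale ?X" using fin by (rule fin_dim_piece_below)
    show "Vector_Spaces.linear fscale pscale (coords \<delta> i t)" for t by (rule linear_coords)
    show "coords \<delta> i t x \<in> supported_on {b \<in> B. \<delta> b = i}" if "x \<in> ?X" for x t
      using that coords_supported piece_below_subset by blast
    show "\<exists>x\<in>?X. coords \<delta> i t x = w \<and> (\<forall>s\<in>mons (d - i) - {t}. coords \<delta> i s x = 0)"
      if "t \<in> mons (d - i)" "w \<in> supported_on {b \<in> B. \<delta> b = i}" for t and w :: "nat \<Rightarrow>\<^sub>0 'k"
    proof (rule bexI[of _ "lift_coords t w"])
      show "lift_coords t w \<in> ?X"
        using that assms(2) by (intro lift_coords_piece) (auto simp: mons_def)
      show "coords \<delta> i t (lift_coords t w) = w \<and>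
          (\<forall>s\<in>mons (d - i) - {t}. coords \<delta> i s (lift_coords t w) = 0)"
        using coords_lift_coords[OF that(2)] by auto
    qed
  qed simp
  then show ?thesis
    unfolding ker dim_supported_on[OF fin] .
qed

lemma dim_piece:
  assumes fin: "\<And>i. finite {b \<in> B. \<delta> b = i}"
  shows "fs.dim (piece B \<delta> d :: ('k::field) fam3 set)
    = (\<Sum>i\<le>d. card (mons (d - i)) * card {b \<in> B. \<delta> b = i})"
proof -
  have "fs.dim (piece_below B \<delta> j d :: 'k fam3 set)
      = (\<Sum>i<j. card (mons (d - i)) * card {b \<in> B. \<delta> b = i})" if "j \<le> Suc d" for j
    using that
  proof (induction j)
    case 0
    show ?case by simp
  next
    case (Suc j)
    have "fs.dim (piece_below B \<delta> (Suc j) d :: 'k fam3 set)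
      = card (mons (d - j)) * card {b \<in> B. \<delta> b = j} + fs.dim (piece_below B \<delta> j d :: 'k fam3 set)"
      using Suc.prems by (intro dim_piece_below_Suc[OF fin]) simp
    then show ?case using Suc by simp
  qed
  from this[of "Suc d"] show ?thesis
    by (simp add: piece_below_all lessThan_Suc_atMost)
qed

definition fam_component :: "(nat \<Rightarrow> nat) \<Rightarrow> nat \<Rightarrow> ('k::field) fam3 \<Rightarrow> 'k fam3" where
  "fam_component \<delta> d v = Poly_Mapping.mapp (\<lambda>b p. if \<delta> b \<le> d then hom_component (d - \<delta> b) p else 0) v"

lemma lookup_fam_component [simp]:
  "lookup (fam_component \<delta> d v) b = (if \<delta> b \<le> d then hom_component (d - \<delta> b) (lookup v b) else 0)"
  by (auto simp: fam_component_def lookup_mapp when_def in_keys_iff)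

lemma fam_component_piece: "v \<in> free_on B \<Longrightarrow> fam_component \<delta> d v \<in> piece B \<delta> d"
  unfolding piece_iff
proof (intro allI impI)
  fix b assume "v \<in> free_on B" and b: "lookup (fam_component \<delta> d v) b \<noteq> 0"
  moreover have "lookup v b \<noteq> 0"
  proof
    assume "lookup v b = 0"
    then have "lookup (fam_component \<delta> d v) b = 0" by simp
    then show False using b by blast
  qed
  ultimately show "b \<in> B \<and> \<delta> b \<le> d \<and> lookup (fam_component \<delta> d v) b \<in> homog (d - \<delta> b)"
    by (auto simp: free_on_def in_keys_iff split: if_splits)
qed

lemma fam_component_of_piece: "v \<in> piece B \<delta> d \<Longrightarrow> fam_component \<delta> d v = v"
proof (rule poly_mapping_eqI)
  fix b assume "v \<in> piece B \<delta> d"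
  then show "lookup (fam_component \<delta> d v) b = lookup v b"
    by (cases "lookup v b = 0") (auto simp: piece_iff hom_component_of_homog)
qed

lemma piece_subset_free_on: "piece B \<delta> d \<subseteq> free_on B"
  by (auto simp: piece_def free_on_def)

text \<open>
  The matrix entry from \<open>b\<close> to \<open>c\<close> is homogeneous of degree \<open>\<delta> b - \<gamma> c\<close>, which is the difference of the
  shifts in the two free modules.
\<close>

lemma lin_ext_fam_component:
  assumes "\<And>b. b \<in> B \<Longrightarrow> \<phi> b \<in> piece C \<gamma> (\<delta> b)" "v \<in> free_on B"
  shows "lin_ext \<phi> (fam_component \<delta> d v) = fam_component \<gamma> d (lin_ext \<phi> v)"
proof (rule poly_mapping_eqI)
  fix c
  have k: "keys (fam_component \<delta> d v) \<subseteq> keys v"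
    by (auto simp: in_keys_iff split: if_splits)
  have "lookup (lin_ext \<phi> (fam_component \<delta> d v)) c
      = (\<Sum>b\<in>keys v. lookup (fam_component \<delta> d v) b * lookup (\<phi> b) c)"
    using k by (intro lookup_lin_ext) auto
  also have "\<dots> = (\<Sum>b\<in>keys v. if \<gamma> c \<le> d then hom_component (d - \<gamma> c) (lookup v b * lookup (\<phi> b) c) else 0)"
  proof (rule sum.cong[OF refl])
    fix b assume "b \<in> keys v"
    then have b: "b \<in> B" using assms(2) by (auto simp: free_on_def)
    show "lookup (fam_component \<delta> d v) b * lookup (\<phi> b) c
        = (if \<gamma> c \<le> d then hom_component (d - \<gamma> c) (lookup v b * lookup (\<phi> b) c) else 0)"
    proof (cases "lookup (\<phi> b) c = 0")
      case False
      then have g: "\<gamma> c \<le> \<delta> b" "lookup (\<phi> b) c \<in> homog (\<delta> b - \<gamma> c)"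
        using assms(1)[OF b] by (auto simp: piece_iff)
      have "\<delta> b - \<gamma> c \<le> d - \<gamma> c \<longleftrightarrow> \<delta> b \<le> d" if "\<gamma> c \<le> d" using g(1) that by auto
      moreover have "d - \<gamma> c - (\<delta> b - \<gamma> c) = d - \<delta> b" using g(1) by simp
      ultimately show ?thesis
        using g by (simp add: hom_component_mult_homog[OF g(2)])
    qed simp
  qed
  also have "\<dots> = lookup (fam_component \<gamma> d (lin_ext \<phi> v)) c"
    by (simp add: lookup_lin_ext[of "keys v" v] hom_component_sum)
  finally show "lookup (lin_ext \<phi> (fam_component \<delta> d v)) c = lookup (fam_component \<gamma> d (lin_ext \<phi> v)) c" .
qed

lemma lin_ext_piece:
  assumes "\<And>b. b \<in> B \<Longrightarrow> \<phi> b \<in> piece C \<gamma> (\<delta> b)" "v \<in> piece B \<delta> d"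
  shows "lin_ext \<phi> v \<in> piece C \<gamma> d"
proof -
  have "lin_ext \<phi> v = (\<Sum>b\<in>keys v. smult_fam (lookup v b) (\<phi> b))"
    by (simp add: lin_ext_def)
  also have "\<dots> \<in> piece C \<gamma> d"
  proof (rule fs.subspace_sum[OF subspace_piece])
    fix b assume "b \<in> keys v"
    then have b: "b \<in> B" "\<delta> b \<le> d" "lookup v b \<in> homog (d - \<delta> b)"
      using assms(2) by (auto simp: piece_def)
    show "smult_fam (lookup v b) (\<phi> b) \<in> piece C \<gamma> d"
      by (rule smult_piece[OF assms(1)[OF b(1)] b(3)]) (use b(2) in simp)
  qed
  finally show ?thesis .
qed

lemma lin_ext_piece_below:
  assumes "\<And>b. b \<in> B \<Longrightarrow> \<phi> b \<in> piece C \<gamma> (\<delta> b)" "v \<in> piece_below B \<delta> i d"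
  shows "lin_ext \<phi> v \<in> piece_below C \<gamma> i d"
proof -
  have "lin_ext \<phi> v = (\<Sum>b\<in>keys v. smult_fam (lookup v b) (\<phi> b))"
    by (simp add: lin_ext_def)
  also have "\<dots> \<in> piece_below C \<gamma> i d"
  proof (rule fs.subspace_sum[OF subspace_piece_below])
    fix b assume "b \<in> keys v"
    then have b: "b \<in> B" "\<delta> b \<le> d" "lookup v b \<in> homog (d - \<delta> b)" "\<delta> b < i"
      using assms(2) by (auto simp: piece_below_def piece_def)
    then have "\<phi> b \<in> piece_below C \<gamma> i (\<delta> b)"
      using assms(1)[OF b(1)] b(4) unfolding piece_below_iff piece_iff by (meson le_less_trans)
    then show "smult_fam (lookup v b) (\<phi> b) \<in> piece_below C \<gamma> i d"
      by (rule smult_piece_below[OF _ b(3)]) (use b(2) in simp)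
  qed
  finally show ?thesis .
qed

section \<open>Betti numbers determine the Hilbert function\<close>

lemma homog_0_eq: "p \<in> homog 0 \<Longrightarrow> p = Poly_Mapping.single 0 (lookup p 0)"
  by (rule poly_mapping_eqI) (metis homog_iff lookup_single_eq lookup_single_not_eq mdeg_eq_zero_iff)

text \<open>
  Matrix entries between basis elements of the same degree are constants, and basis elements of
  degree less than \<open>i\<close> do not map to basis elements of degree \<open>i\<close>.
\<close>

lemma tensor_diff_eq:
  assumes "\<And>b. b \<in> B \<Longrightarrow> \<phi> b \<in> piece C \<gamma> (\<delta> b)" "v \<in> piece_below B \<delta> (Suc i) d"
  shows "coords \<gamma> i t (lin_ext \<phi> v)
    = lin_ext (\<lambda>b. Poly_Mapping.map (\<lambda>p. lookup p 0) (\<phi> b)) (coords \<delta> i t v)"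
proof (rule poly_mapping_eqI)
  fix c
  have k: "keys (coords \<delta> i t v) \<subseteq> keys v"
    by (auto simp: in_keys_iff split: if_splits)
  have "lookup (coords \<gamma> i t (lin_ext \<phi> v)) c
      = (\<Sum>b\<in>keys v. if \<gamma> c = i then lookup (lookup v b * lookup (\<phi> b) c) t else 0)"
    by (simp add: lookup_lin_ext[of "keys v" v] lookup_sum)
  also have "\<dots> = (\<Sum>b\<in>keys v. lookup (coords \<delta> i t v) b * lookup (lookup (\<phi> b) c) 0)"
  proof (rule sum.cong[OF refl])
    fix b assume "b \<in> keys v"
    then have b: "b \<in> B" "\<delta> b \<le> i"
      using assms(2) by (auto simp: piece_below_def piece_def)
    show "(if \<gamma> c = i then lookup (lookup v b * lookup (\<phi> b) c) t else 0)
        = lookup (coords \<delta> i t v) b * lookup (lookup (\<phi> b) c) 0"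
    proof (cases "lookup (\<phi> b) c = 0")
      case False
      then have g: "\<gamma> c \<le> \<delta> b" "lookup (\<phi> b) c \<in> homog (\<delta> b - \<gamma> c)"
        using assms(1)[OF b(1)] by (auto simp: piece_iff)
      show ?thesis
      proof (cases "\<gamma> c = i")
        case True
        then have "\<delta> b = i" using g(1) b(2) by simp
        then have "lookup (\<phi> b) c \<in> homog 0" using g(2) True by simp
        then have eq: "lookup v b * lookup (\<phi> b) c = Poly_Mapping.single 0 (lookup (lookup (\<phi> b) c) 0) * lookup v b"
          using homog_0_eq mult.commute by metis
        have "lookup (lookup v b * lookup (\<phi> b) c) t = lookup (lookup (\<phi> b) c) 0 * lookup (lookup v b) t"
          unfolding eq using lookup_single_mult_add[of 0 _ "lookup v b" t] by simp
        then show ?thesis using True \<open>\<delta> b = i\<close> by simp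
      next
        case False
        have "lookup (lookup (\<phi> b) c) 0 = 0" if "\<delta> b = i"
          using g that False by (auto simp: homog_iff)
        then show ?thesis using False by simp
      qed
    qed simp
  qed
  also have "\<dots> = lookup (lin_ext (\<lambda>b. Poly_Mapping.map (\<lambda>p. lookup p 0) (\<phi> b)) (coords \<delta> i t v)) c"
    by (subst lookup_lin_ext[OF _ k]) (auto simp: lookup_map_zero)
  finally show "lookup (coords \<gamma> i t (lin_ext \<phi> v)) c
    = lookup (lin_ext (\<lambda>b. Poly_Mapping.map (\<lambda>p. lookup p 0) (\<phi> b)) (coords \<delta> i t v)) c" .
qed

lemma aug_map_eq: "aug_map F v = lookup (lin_ext (\<lambda>b. Poly_Mapping.single 0 (aug F b)) v) 0"
  by (simp add: aug_map_def lin_ext_def lookup_sum)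

locale graded_resolution =
  fixes F :: "('k::field) graded_free_complex" and K :: "'k poly3 set"
  assumes resolution: "graded_free_resolution F K"
begin

abbreviation "D q \<equiv> lin_ext (diff F q)"
abbreviation P :: "nat \<Rightarrow> nat \<Rightarrow> 'k fam3 set" where
  "P q d \<equiv> piece (basis F q) (bdeg F q) d"
abbreviation below :: "nat \<Rightarrow> nat \<Rightarrow> nat \<Rightarrow> 'k fam3 set" where
  "below q i d \<equiv> piece_below (basis F q) (bdeg F q) i d"
abbreviation "gens q i \<equiv> {b \<in> basis F q. bdeg F q b = i}"

lemma free_mod_piece_eq: "free_mod_piece F q d = P q d"
  unfolding free_mod_piece_def free_mod_def free_on_def piece_def by auto

lemmas conditions = resolution[unfolded graded_free_resolution_def free_mod_piece_eq free_mod_def]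

lemma finite_gens [simp]: "finite (gens q i)"
  using conditions[THEN conjunct1] by simp

lemma aug_homog: "b \<in> basis F 0 \<Longrightarrow> aug F b \<in> homog (bdeg F 0 b)"
  using conditions[THEN conjunct2, THEN conjunct1] by simp

lemma diff_piece: "b \<in> basis F (Suc q) \<Longrightarrow> diff F q b \<in> P q (bdeg F (Suc q) b)"
  using conditions[THEN conjunct2, THEN conjunct2, THEN conjunct1] by simp

lemma aug_image: "aug_map F ` free_on (basis F 0) = K"
  using conditions[THEN conjunct2, THEN conjunct2, THEN conjunct2, THEN conjunct1] .

lemma exact_aug: "{v \<in> free_on (basis F 0). aug_map F v = 0} = D 0 ` free_on (basis F (Suc 0))"
  using conditions[THEN conjunct2, THEN conjunct2, THEN conjunct2, THEN conjunct2, THEN conjunct1]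
  by simp

lemma exact: "{v \<in> free_on (basis F (Suc q)). D q v = 0} = D (Suc q) ` free_on (basis F (Suc (Suc q)))"
  using conditions[THEN conjunct2, THEN conjunct2, THEN conjunct2, THEN conjunct2, THEN conjunct2]
  by (rule spec)

lemma D_P: "v \<in> P (Suc q) d \<Longrightarrow> D q v \<in> P q d"
  using lin_ext_piece[OF diff_piece] .

lemma D_below: "v \<in> below (Suc q) i d \<Longrightarrow> D q v \<in> below q i d"
  using lin_ext_piece_below[OF diff_piece] .

lemma D_component: "v \<in> free_on (basis F (Suc q)) \<Longrightarrow>
    D q (fam_component (bdeg F (Suc q)) d v) = fam_component (bdeg F q) d (D q v)"
  using lin_ext_fam_component[OF diff_piece] .

lemma D_D: "v \<in> P (Suc (Suc q)) d \<Longrightarrow> D q (D (Suc q) v) = 0"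
  using exact[of q] piece_subset_free_on by blast

lemma D_diff: "D q (v - w) = D q v - D q w"
  using module_hom.diff[OF linear_lin_ext[unfolded Vector_Spaces.linear_iff_module_hom]] .

lemma D_sum: "D q (sum f A) = (\<Sum>x\<in>A. D q (f x))"
  by (induction A rule: infinite_finite_induct) (auto simp: lin_ext_add)

lemma exact_piece: "{v \<in> P (Suc q) d. D q v = 0} = D (Suc q) ` P (Suc (Suc q)) d"
proof
  show "{v \<in> P (Suc q) d. D q v = 0} \<subseteq> D (Suc q) ` P (Suc (Suc q)) d"
  proof
    fix v assume v: "v \<in> {v \<in> P (Suc q) d. D q v = 0}"
    then obtain u where u: "u \<in> free_on (basis F (Suc (Suc q)))" "v = D (Suc q) u"
      using exact[of q] piece_subset_free_on by blast
    have "v = D (Suc q) (fam_component (bdeg F (Suc (Suc q))) d u)"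
      unfolding D_component[OF u(1)] u(2)[symmetric]
      by (rule fam_component_of_piece[symmetric]) (use v in blast)
    then show "v \<in> D (Suc q) ` P (Suc (Suc q)) d"
      using fam_component_piece[OF u(1)] by blast
  qed
  show "D (Suc q) ` P (Suc (Suc q)) d \<subseteq> {v \<in> P (Suc q) d. D q v = 0}"
    using D_P D_D by blast
qed

lemma aug_piece:
  assumes "b \<in> basis F 0"
  shows "Poly_Mapping.single 0 (aug F b) \<in> piece {0::nat} (\<lambda>_. 0) (bdeg F 0 b)"
  using aug_homog[OF assms] unfolding piece_iff by (auto simp: lookup_single when_def)

lemma aug_component:
  assumes "v \<in> free_on (basis F 0)"
  shows "aug_map F (fam_component (bdeg F 0) d v) = hom_component d (aug_map F v)"
  unfolding aug_map_eq using lin_ext_fam_component[OF aug_piece assms, where d = d] by simp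

lemma exact_piece_aug: "{v \<in> P 0 d. aug_map F v = 0} = D 0 ` P (Suc 0) d"
proof
  show "{v \<in> P 0 d. aug_map F v = 0} \<subseteq> D 0 ` P (Suc 0) d"
  proof
    fix v assume v: "v \<in> {v \<in> P 0 d. aug_map F v = 0}"
    then obtain u where u: "u \<in> free_on (basis F (Suc 0))" "v = D 0 u"
      using exact_aug piece_subset_free_on by blast
    have "v = D 0 (fam_component (bdeg F (Suc 0)) d u)"
      unfolding D_component[OF u(1)] u(2)[symmetric]
      by (rule fam_component_of_piece[symmetric]) (use v in blast)
    then show "v \<in> D 0 ` P (Suc 0) d"
      using fam_component_piece[OF u(1)] by blast
  qed
  show "D 0 ` P (Suc 0) d \<subseteq> {v \<in> P 0 d. aug_map F v = 0}"
    using D_P exact_aug piece_subset_free_on by blast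
qed

lemma aug_image_piece: "aug_map F ` P 0 d = K \<inter> homog d"
proof
  have "aug_map F v \<in> K" if "v \<in> P 0 d" for v
    using that aug_image piece_subset_free_on by blast
  moreover have "aug_map F v \<in> homog d" if v: "v \<in> P 0 d" for v
  proof -
    have "v \<in> free_on (basis F 0)" using v piece_subset_free_on by blast
    then show ?thesis
      using aug_component[of v d] fam_component_of_piece[OF v] by (metis hom_component_homog)
  qed
  ultimately show "aug_map F ` P 0 d \<subseteq> K \<inter> homog d" by blast
  show "K \<inter> homog d \<subseteq> aug_map F ` P 0 d"
  proof
    fix f assume f: "f \<in> K \<inter> homog d"
    then obtain v where v: "v \<in> free_on (basis F 0)" "f = aug_map F v"
      using aug_image by blast
    have "f = aug_map F (fam_component (bdeg F 0) d v)"
      using f v hom_component_of_homog[of f d d] by (simp add: aug_component)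
    then show "f \<in> aug_map F ` P 0 d"
      using fam_component_piece[OF v(1)] by blast
  qed
qed

lemma linear_aug: "Vector_Spaces.linear fscale pscale (aug_map F)"
  unfolding aug_map_eq
  by (rule Vector_Spaces.linear_iff[THEN iffD2])
    (auto simp: lin_ext_add fscale_def lin_ext_smult lookup_add pscale_eq_mult
      fs.vector_space_axioms ps.vector_space_axioms)

lemma tensor_piece_eq: "tensor_piece F q i = supported_on (gens q i)"
  by (simp add: tensor_piece_def free_on_def supported_on_def)

lemma coords_D:
  "v \<in> below (Suc q) (Suc i) d \<Longrightarrow>
    coords (bdeg F q) i t (D q v) = tensor_diff F q (coords (bdeg F (Suc q)) i t v)"
  unfolding tensor_diff_def by (rule tensor_diff_eq[OF diff_piece])

lemma tensor_diff_piece: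
  assumes "u \<in> tensor_piece F (Suc q) i"
  shows "tensor_diff F q u \<in> tensor_piece F q i"
proof -
  let ?v = "lift_coords 0 u"
  have v: "?v \<in> below (Suc q) (Suc i) i"
    using assms unfolding tensor_piece_eq by (rule lift_coords_piece) simp
  have "tensor_diff F q u = coords (bdeg F q) i 0 (D q ?v)"
    unfolding coords_D[OF v] using coords_lift_coords[OF assms[unfolded tensor_piece_eq], of 0 0] by simp
  moreover have "D q ?v \<in> P q i"
    using D_P v piece_below_subset by blast
  ultimately show ?thesis
    unfolding tensor_piece_eq by (simp add: coords_supported)
qed

lemma tensor_diff_diff:
  assumes "u \<in> tensor_piece F (Suc (Suc q)) i"
  shows "tensor_diff F q (tensor_diff F (Suc q) u) = 0"
proof -
  let ?v = "lift_coords 0 u"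
  have v: "?v \<in> below (Suc (Suc q)) (Suc i) i"
    using assms unfolding tensor_piece_eq by (rule lift_coords_piece) simp
  have u: "coords (bdeg F (Suc (Suc q))) i 0 ?v = u"
    using coords_lift_coords[OF assms[unfolded tensor_piece_eq], of 0 0] by simp
  have "tensor_diff F q (tensor_diff F (Suc q) u) = coords (bdeg F q) i 0 (D q (D (Suc q) ?v))"
    using coords_D[OF v, of 0] coords_D[OF D_below[OF v], of 0] u by simp
  moreover have "?v \<in> P (Suc (Suc q)) i"
    using v piece_below_subset by blast
  ultimately show ?thesis
    using D_D by simp
qed

lemma linear_tensor_diff: "Vector_Spaces.linear pscale pscale (tensor_diff F q)"
  unfolding tensor_diff_def by (rule linear_lin_ext_scalar)

text \<open>
  The subcomplex spanned by the basis elements of degree less than \<open>i\<close> is exact from homological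
  degree \<open>i\<close> on: the leading coefficients of a cycle, those at the basis elements of degree
  \<open>i - 1\<close>, are cycles of the complex tensored with \<open>k\<close>, and each of them can be completed to a
  cycle of internal degree \<open>i - 1\<close>. Such a cycle is a boundary of the subcomplex, because all basis
  elements that occur in degree \<open>i - 1\<close> belong to it.
\<close>

lemma below_exact:
  assumes "i \<le> q" "z \<in> below q i d" "\<And>p. q = Suc p \<Longrightarrow> D p z = 0"
  shows "z \<in> D q ` below (Suc q) i d"
  using assms
proof (induction i arbitrary: q z d)
  case 0
  then show ?case by simp
next
  case (Suc i)
  then obtain p where q: "q = Suc p" and ip: "i \<le> p"
    by (cases q) auto
  let ?\<delta> = "bdeg F q"
  have Dz: "D p z = 0" using Suc.prems(3) q by blast
  show ?case
  proof (cases "i \<le> d")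
    case False
    then have "z \<in> below q i d"
      using Suc.prems(2) by (simp add: piece_below_all)
    then have "z \<in> D q ` below (Suc q) i d"
      using Suc.IH[of q z d] Suc.prems(1,3) by simp
    then show ?thesis
      using piece_below_Suc by blast
  next
    case True
    \<comment> \<open>the leading coefficients of \<open>z\<close>, one vector for each monomial\<close>
    define c where "c t = coords ?\<delta> i t z" for t
    have c_supp: "c t \<in> supported_on (gens q i)" for t
      unfolding c_def using Suc.prems(2) coords_supported piece_below_subset by blast
    have "\<exists>u w. u \<in> below (Suc q) (Suc i) i \<and> w \<in> below q i i \<and> D q u = lift_coords 0 (c t) - w" for t
    proof -
      let ?l = "lift_coords 0 (c t)"
      have l: "?l \<in> below q (Suc i) i"
        using c_supp by (rule lift_coords_piece) simp
      have Dl: "D p ?l \<in> below p (Suc i) i"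
        using l q D_below by simp
      have "D p ?l \<in> below p i i"
      proof (rule piece_below_if_coords_zero[OF Dl])
        fix s assume "s \<in> mons (i - i)"
        then have s: "s = 0" by simp
        have "coords (bdeg F p) i 0 (D p ?l) = tensor_diff F p (c t)"
          using coords_D[of ?l p i i 0] l q coords_lift_coords[OF c_supp] by simp
        also have "\<dots> = coords (bdeg F p) i t (D p z)"
          unfolding c_def using coords_D[of z p i d t] Suc.prems(2) q by simp
        finally show "coords (bdeg F p) i s (D p ?l) = 0"
          using Dz s by simp
      qed
      moreover have "D p' (D p ?l) = 0" if "p = Suc p'" for p'
        using D_D[of ?l p' i] l q that piece_below_subset by blast
      ultimately have "D p ?l \<in> D p ` below (Suc p) i i"
        using Suc.IH[OF ip] by blast
      then obtain w where w: "w \<in> below q i i" "D p ?l = D p w"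
        using q by blast
      have "?l \<in> P (Suc p) i" "w \<in> P (Suc p) i"
        using l w(1) q piece_below_subset by blast+
      then have "?l - w \<in> {v \<in> P (Suc p) i. D p v = 0}"
        using w(2) fs.subspace_diff[OF subspace_piece] by (auto simp: D_diff)
      then obtain u where "u \<in> P (Suc q) i" and u: "?l - w = D q u"
        unfolding exact_piece using q by blast
      then have "u \<in> below (Suc q) (Suc i) i"
        by (simp add: piece_below_all)
      then show ?thesis
        using w(1) u by (intro exI[of _ u] exI[of _ w]) simp
    qed
    then obtain u w where u: "\<And>t. u t \<in> below (Suc q) (Suc i) i" and w: "\<And>t. w t \<in> below q i i"
      and uw: "\<And>t. D q (u t) = lift_coords 0 (c t) - w t"
      by metis
    \<comment> \<open>\<open>U\<close> is mapped to an element with the same leading coefficients as \<open>z\<close>.\<close>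
    let ?T = "mons (d - i)"
    define U where "U = (\<Sum>t\<in>?T. smult_fam (mono_poly t) (u t))"
    have tT: "mono_poly t \<in> homog (d - i)" if "t \<in> ?T" for t :: mon3
      using that by (auto simp: mons_def intro: homog_single)
    have U: "U \<in> below (Suc q) (Suc i) d"
      unfolding U_def
      by (rule fs.subspace_sum[OF subspace_piece_below], rule smult_piece_below[OF u tT])
        (use True in auto)
    have DU: "D q U = (\<Sum>t\<in>?T. lift_coords t (c t) - smult_fam (mono_poly t) (w t))"
      unfolding U_def D_sum lin_ext_smult uw
    proof (rule sum.cong[OF refl], rule poly_mapping_eqI)
      fix t b
      show "lookup (smult_fam (mono_poly t) (lift_coords 0 (c t) - w t)) b
          = lookup (lift_coords t (c t) - smult_fam (mono_poly t) (w t)) b"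
        by (simp add: lookup_minus algebra_simps mult_single)
    qed
    have zU: "z - D q U \<in> below q (Suc i) d"
      using fs.subspace_diff[OF subspace_piece_below Suc.prems(2) D_below[OF U]] .
    have "z - D q U \<in> below q i d"
    proof (rule piece_below_if_coords_zero[OF zU])
      fix s assume s: "s \<in> ?T"
      have "coords ?\<delta> i s (smult_fam (mono_poly t) (w t)) = 0" if "t \<in> ?T" for t
        by (rule coords_piece_below, rule smult_piece_below[OF w tT[OF that]]) (use True in simp)
      then have "coords ?\<delta> i s (D q U) = (\<Sum>t\<in>?T. if s = t then c t else 0)"
        unfolding DU coords_sum coords_diff
        by (intro sum.cong refl) (simp add: coords_lift_coords[OF c_supp])
      also have "\<dots> = c s" using s by simp
      finally show "coords ?\<delta> i s (z - D q U) = 0"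
        by (simp add: coords_diff c_def)
    qed
    moreover have "D p' (z - D q U) = 0" if "q = Suc p'" for p'
    proof -
      have "U \<in> P (Suc (Suc p')) d" using U that piece_below_subset by blast
      then show ?thesis using D_D Suc.prems(3)[OF that] that by (simp add: D_diff)
    qed
    ultimately obtain w' where w': "w' \<in> below (Suc q) i d" "z - D q U = D q w'"
      using Suc.IH[of q "z - D q U" d] Suc.prems(1) by fastforce
    have "z = D q (w' + U)" using w'(2) by (simp add: lin_ext_add algebra_simps)
    moreover have "w' + U \<in> below (Suc q) (Suc i) d"
      using w'(1) U piece_below_Suc
      by (intro fs.subspace_add[OF subspace_piece_below]) auto
    ultimately show ?thesis by blast
  qed
qed

lemma fin_dim_P [simp]: "fin_dim_subspace fscale (P q d)"
  by (rule fin_dim_piece) simp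

lemma fin_dim_below [simp]: "fin_dim_subspace fscale (below q i d)"
  by (rule fin_dim_piece_below) simp

lemma fin_dim_tensor_piece [simp]: "fin_dim_subspace pscale (tensor_piece F q i)"
  unfolding tensor_piece_eq by (rule fin_dim_supported_on) simp

text \<open>
  A boundary with vanishing leading coefficients is again a boundary of elements of lower filtration
  degree, by \<open>below_exact\<close>; so the leading coefficients account for the whole difference.
\<close>

lemma dim_boundaries_below:
  assumes "i \<le> q" "i \<le> d"
  shows "fs.dim (D q ` below (Suc q) (Suc i) d)
    = card (mons (d - i)) * ps.dim (tensor_boundaries F q i) + fs.dim (D q ` below (Suc q) i d)"
proof -
  let ?X = "D q ` below (Suc q) (Suc i) d" and ?c = "coords (bdeg F q) i"
  let ?T = "mons (d - i)" and ?B = "tensor_boundaries F q i"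
  have ker: "{x \<in> ?X. \<forall>t\<in>?T. ?c t x = 0} = D q ` below (Suc q) i d"
  proof
    show "{x \<in> ?X. \<forall>t\<in>?T. ?c t x = 0} \<subseteq> D q ` below (Suc q) i d"
    proof
      fix x assume x: "x \<in> {x \<in> ?X. \<forall>t\<in>?T. ?c t x = 0}"
      then obtain v where v: "v \<in> below (Suc q) (Suc i) d" "x = D q v" by blast
      have "x \<in> below q i d"
        unfolding v(2) by (rule piece_below_if_coords_zero[OF D_below[OF v(1)]]) (use x v(2) in simp)
      moreover have "D p x = 0" if "q = Suc p" for p
        using D_D v that piece_below_subset by blast
      ultimately show "x \<in> D q ` below (Suc q) i d"
        using below_exact[OF assms(1)] by blast
    qed
    show "D q ` below (Suc q) i d \<subseteq> {x \<in> ?X. \<forall>t\<in>?T. ?c t x = 0}"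
    proof
      fix x assume "x \<in> D q ` below (Suc q) i d"
      then obtain v where v: "v \<in> below (Suc q) i d" "x = D q v" by blast
      then show "x \<in> {x \<in> ?X. \<forall>t\<in>?T. ?c t x = 0}"
        using piece_below_Suc[OF v(1)] coords_piece_below[OF D_below[OF v(1)]] by simp
    qed
  qed
  have "fs.dim ?X = card ?T * ps.dim ?B + fs.dim {x \<in> ?X. \<forall>t\<in>?T. ?c t x = 0}"
  proof (rule fsps.dim_split_off_coordinates[THEN conjunct1])
    show "fin_dim_subspace fscale ?X"
      by (rule fsfs.fin_dim_subspace_image[OF linear_lin_ext fin_dim_below])
    show "Vector_Spaces.linear fscale pscale (?c t)" for t by (rule linear_coords)
    show "?c t x \<in> ?B" if x: "x \<in> ?X" for x t
    proof -
      obtain v where v: "v \<in> below (Suc q) (Suc i) d" "x = D q v" using x by blast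
      have "coords (bdeg F (Suc q)) i t v \<in> tensor_piece F (Suc q) i"
        unfolding tensor_piece_eq using v(1) coords_supported piece_below_subset by blast
      then show ?thesis
        unfolding tensor_boundaries_def v(2) coords_D[OF v(1)] by blast
    qed
    show "\<exists>x\<in>?X. ?c t x = w \<and> (\<forall>s\<in>?T - {t}. ?c s x = 0)" if t: "t \<in> ?T" and w: "w \<in> ?B" for t w
    proof -
      obtain u where u: "u \<in> supported_on (gens (Suc q) i)" "w = tensor_diff F q u"
        using w unfolding tensor_boundaries_def tensor_piece_eq by blast
      have l: "lift_coords t u \<in> below (Suc q) (Suc i) d"
        using u(1) by (rule lift_coords_piece) (use t assms(2) in \<open>auto simp: mons_def\<close>)
      have z: "tensor_diff F q 0 = 0" by (simp add: tensor_diff_def)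
      have "?c s (D q (lift_coords t u)) = (if s = t then w else 0)" for s
        unfolding coords_D[OF l] coords_lift_coords[OF u(1)] using u(2) z by simp
      then show ?thesis using l by (intro bexI[of _ "D q (lift_coords t u)"]) auto
    qed
  qed simp
  then show ?thesis unfolding ker .
qed

lemma dim_boundaries:
  assumes "d \<le> q"
  shows "fs.dim (D q ` P (Suc q) d) = (\<Sum>i\<le>d. card (mons (d - i)) * ps.dim (tensor_boundaries F q i))"
proof -
  have "fs.dim (D q ` below (Suc q) j d)
      = (\<Sum>i<j. card (mons (d - i)) * ps.dim (tensor_boundaries F q i))" if "j \<le> Suc d" for j
    using that
  proof (induction j)
    case 0
    show ?case by simp
  next
    case (Suc j)
    then show ?case using dim_boundaries_below[of j q d] assms by simp
  qed
  from this[of "Suc d"] show ?thesis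
    by (simp add: piece_below_all lessThan_Suc_atMost)
qed

text \<open>
  Homological degrees are shifted by one, so that the index \<open>0\<close> stands for the augmentation: its
  image is \<open>K\<close>, and it contributes no boundaries after tensoring with \<open>k\<close>.
\<close>

definition cycle_dim :: "nat \<Rightarrow> nat \<Rightarrow> nat" where
  "cycle_dim q d = (case q of 0 \<Rightarrow> ps.dim (K \<inter> homog d) | Suc p \<Rightarrow> fs.dim (D p ` P (Suc p) d))"

definition tensor_boundary_dim :: "nat \<Rightarrow> nat \<Rightarrow> nat" where
  "tensor_boundary_dim q i = (case q of 0 \<Rightarrow> 0 | Suc p \<Rightarrow> ps.dim (tensor_boundaries F p i))"

definition betti :: "nat \<Rightarrow> nat \<Rightarrow> nat" where
  "betti q i = ps.dim (tensor_cycles F q i) - ps.dim (tensor_boundaries F q i)"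

lemma dim_P: "fs.dim (P q d) = cycle_dim q d + cycle_dim (Suc q) d"
proof (cases q)
  case 0
  then show ?thesis
    using fsps.rank_nullity[OF linear_aug fin_dim_P[of 0 d]]
    by (simp add: cycle_dim_def aug_image_piece exact_piece_aug)
next
  case (Suc p)
  then show ?thesis
    using fsfs.rank_nullity[OF linear_lin_ext[of "diff F p"] fin_dim_P[of "Suc p" d]]
    by (simp add: cycle_dim_def exact_piece)
qed

lemma card_gens: "card (gens q i) = betti q i + tensor_boundary_dim q i + tensor_boundary_dim (Suc q) i"
proof -
  have card: "card (gens q i) = ps.dim (tensor_piece F q i)"
    unfolding tensor_piece_eq by (simp add: dim_supported_on)
  have "fin_dim_subspace pscale (tensor_cycles F q i) \<and>
      card (gens q i) = ps.dim (tensor_cycles F q i) + tensor_boundary_dim q i \<and>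
      tensor_boundaries F q i \<subseteq> tensor_cycles F q i"
  proof (cases q)
    case 0
    then show ?thesis
      using card tensor_diff_piece[of _ 0 i]
      by (auto simp: tensor_cycles_def tensor_boundary_dim_def tensor_boundaries_def)
  next
    case (Suc p)
    interpret L: Vector_Spaces.linear pscale pscale "tensor_diff F p" by (rule linear_tensor_diff)
    have "tensor_cycles F q i = tensor_piece F q i \<inter> {v. tensor_diff F p v = 0}"
      using Suc by (auto simp: tensor_cycles_def)
    moreover have "ps.subspace (tensor_piece F q i \<inter> {v. tensor_diff F p v = 0})"
      by (rule ps.subspace_inter[OF ps.fin_dim_subspace_subspace[OF fin_dim_tensor_piece] L.subspace_kernel])
    ultimately have "fin_dim_subspace pscale (tensor_cycles F q i)"
      using ps.fin_dim_subspace_mono[OF fin_dim_tensor_piece[of q i]] by simp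
    moreover have "ps.dim (tensor_piece F q i) = ps.dim (tensor_cycles F q i) + tensor_boundary_dim q i"
      using psps.rank_nullity[OF linear_tensor_diff[of p] fin_dim_tensor_piece[of "Suc p" i]] Suc
      by (simp add: tensor_cycles_def tensor_boundary_dim_def tensor_boundaries_def)
    moreover have "tensor_boundaries F q i \<subseteq> tensor_cycles F q i"
      using tensor_diff_piece[of _ q i] tensor_diff_diff[of _ p i] Suc
      by (auto simp: tensor_cycles_def tensor_boundaries_def)
    ultimately show ?thesis using card by simp
  qed
  moreover have "ps.subspace (tensor_boundaries F q i)"
    unfolding tensor_boundaries_def
    by (meson psps.fin_dim_subspace_image[OF linear_tensor_diff fin_dim_tensor_piece] ps.fin_dim_subspace_subspace)
  ultimately show ?thesis
    using ps.dim_mono_fin[of "tensor_cycles F q i" "tensor_boundaries F q i"]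
    by (simp add: betti_def tensor_boundary_dim_def)
qed

lemma euler_step:
  "cycle_dim q d + cycle_dim (Suc q) d
    = (\<Sum>i\<le>d. card (mons (d - i)) * (betti q i + tensor_boundary_dim q i + tensor_boundary_dim (Suc q) i))"
  unfolding dim_P[symmetric] by (simp add: dim_piece card_gens)

lemma euler_end: "d < q \<Longrightarrow> cycle_dim q d = (\<Sum>i\<le>d. card (mons (d - i)) * tensor_boundary_dim q i)"
  by (cases q) (auto simp: cycle_dim_def tensor_boundary_dim_def dim_boundaries)

end

text \<open>
  The defect \<open>cycle_dim q d - (\<Sum>i\<le>d. N (d - i) * tensor_boundary_dim q i)\<close> vanishes for \<open>q > d\<close>, two
  consecutive defects have a sum that depends on the Betti numbers only, and the defect for
  \<open>q = 0\<close> is \<open>dim K\<^sub>d\<close>.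
\<close>

lemma hilbert_function_eq_if_betti_eq:
  fixes F G :: "('k::field) graded_free_complex"
  assumes "graded_free_resolution F K" "graded_free_resolution G L"
    and betti: "\<And>q i. graded_resolution.betti F q i = graded_resolution.betti G q i"
  shows "ps.dim (K \<inter> homog d) = ps.dim (L \<inter> homog d)"
proof -
  interpret F: graded_resolution F K by unfold_locales fact
  interpret G: graded_resolution G L by unfold_locales fact
  let ?N = "\<lambda>i. card (mons (d - i))"
  let ?f = "\<lambda>q. int (F.cycle_dim q d) - (\<Sum>i\<le>d. int (?N i * F.tensor_boundary_dim q i))"
  let ?g = "\<lambda>q. int (G.cycle_dim q d) - (\<Sum>i\<le>d. int (?N i * G.tensor_boundary_dim q i))"
  have stepF: "?f q + ?f (Suc q) = (\<Sum>i\<le>d. int (?N i * F.betti q i))" for q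
    using arg_cong[OF F.euler_step[of q d], of int] by (simp add: algebra_simps sum.distrib)
  have stepG: "?g q + ?g (Suc q) = (\<Sum>i\<le>d. int (?N i * G.betti q i))" for q
    using arg_cong[OF G.euler_step[of q d], of int] by (simp add: algebra_simps sum.distrib)
  have step: "?f q + ?f (Suc q) = ?g q + ?g (Suc q)" for q
    unfolding stepF stepG using betti by simp
  have "?f q = ?g q" if "q \<le> Suc d" for q
    using that
  proof (induction q rule: inc_induct)
    case base
    show ?case by (simp add: F.euler_end G.euler_end)
  next
    case (step q)
    then show ?case using \<open>\<And>q. ?f q + ?f (Suc q) = ?g q + ?g (Suc q)\<close>[of q] by linarith
  qed
  from this[of 0] show ?thesis
    by (simp add: F.cycle_dim_def G.cycle_dim_def F.tensor_boundary_dim_def G.tensor_boundary_dim_def)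
qed

section \<open>Existence of graded free resolutions\<close>

definition graded_submodule :: "nat set \<Rightarrow> (nat \<Rightarrow> nat) \<Rightarrow> ('k::field) fam3 set \<Rightarrow> bool" where
  "graded_submodule B \<delta> M \<longleftrightarrow> M \<subseteq> free_on B \<and> 0 \<in> M \<and> (\<forall>v\<in>M. \<forall>w\<in>M. v + w \<in> M) \<and>
     (\<forall>v\<in>M. \<forall>r. smult_fam r v \<in> M) \<and> (\<forall>v\<in>M. \<forall>d. fam_component \<delta> d v \<in> M)"

lemma sum_fam_components:
  assumes "finite D" "\<And>b t. lookup (lookup v b) t \<noteq> 0 \<Longrightarrow> \<delta> b + mdeg t \<in> D"
  shows "(\<Sum>d\<in>D. fam_component \<delta> d v) = v"
proof (rule poly_mapping_eqI, rule poly_mapping_eqI)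
  fix b t
  have "lookup (lookup (\<Sum>d\<in>D. fam_component \<delta> d v) b) t
      = (\<Sum>d\<in>D. if d = \<delta> b + mdeg t then lookup (lookup v b) t else 0)"
    unfolding lookup_sum by (rule sum.cong) (auto simp: lookup_hom_component)
  then show "lookup (lookup (\<Sum>d\<in>D. fam_component \<delta> d v) b) t = lookup (lookup v b) t"
    using assms by (cases "lookup (lookup v b) t = 0") (simp_all add: sum.neutral)
qed

lemma exists_degrees:
  obtains D where "finite D" "\<And>b t. lookup (lookup v b) t \<noteq> 0 \<Longrightarrow> \<delta> b + mdeg t \<in> D"
proof
  let ?D = "\<Union>b\<in>keys v. (\<lambda>t. \<delta> b + mdeg t) ` keys (lookup v b)"
  show "finite ?D" by simp
  fix b t assume t: "lookup (lookup v b) t \<noteq> 0"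
  then have "lookup v b \<noteq> 0" by auto
  then have "b \<in> keys v" "t \<in> keys (lookup v b)" using t by (simp_all add: in_keys_iff)
  then show "\<delta> b + mdeg t \<in> ?D" by blast
qed

lemma graded_submodule_sum:
  "graded_submodule B \<delta> M \<Longrightarrow> (\<And>x. x \<in> A \<Longrightarrow> f x \<in> M) \<Longrightarrow> sum f A \<in> M"
  by (induction A rule: infinite_finite_induct) (auto simp: graded_submodule_def)

lemma lin_ext_single: "lin_ext \<phi> (Poly_Mapping.single b r) = smult_fam r (\<phi> b)"
  by (cases "r = 0") (auto simp: lin_ext_def intro!: poly_mapping_eqI)

lemma free_on_add: "v \<in> free_on B \<Longrightarrow> w \<in> free_on B \<Longrightarrow> v + w \<in> free_on B"
  using keys_add[of v w] by (auto simp: free_on_def)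

lemma free_on_smult: "v \<in> free_on B \<Longrightarrow> smult_fam r v \<in> free_on B"
  unfolding free_on_def subset_iff in_keys_iff mem_Collect_eq by (metis lookup_smult_fam mult_zero_right)

text \<open>
  A graded submodule is generated by bases of its pieces, which are finite; the \<open>j\<close>-th basis
  vector of degree \<open>d\<close> is indexed by \<open>prod_encode (d, j)\<close>.
\<close>

lemma exists_graded_generators:
  assumes fin: "\<And>i. finite {b \<in> B. \<delta> b = i}" and M: "graded_submodule B \<delta> (M :: ('k::field) fam3 set)"
  obtains B' \<delta>' \<phi> where "\<And>i. finite {b \<in> B'. \<delta>' b = i}"
    "\<And>b. b \<in> B' \<Longrightarrow> \<phi> b \<in> piece B \<delta> (\<delta>' b)" "lin_ext \<phi> ` free_on B' = M"
proof -
  have sub: "fs.subspace (M \<inter> piece B \<delta> d)" for d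
  proof (rule fs.subspace_inter[OF _ subspace_piece], rule fs.subspaceI)
  qed (use M in \<open>auto simp: graded_submodule_def fscale_def\<close>)
  have "fin_dim_subspace fscale (M \<inter> piece B \<delta> d)" for d
    by (rule fs.fin_dim_subspace_mono[OF fin_dim_piece[OF fin] sub]) auto
  then have "\<exists>S. S \<subseteq> M \<inter> piece B \<delta> d \<and> fs.span S = M \<inter> piece B \<delta> d \<and> finite S" for d
    using fs.fin_dim_basis by metis
  then obtain S where S: "\<And>d. S d \<subseteq> M \<inter> piece B \<delta> d"
    "\<And>d. fs.span (S d) = M \<inter> piece B \<delta> d" "\<And>d. finite (S d)"
    by metis
  obtain e where e: "\<And>d. bij_betw (e d) {0..<card (S d)} (S d)"
    using ex_bij_betw_nat_finite[OF S(3)] by metis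
  define B' where "B' = {b. snd (prod_decode b) < card (S (fst (prod_decode b)))}"
  define \<delta>' where "\<delta>' b = fst (prod_decode b)" for b
  define \<phi> where "\<phi> b = e (fst (prod_decode b)) (snd (prod_decode b))" for b
  have \<phi>S: "\<phi> b \<in> S (\<delta>' b)" if "b \<in> B'" for b
    using that e[of "\<delta>' b"] by (auto simp: B'_def \<delta>'_def \<phi>_def bij_betw_def)
  have fin': "finite {b \<in> B'. \<delta>' b = i}" for i
  proof (rule finite_subset)
    show "{b \<in> B'. \<delta>' b = i} \<subseteq> (\<lambda>j. prod_encode (i, j)) ` {..<card (S i)}"
    proof
      fix b assume b: "b \<in> {b \<in> B'. \<delta>' b = i}"
      have "b = prod_encode (i, snd (prod_decode b))"
        using b by (auto simp: \<delta>'_def)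
      then show "b \<in> (\<lambda>j. prod_encode (i, j)) ` {..<card (S i)}"
        using b by (auto simp: B'_def \<delta>'_def)
    qed
  qed simp
  let ?I = "lin_ext \<phi> ` free_on B'"
  have "?I \<subseteq> M"
  proof
    fix x assume "x \<in> ?I"
    then obtain v where v: "v \<in> free_on B'" "x = lin_ext \<phi> v" by blast
    have "smult_fam (lookup v b) (\<phi> b) \<in> M" if "b \<in> keys v" for b
    proof -
      have "\<phi> b \<in> M" using \<phi>S[of b] S(1) v(1) that by (auto simp: free_on_def)
      then show ?thesis using M by (auto simp: graded_submodule_def)
    qed
    then show "x \<in> M"
      unfolding v(2) lin_ext_def by (rule graded_submodule_sum[OF M])
  qed
  moreover have "M \<subseteq> ?I"
  proof
    have I: "fs.subspace ?I"
    proof (rule fs.subspaceI)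
      have "0 \<in> free_on B'" by (simp add: free_on_def)
      then show "0 \<in> ?I" by (metis imageI lin_ext_zero)
      show "x + y \<in> ?I" if "x \<in> ?I" "y \<in> ?I" for x y
        using that by (auto simp: lin_ext_add[symmetric] intro!: imageI free_on_add)
      show "fscale c x \<in> ?I" if "x \<in> ?I" for c x
        using that by (auto simp: lin_ext_smult[symmetric] fscale_def intro!: imageI free_on_smult)
    qed
    have "S d \<subseteq> ?I" for d
    proof
      fix x assume "x \<in> S d"
      then obtain j where j: "j < card (S d)" "x = e d j"
        using e[of d] by (force simp: bij_betw_def)
      let ?b = "prod_encode (d, j)"
      have "x = smult_fam 1 (\<phi> ?b)"
        by (rule poly_mapping_eqI) (simp add: \<phi>_def j(2))
      then have "x = lin_ext \<phi> (Poly_Mapping.single ?b 1)"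
        by (simp add: lin_ext_single)
      moreover have "Poly_Mapping.single ?b 1 \<in> free_on B'"
        using j(1) by (simp add: free_on_def B'_def)
      ultimately show "x \<in> ?I" by blast
    qed
    then have MI: "M \<inter> piece B \<delta> d \<subseteq> ?I" for d
      using fs.span_minimal[OF _ I] S(2) by metis
    fix x assume x: "x \<in> M"
    obtain Ds where Ds: "finite Ds" "\<And>b t. lookup (lookup x b) t \<noteq> 0 \<Longrightarrow> \<delta> b + mdeg t \<in> Ds"
      using exists_degrees[of x \<delta>] by metis
    have "fam_component \<delta> d x \<in> ?I" for d
    proof -
      have "x \<in> free_on B" using x M by (auto simp: graded_submodule_def)
      then have "fam_component \<delta> d x \<in> M \<inter> piece B \<delta> d"
        using x M by (auto simp: graded_submodule_def fam_component_piece)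
      then show ?thesis using MI by blast
    qed
    then have "(\<Sum>d\<in>Ds. fam_component \<delta> d x) \<in> ?I"
      by (intro fs.subspace_sum[OF I])
    then show "x \<in> ?I"
      using sum_fam_components[of Ds x \<delta>, OF Ds] by simp
  qed
  ultimately have "?I = M" by blast
  then show ?thesis
    using that[of B' \<delta>' \<phi>] fin' \<phi>S S(1) by blast
qed

lemma graded_submodule_kernel:
  fixes \<phi> :: "nat \<Rightarrow> ('k::field) fam3"
  assumes "\<And>b. b \<in> B' \<Longrightarrow> \<phi> b \<in> piece B \<delta> (\<delta>' b)"
  shows "graded_submodule B' \<delta>' {v \<in> free_on B'. lin_ext \<phi> v = 0}"
  unfolding graded_submodule_def
proof (intro conjI ballI allI)
  fix v d assume v: "v \<in> {v \<in> free_on B'. lin_ext \<phi> v = 0}"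
  have "fam_component \<delta>' d v \<in> free_on B'"
    using fam_component_piece[of v B' \<delta>' d] piece_subset_free_on v by blast
  moreover have "lin_ext \<phi> (fam_component \<delta>' d v) = fam_component \<delta> d (lin_ext \<phi> v)"
    by (rule lin_ext_fam_component[OF assms]) (use v in auto)
  moreover have "fam_component \<delta> d 0 = 0"
    by (rule poly_mapping_eqI) simp
  ultimately show "fam_component \<delta>' d v \<in> {v \<in> free_on B'. lin_ext \<phi> v = 0}"
    using v by simp
next
  fix v and r :: "'k poly3" assume "v \<in> {v \<in> free_on B'. lin_ext \<phi> v = 0}"
  moreover have "smult_fam r 0 = 0"
    by (rule poly_mapping_eqI) simp
  ultimately show "smult_fam r v \<in> {v \<in> free_on B'. lin_ext \<phi> v = 0}"
    by (auto simp: lin_ext_smult intro: free_on_smult)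
qed (auto simp: lin_ext_add intro: free_on_add, simp add: free_on_def)

text \<open>
  The ideal \<open>K\<close> is viewed as a submodule of the free module of rank one; generators of the kernel
  of the map constructed last give the next map.
\<close>

lemma exists_graded_free_resolution:
  fixes K :: "('k::field) poly3 set"
  assumes K: "homogeneous_ideal K"
  shows "\<exists>F. graded_free_resolution F K"
proof -
  let ?M0 = "Poly_Mapping.single (0::nat) ` K"
  have I: "ideal K R3" and hom: "\<And>f d. f \<in> K \<Longrightarrow> hom_component d f \<in> K"
    using K by (auto simp: homogeneous_ideal_def)
  have sm: "smult_fam r (Poly_Mapping.single (0::nat) f) = Poly_Mapping.single 0 (r * f)" for r f :: "'k poly3"
    by (rule poly_mapping_eqI) (simp add: lookup_single when_def)
  have fc: "fam_component (\<lambda>_. 0) d (Poly_Mapping.single (0::nat) f) = Poly_Mapping.single 0 (hom_component d f)"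
    for d and f :: "'k poly3"
    by (rule poly_mapping_eqI) (simp add: lookup_single when_def)
  have M0: "graded_submodule {0} (\<lambda>_. 0) ?M0"
    unfolding graded_submodule_def
  proof (intro conjI ballI allI)
    show "0 \<in> ?M0" using I by (force simp: ideal_R3_iff)
  qed (use I hom in \<open>auto simp: free_on_def sm fc single_add[symmetric] ideal_R3_iff split: if_splits\<close>)
  \<comment> \<open>A state consists of a graded free module, a graded submodule that is still to be covered, and
    the map defined last, which has no meaning for the initial state.\<close>
  define good :: "nat set \<times> (nat \<Rightarrow> nat) \<times> 'k fam3 set \<times> (nat \<Rightarrow> 'k fam3) \<Rightarrow> bool"
    where "good = (\<lambda>(B, \<delta>, M, \<phi>). (\<forall>i. finite {b \<in> B. \<delta> b = i}) \<and> graded_submodule B \<delta> M)"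
  define covers :: "nat set \<times> (nat \<Rightarrow> nat) \<times> 'k fam3 set \<times> (nat \<Rightarrow> 'k fam3) \<Rightarrow>
      nat set \<times> (nat \<Rightarrow> nat) \<times> 'k fam3 set \<times> (nat \<Rightarrow> 'k fam3) \<Rightarrow> bool"
    where "covers = (\<lambda>(B, \<delta>, M, _) (B', \<delta>', M', \<phi>'). (\<forall>b\<in>B'. \<phi>' b \<in> piece B \<delta> (\<delta>' b)) \<and>
      lin_ext \<phi>' ` free_on B' = M \<and> M' = {v \<in> free_on B'. lin_ext \<phi>' v = 0})"
  have "\<exists>f. \<forall>n. (good (f n) \<and> (n = 0 \<longrightarrow> f n = ({0}, \<lambda>_. 0, ?M0, \<lambda>_. 0))) \<and> covers (f n) (f (Suc n))"
  proof (rule dependent_nat_choice)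
    show "\<exists>x. good x \<and> ((0::nat) = 0 \<longrightarrow> x = ({0}, \<lambda>_. 0, ?M0, \<lambda>_. 0))"
      by (intro exI[of _ "({0}, \<lambda>_. 0, ?M0, \<lambda>_. 0)"]) (use M0 in \<open>simp add: good_def\<close>)
  next
    fix x and n :: nat assume x: "good x \<and> (n = 0 \<longrightarrow> x = ({0}, \<lambda>_. 0, ?M0, \<lambda>_. 0))"
    obtain B \<delta> M \<phi> where xe: "x = (B, \<delta>, M, \<phi>)" by (cases x)
    have "\<And>i. finite {b \<in> B. \<delta> b = i}" and "graded_submodule B \<delta> M"
      using x by (auto simp: xe good_def)
    from exists_graded_generators[OF this] obtain B' \<delta>' \<phi>' where *: "\<And>i. finite {b \<in> B'. \<delta>' b = i}"
      "\<And>b. b \<in> B' \<Longrightarrow> \<phi>' b \<in> piece B \<delta> (\<delta>' b)" "lin_ext \<phi>' ` free_on B' = M"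
      by blast
    show "\<exists>y. (good y \<and> (Suc n = 0 \<longrightarrow> y = ({0}, \<lambda>_. 0, ?M0, \<lambda>_. 0))) \<and> covers x y"
      by (rule exI[of _ "(B', \<delta>', {v \<in> free_on B'. lin_ext \<phi>' v = 0}, \<phi>')"])
        (use * graded_submodule_kernel[OF *(2)] in \<open>simp add: good_def covers_def xe\<close>)
  qed
  then obtain f where f: "\<And>n. good (f n)" "f 0 = ({0}, \<lambda>_. 0, ?M0, \<lambda>_. 0)" "\<And>n. covers (f n) (f (Suc n))"
    by blast
  define B where "B n = fst (f n)" for n
  define \<delta> where "\<delta> n = fst (snd (f n))" for n
  define M where "M n = fst (snd (snd (f n)))" for n
  define \<phi> where "\<phi> n = snd (snd (snd (f n)))" for n
  have fn: "f n = (B n, \<delta> n, M n, \<phi> n)" for n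
    by (simp add: B_def \<delta>_def M_def \<phi>_def)
  have fin: "finite {b \<in> B n. \<delta> n b = i}" for n i
    using f(1)[of n] by (simp add: fn good_def)
  have f0: "B 0 = {0}" "\<delta> 0 = (\<lambda>_. 0)" "M 0 = ?M0"
    using f(2) by (simp_all add: fn)
  have \<phi>: "\<phi> (Suc n) b \<in> piece (B n) (\<delta> n) (\<delta> (Suc n) b)" if "b \<in> B (Suc n)" for n b
    using f(3)[of n] that by (simp add: fn covers_def)
  have im: "lin_ext (\<phi> (Suc n)) ` free_on (B (Suc n)) = M n" for n
    using f(3)[of n] by (simp add: fn covers_def)
  have ker: "M (Suc n) = {v \<in> free_on (B (Suc n)). lin_ext (\<phi> (Suc n)) v = 0}" for n
    using f(3)[of n] by (simp add: fn covers_def)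
  define F where "F = \<lparr>basis = (\<lambda>q. B (Suc q)), bdeg = (\<lambda>q. \<delta> (Suc q)),
    diff = (\<lambda>q. \<phi> (Suc (Suc q))), aug = (\<lambda>b. lookup (\<phi> (Suc 0) b) 0)\<rparr>"
  have F: "basis F q = B (Suc q)" "bdeg F q = \<delta> (Suc q)" "diff F q = \<phi> (Suc (Suc q))"
    "aug F = (\<lambda>b. lookup (\<phi> (Suc 0) b) 0)" for q
    by (simp_all add: F_def)
  have fm: "free_mod F q = free_on (B (Suc q))" for q
    by (simp add: free_mod_def F)
  have fp: "free_mod_piece F q d = piece (B (Suc q)) (\<delta> (Suc q)) d" for q d
    unfolding free_mod_piece_def free_mod_def free_on_def piece_def F by auto
  have aug: "aug_map F v = lookup (lin_ext (\<phi> (Suc 0)) v) 0" for v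
    by (simp add: aug_map_def lin_ext_def lookup_sum F)
  have rank1: "lin_ext (\<phi> (Suc 0)) v = Poly_Mapping.single 0 (aug_map F v)" if "v \<in> free_on (B (Suc 0))" for v
  proof -
    have "lin_ext (\<phi> (Suc 0)) v \<in> ?M0"
      using im[of 0] that unfolding f0(3) by blast
    then show ?thesis unfolding aug by auto
  qed
  have "graded_free_resolution F K"
    unfolding graded_free_resolution_def fm fp
  proof (intro conjI allI ballI)
    show "finite {b \<in> basis F q. bdeg F q b = d}" for q d
      using fin by (simp add: F)
    show "aug F b \<in> homog (bdeg F 0 b)" if "b \<in> basis F 0" for b
      using \<phi>[of b 0] that
      by (cases "lookup (\<phi> (Suc 0) b) 0 = 0") (auto simp: F f0 piece_iff)
    show "diff F q b \<in> piece (B (Suc q)) (\<delta> (Suc q)) (bdeg F (Suc q) b)" if "b \<in> basis F (Suc q)" for q b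
      using \<phi>[of b "Suc q"] that by (simp add: F)
    show "aug_map F ` free_on (B (Suc 0)) = K"
    proof -
      have "Poly_Mapping.single (0::nat) ` (aug_map F ` free_on (B (Suc 0)))
          = lin_ext (\<phi> (Suc 0)) ` free_on (B (Suc 0))"
        unfolding image_image by (rule image_cong) (simp_all add: rank1)
      also have "\<dots> = Poly_Mapping.single 0 ` K"
        using im[of 0] f0(3) by simp
      finally show ?thesis
        by (simp add: inj_image_eq_iff)
    qed
    show "{v \<in> free_on (B (Suc 0)). aug_map F v = 0} = lin_ext (diff F 0) ` free_on (B (Suc 1))"
    proof -
      have "aug_map F v = 0 \<longleftrightarrow> lin_ext (\<phi> (Suc 0)) v = 0" if "v \<in> free_on (B (Suc 0))" for v
        using rank1[OF that] by (metis aug lookup_zero single_zero)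
      then have "{v \<in> free_on (B (Suc 0)). aug_map F v = 0} = M (Suc 0)"
        unfolding ker by blast
      then show ?thesis
        using im[of "Suc 0"] by (simp add: F)
    qed
    show "{v \<in> free_on (B (Suc (Suc q))). lin_ext (diff F q) v = 0}
        = lin_ext (diff F (Suc q)) ` free_on (B (Suc (Suc (Suc q))))" for q
      using im[of "Suc (Suc q)"] ker[of "Suc q"] by (simp add: F)
  qed
  then show ?thesis by blast
qed

lemma hilbert_function_determined_by_betti:
  fixes I J :: "('k::field) poly3 set"
  assumes "homogeneous_ideal I" "homogeneous_ideal J"
    and betti: "\<And>i j. graded_betti I i j = graded_betti J i j"
  shows "ps.dim (I \<inter> homog d) = ps.dim (J \<inter> homog d)"
proof -
  have res: "graded_free_resolution (SOME F. graded_free_resolution F K) K"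
    if "homogeneous_ideal K" for K :: "'k poly3 set"
    using exists_graded_free_resolution[OF that] by (rule someI_ex)
  have "graded_betti K q i = graded_resolution.betti (SOME F. graded_free_resolution F K) q i"
    if "homogeneous_ideal K" for K :: "'k poly3 set" and q i
  proof -
    interpret graded_resolution "SOME F. graded_free_resolution F K" K
      using res[OF that] by unfold_locales
    show ?thesis
      unfolding graded_betti_def Let_def betti_def smult_fam_eq_pscale ..
  qed
  then show ?thesis
    using hilbert_function_eq_if_betti_eq[OF res[OF assms(1)] res[OF assms(2)]] assms by metis
qed

section \<open>Initial monomials for the reverse lexicographic order\<close>

lemma UNIV_3_eq: "(UNIV :: 3 set) = {0, 1, 2}"
proof -
  have "(3::3) = 0" by simp
  then show ?thesis using UNIV_3 by auto
qed

lemma all_3: "(\<forall>i::3. P i) \<longleftrightarrow> P 0 \<and> P 1 \<and> P 2"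
  using UNIV_3_eq by (metis UNIV_I empty_iff insert_iff)

lemma ex_3: "(\<exists>i::3. P i) \<longleftrightarrow> P 0 \<or> P 1 \<or> P 2"
  using all_3[of "\<lambda>i. \<not> P i"] by blast

lemma less_3: "(0::3) < 1" "(1::3) < 2" "(0::3) < 2"
  by (simp_all add: less_bit1_def bit1.Rep_0 bit1.Rep_1 bit1.Rep_numeral)

lemma distinct_3: "(0::3) \<noteq> 1" "(1::3) \<noteq> 2" "(0::3) \<noteq> 2"
  using less_3 by force+

lemma mdeg_eq: "mdeg t = lookup t 0 + lookup t 1 + lookup t 2"
  unfolding mdeg_def UNIV_3_eq using distinct_3 by simp

text \<open>On monomials of degree \<open>d\<close>, the order is the reverse of the order of these numbers.\<close>

definition revlex_rank :: "nat \<Rightarrow> mon3 \<Rightarrow> nat" where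
  "revlex_rank d t = lookup t 2 * Suc d + lookup t 1"

lemma mons_exponents_le: "t \<in> mons d \<Longrightarrow> lookup t 1 \<le> d \<and> lookup t 2 \<le> d"
  by (auto simp: mons_def mdeg_eq)

lemma mult_Suc_add_less_iff:
  fixes a b c e d :: nat
  assumes "b \<le> d" "e \<le> d"
  shows "a * Suc d + b < c * Suc d + e \<longleftrightarrow> a < c \<or> a = c \<and> b < e"
proof -
  have "a * Suc d + b < c * Suc d + e" if "a < c"
  proof -
    have "Suc a * Suc d \<le> c * Suc d" using that by (intro mult_le_mono) auto
    then show ?thesis using assms by simp
  qed
  moreover have "c * Suc d + e < a * Suc d + b" if "c < a"
  proof -
    have "Suc c * Suc d \<le> a * Suc d" using that by (intro mult_le_mono) auto
    then show ?thesis using assms by simp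
  qed
  ultimately show ?thesis
    by (metis add_less_cancel_left less_asym linorder_neqE_nat)
qed

lemma revlex_less_iff_rank:
  assumes "s \<in> mons d" "t \<in> mons d"
  shows "revlex_less s t \<longleftrightarrow> revlex_rank d t < revlex_rank d s"
proof -
  have m: "mdeg s = d" "mdeg t = d" using assms by (auto simp: mons_def)
  have "revlex_less s t \<longleftrightarrow> lookup t 2 < lookup s 2 \<or>
      lookup t 1 < lookup s 1 \<and> lookup s 2 = lookup t 2 \<or>
      lookup t 0 < lookup s 0 \<and> lookup s 1 = lookup t 1 \<and> lookup s 2 = lookup t 2"
  proof -
    have n: "\<not> (2::3) < 0" "\<not> (2::3) < 1" "\<not> (1::3) < 0"
      using less_3 by (auto dest: less_asym)
    have *: "(\<forall>j>2. Q j) \<longleftrightarrow> True" "(\<forall>j>1. Q j) \<longleftrightarrow> Q 2" "(\<forall>j>0. Q j) \<longleftrightarrow> Q 1 \<and> Q 2"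
      for Q :: "3 \<Rightarrow> bool"
      using all_3[of "\<lambda>j. 2 < j \<longrightarrow> Q j"] all_3[of "\<lambda>j. 1 < j \<longrightarrow> Q j"] all_3[of "\<lambda>j. 0 < j \<longrightarrow> Q j"]
        less_3 n by simp_all
    show ?thesis
      unfolding revlex_less_def m ex_3 * by auto
  qed
  also have "\<dots> \<longleftrightarrow> lookup t 2 < lookup s 2 \<or> lookup t 2 = lookup s 2 \<and> lookup t 1 < lookup s 1"
    using m by (auto simp: mdeg_eq)
  also have "\<dots> \<longleftrightarrow> revlex_rank d t < revlex_rank d s"
    unfolding revlex_rank_def
    using mult_Suc_add_less_iff[of "lookup t 1" d "lookup s 1" "lookup t 2" "lookup s 2"]
      mons_exponents_le[OF assms(1)] mons_exponents_le[OF assms(2)] by blast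
  finally show ?thesis .
qed

lemma mons_eqI:
  assumes "s \<in> mons d" "t \<in> mons d" "lookup s 1 = lookup t 1" "lookup s 2 = lookup t 2"
  shows "s = t"
proof (rule poly_mapping_eqI)
  fix i
  have "\<forall>i. lookup s i = lookup t i"
    unfolding all_3 using assms by (auto simp: mons_def mdeg_eq)
  then show "lookup s i = lookup t i" by blast
qed

lemma revlex_rank_inj:
  assumes "s \<in> mons d" "t \<in> mons d" "revlex_rank d s = revlex_rank d t"
  shows "s = t"
proof -
  have *: "\<not> revlex_rank d s < revlex_rank d t" "\<not> revlex_rank d t < revlex_rank d s"
    using assms(3) by auto
  have "lookup s 2 = lookup t 2 \<and> lookup s 1 = lookup t 1"
    using * mons_exponents_le[OF assms(1)] mons_exponents_le[OF assms(2)]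
    unfolding revlex_rank_def
    by (metis linorder_neqE_nat mult_Suc_add_less_iff)
  then show ?thesis using mons_eqI[OF assms(1,2)] by simp
qed

lemma revlex_rank_ge_iff:
  assumes "t \<in> mons d" "j \<le> d"
  shows "c * Suc d + j \<le> revlex_rank d t \<longleftrightarrow> c < lookup t 2 \<or> c = lookup t 2 \<and> j \<le> lookup t 1"
proof -
  have "revlex_rank d t < c * Suc d + j \<longleftrightarrow> lookup t 2 < c \<or> lookup t 2 = c \<and> lookup t 1 < j"
    unfolding revlex_rank_def
    by (rule mult_Suc_add_less_iff) (use mons_exponents_le[OF assms(1)] assms(2) in simp_all)
  then have "c * Suc d + j \<le> revlex_rank d t \<longleftrightarrow> \<not> (lookup t 2 < c \<or> lookup t 2 = c \<and> lookup t 1 < j)"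
    by (simp only: not_less[symmetric])
  also have "\<dots> \<longleftrightarrow> c < lookup t 2 \<or> c = lookup t 2 \<and> j \<le> lookup t 1"
    by auto
  finally show ?thesis .
qed

lemma revlex_rank_ge_Suc_iff:
  assumes "t \<in> mons d"
  shows "c * Suc d \<le> revlex_rank d t \<longleftrightarrow> c \<le> lookup t 2"
  using revlex_rank_ge_iff[OF assms, of 0 c] by auto

text \<open>The value \<open>j = d + 1\<close> occurs below if all monomials of degree \<open>d\<close> in \<open>x\<^sub>1, x\<^sub>2\<close> are initial.\<close>

lemma revlex_rank_ge_iff_Suc:
  assumes "t \<in> mons d" "j \<le> Suc d"
  shows "c * Suc d + j \<le> revlex_rank d t \<longleftrightarrow> c < lookup t 2 \<or> c = lookup t 2 \<and> j \<le> lookup t 1"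
proof (cases "j = Suc d")
  case True
  then show ?thesis
    using revlex_rank_ge_Suc_iff[OF assms(1), of "Suc c"] mons_exponents_le[OF assms(1)] by auto
next
  case False
  then show ?thesis using revlex_rank_ge_iff[OF assms(1)] assms(2) by simp
qed

lemma revlex_rank_less:
  assumes "t \<in> mons d"
  shows "revlex_rank d t < Suc d * Suc d"
  using revlex_rank_ge_Suc_iff[OF assms, of "Suc d"] mons_exponents_le[OF assms] by simp

definition lead_mons :: "nat \<Rightarrow> ('k::field) poly3 set \<Rightarrow> mon3 set" where
  "lead_mons d V = {t. \<exists>f\<in>V. t \<in> keys f \<and> (\<forall>s\<in>keys f. revlex_rank d t \<le> revlex_rank d s)}"

definition tail_space :: "nat \<Rightarrow> nat \<Rightarrow> ('k::field) poly3 set" where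
  "tail_space d n = supported_on {t \<in> mons d. n \<le> revlex_rank d t}"

lemma subspace_tail_space [simp]: "ps.subspace (tail_space d n)"
  by (simp add: tail_space_def)

lemma tail_space_subset_homog: "tail_space d n \<subseteq> homog d"
  by (auto simp: tail_space_def homog_eq_supported_on supported_on_def)

lemma tail_space_0: "tail_space d 0 = homog d"
  by (simp add: tail_space_def homog_eq_supported_on)

lemma tail_space_iff: "f \<in> tail_space d n \<longleftrightarrow> f \<in> homog d \<and> (\<forall>t\<in>keys f. n \<le> revlex_rank d t)"
  by (auto simp: tail_space_def homog_eq_supported_on supported_on_def)

lemma tail_space_antimono: "m \<le> n \<Longrightarrow> tail_space d n \<subseteq> tail_space d m"
  unfolding subset_iff tail_space_iff by (blast intro: le_trans)

lemma tail_space_end: "Suc d * Suc d \<le> n \<Longrightarrow> tail_space d n = {0}"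
proof -
  assume n: "Suc d * Suc d \<le> n"
  have "\<not> n \<le> revlex_rank d t" if "t \<in> mons d" for t
    using revlex_rank_less[OF that] n by linarith
  then have e: "{t \<in> mons d. n \<le> revlex_rank d t} = {}" by blast
  show ?thesis unfolding tail_space_def supported_on_def e by auto
qed

lemma lead_mons_subset: "V \<subseteq> homog d \<Longrightarrow> lead_mons d V \<subseteq> mons d"
  by (auto simp: lead_mons_def homog_def mons_def)

lemma is_lead_mon_iff_rank:
  assumes "f \<in> homog d"
  shows "is_lead_mon f t \<longleftrightarrow> t \<in> keys f \<and> (\<forall>s\<in>keys f. revlex_rank d t \<le> revlex_rank d s)"
proof -
  have k: "\<And>s. s \<in> keys f \<Longrightarrow> s \<in> mons d" using assms by (auto simp: homog_def mons_def)
  show ?thesis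
    unfolding is_lead_mon_def using revlex_less_iff_rank revlex_rank_inj k
    by (metis leD le_less linorder_neqE_nat order_le_less)
qed

text \<open>
  Passing from \<open>tail_space d n\<close> to \<open>tail_space d (n + 1)\<close> drops one monomial, and the dimension of
  the intersection with \<open>V\<close> decreases exactly if it is an initial monomial.
\<close>

lemma dim_inter_tail_space:
  assumes V: "ps.subspace V" "V \<subseteq> homog d"
  shows "ps.dim (V \<inter> tail_space d n) = card {t \<in> lead_mons d V. n \<le> revlex_rank d t}"
proof (cases "n \<le> Suc d * Suc d")
  case False
  have "{t \<in> lead_mons d V. n \<le> revlex_rank d t} = {}"
    using lead_mons_subset[OF V(2)] revlex_rank_less[of _ d] False
    by (auto simp del: mult_Suc mult_Suc_right) (meson le_trans less_le_not_le nle_le subsetD)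
  moreover have "V \<inter> tail_space d n = {0}"
    using tail_space_end[of d n] False ps.subspace_0[OF V(1)] by auto
  ultimately show ?thesis by (simp only: card.empty ps.dim_zero_subspace)
next
  case True
  then show ?thesis
  proof (induction n rule: inc_induct)
    case base
    have "{t \<in> lead_mons d V. Suc d * Suc d \<le> revlex_rank d t} = {}"
      using lead_mons_subset[OF V(2)] revlex_rank_less[of _ d] by (auto simp: not_le[symmetric] subset_iff)
    moreover have "V \<inter> tail_space d (Suc d * Suc d) = {0}"
      using tail_space_end[of d] ps.subspace_0[OF V(1)] by auto
    ultimately show ?case by (simp only: card.empty ps.dim_zero_subspace)
  next
    case (step n)
    let ?X = "V \<inter> tail_space d n"
    have fin: "finite (lead_mons d V)"
      using lead_mons_subset[OF V(2)] finite_subset finite_mons by blast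
    show ?case
    proof (cases "\<exists>t\<in>mons d. revlex_rank d t = n")
      case False
      then have *: "n \<le> revlex_rank d t \<longleftrightarrow> Suc n \<le> revlex_rank d t" if "t \<in> mons d" for t
        using that by (metis Suc_leD Suc_leI le_eq_less_or_eq)
      have "?X = V \<inter> tail_space d (Suc n)"
        unfolding tail_space_def using * by (simp cong: conj_cong)
      moreover have "{t \<in> lead_mons d V. n \<le> revlex_rank d t} = {t \<in> lead_mons d V. Suc n \<le> revlex_rank d t}"
        using * lead_mons_subset[OF V(2)] by blast
      ultimately show ?thesis using step.IH by simp
    next
      case True
      then obtain t where t: "t \<in> mons d" "revlex_rank d t = n" by blast
      let ?f = "\<lambda>f. Poly_Mapping.single (0::mon3) (lookup f t)"
      have lin: "Vector_Spaces.linear pscale pscale ?f"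
        by (rule Vector_Spaces.linear_iff[THEN iffD2])
          (auto simp: lookup_add single_add pscale_single ps.vector_space_axioms)
      have X: "fin_dim_subspace pscale ?X"
        by (rule ps.fin_dim_subspace_mono[OF fin_dim_homog[of d]])
          (use V in \<open>auto intro: ps.subspace_inter\<close>)
      have ker: "{f \<in> ?X. ?f f = 0} = V \<inter> tail_space d (Suc n)"
      proof -
        have A: "lookup f t = 0 \<longleftrightarrow> (\<forall>s\<in>keys f. Suc n \<le> revlex_rank d s)"
          if f: "f \<in> tail_space d n" for f
        proof
          assume 0: "lookup f t = 0"
          show "\<forall>s\<in>keys f. Suc n \<le> revlex_rank d s"
          proof
            fix s assume s: "s \<in> keys f"
            then have "s \<in> mons d" "n \<le> revlex_rank d s" "s \<noteq> t"
              using f 0 by (auto simp: tail_space_iff homog_def mons_def in_keys_iff)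
            then show "Suc n \<le> revlex_rank d s"
              using t revlex_rank_inj by (metis Suc_leI le_neq_implies_less)
          qed
        next
          assume "\<forall>s\<in>keys f. Suc n \<le> revlex_rank d s"
          then show "lookup f t = 0" using t(2) by (metis Suc_n_not_le_n in_keys_iff)
        qed
        have B: "?f f = 0 \<longleftrightarrow> lookup f t = 0" for f
          by (metis lookup_single_eq lookup_zero single_zero)
        have C: "tail_space d (Suc n) \<subseteq> tail_space d n"
          unfolding subset_iff tail_space_iff by (blast intro: Suc_leD)
        have "f \<in> tail_space d (Suc n) \<longleftrightarrow> f \<in> tail_space d n \<and> lookup f t = 0" for f
          using A[of f] C by (metis subsetD tail_space_iff)
        then show ?thesis
          unfolding B by blast
      qed
      have rn: "ps.dim ?X = ps.dim (?f ` ?X) + ps.dim (V \<inter> tail_space d (Suc n))"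
        using psps.rank_nullity[OF lin X] unfolding ker .
      have lm: "t \<in> lead_mons d V \<longleftrightarrow> (\<exists>f\<in>?X. lookup f t \<noteq> 0)"
      proof
        assume "t \<in> lead_mons d V"
        then obtain f where f: "f \<in> V" "t \<in> keys f" "\<forall>s\<in>keys f. n \<le> revlex_rank d s"
          using t(2) by (auto simp: lead_mons_def)
        then have "f \<in> ?X" using V(2) by (auto simp: tail_space_iff)
        then show "\<exists>f\<in>?X. lookup f t \<noteq> 0" using f(2) by (auto simp: in_keys_iff)
      next
        assume "\<exists>f\<in>?X. lookup f t \<noteq> 0"
        then show "t \<in> lead_mons d V"
          using t(2) by (auto simp: lead_mons_def tail_space_iff in_keys_iff)
      qed
      show ?thesis
      proof (cases "t \<in> lead_mons d V")
        case True
        then obtain f where f: "f \<in> ?X" "lookup f t \<noteq> 0" using lm by blast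
        have "?f ` ?X = supported_on {0}"
        proof
          show "?f ` ?X \<subseteq> supported_on {0}" by (auto simp: supported_on_def split: if_splits)
          show "supported_on {0} \<subseteq> ?f ` ?X"
          proof
            fix h :: "'a poly3" assume h: "h \<in> supported_on {0}"
            let ?c = "lookup h 0 / lookup f t"
            have "h = ?f (pscale ?c f)"
              by (rule poly_mapping_eqI) (use f(2) h in \<open>auto simp: lookup_single when_def supported_on_iff\<close>)
            moreover have "pscale ?c f \<in> ?X"
              using f(1) ps.subspace_scale[OF ps.fin_dim_subspace_subspace[OF X]] by blast
            ultimately show "h \<in> ?f ` ?X" by blast
          qed
        qed
        then have "ps.dim (?f ` ?X) = 1" by (simp add: dim_supported_on)
        moreover have "{s \<in> lead_mons d V. n \<le> revlex_rank d s}
            = insert t {s \<in> lead_mons d V. Suc n \<le> revlex_rank d s}"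
          using t True lead_mons_subset[OF V(2)] revlex_rank_inj
          by (auto simp: Suc_le_eq) (metis le_neq_implies_less subsetD)
        ultimately show ?thesis
          using rn step.IH fin t(2) by simp
      next
        case False
        then have "?f f = 0" if "f \<in> ?X" for f using lm that by simp
        moreover have "0 \<in> ?X"
          using ps.subspace_0[OF ps.fin_dim_subspace_subspace[OF X]] .
        ultimately have "?f ` ?X = {0}" by (auto simp: image_iff)
        moreover have "{s \<in> lead_mons d V. n \<le> revlex_rank d s}
            = {s \<in> lead_mons d V. Suc n \<le> revlex_rank d s}"
          using t False lead_mons_subset[OF V(2)] revlex_rank_inj
          by (auto simp: Suc_le_eq) (metis le_neq_implies_less subsetD)
        ultimately show ?thesis
          using rn step.IH by simp
      qed
    qed
  qed
qed

lemma card_lead_mons: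
  assumes "ps.subspace V" "V \<subseteq> homog d"
  shows "card (lead_mons d V) = ps.dim V"
  using dim_inter_tail_space[OF assms, of 0] assms(2) by (simp add: tail_space_0 Int_absorb2)

abbreviation x3_power :: "nat \<Rightarrow> ('k::field) poly3" where
  "x3_power c \<equiv> mono_poly (Poly_Mapping.single 2 c)"

text \<open>
  The exponent of \<open>x\<^sub>2\<close> adds at most \<open>d\<close> to the rank, so ranks from \<open>c * (d + 1)\<close> on mean divisibility
  by \<open>x\<^sub>3\<^sup>c\<close>. This property of the reverse lexicographic order links initial monomials with
  multiplication by \<open>x\<^sub>3\<close>.
\<close>

lemma x3_power_mult_tail_space:
  assumes "c \<le> d"
  shows "(\<lambda>f. x3_power c * f) ` homog (d - c) = (tail_space d (c * Suc d) :: ('k::field) poly3 set)"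
proof
  let ?u = "Poly_Mapping.single (2::3) c"
  show "(\<lambda>f. x3_power c * f) ` homog (d - c) \<subseteq> (tail_space d (c * Suc d) :: 'k poly3 set)"
  proof
    fix h :: "'k poly3" assume "h \<in> (\<lambda>f. x3_power c * f) ` homog (d - c)"
    then obtain f where f: "f \<in> homog (d - c)" "h = x3_power c * f" by blast
    have "h \<in> homog (c + (d - c))"
      unfolding f(2) by (rule homog_mult[OF homog_single f(1)]) simp
    moreover have "c * Suc d \<le> revlex_rank d t" if t: "t \<in> keys h" for t
    proof -
      have tm: "t \<in> mons d" using t calculation assms by (auto simp: homog_def mons_def)
      obtain s where "t = ?u + s"
        using t lookup_single_mult_exists[of ?u 1 f t] by (auto simp: f(2) in_keys_iff)
      then show ?thesis
        unfolding revlex_rank_ge_Suc_iff[OF tm] by (simp add: lookup_add)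
    qed
    ultimately show "h \<in> tail_space d (c * Suc d)"
      using assms by (simp add: tail_space_iff)
  qed
  show "tail_space d (c * Suc d) \<subseteq> (\<lambda>f. x3_power c * (f :: 'k poly3)) ` homog (d - c)"
  proof
    fix h :: "'k poly3" assume h: "h \<in> tail_space d (c * Suc d)"
    have div: "t = ?u + (t - ?u)" if "t \<in> keys h" for t
    proof -
      have tm: "t \<in> mons d" using h that by (auto simp: tail_space_iff homog_def mons_def)
      then have "c \<le> lookup t 2"
        using h that revlex_rank_ge_Suc_iff[OF tm] by (auto simp: tail_space_iff)
      then show ?thesis
        by (intro poly_mapping_eqI) (simp add: lookup_add lookup_minus lookup_single when_def)
    qed
    define f where "f = (\<Sum>t\<in>keys h. Poly_Mapping.single (t - ?u) (lookup h t))"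
    have "x3_power c * f = (\<Sum>t\<in>keys h. Poly_Mapping.single (?u + (t - ?u)) (lookup h t))"
      by (simp add: f_def sum_distrib_left mult_single)
    also have "\<dots> = (\<Sum>t\<in>keys h. Poly_Mapping.single t (lookup h t))"
      using div by (intro sum.cong) simp_all
    also have "\<dots> = h" by (rule sum_single_keys) auto
    finally have "h = x3_power c * f" by simp
    moreover have "f \<in> homog (d - c)"
      unfolding f_def
    proof (intro homog_sum homog_single)
      fix t assume t: "t \<in> keys h"
      then have "mdeg t = d" using h by (auto simp: tail_space_iff homog_def)
      moreover have "mdeg t = c + mdeg (t - ?u)"
        using arg_cong[OF div[OF t], of mdeg] by simp
      ultimately show "mdeg (t - ?u) = d - c" by simp
    qed
    ultimately show "h \<in> (\<lambda>f. x3_power c * f) ` homog (d - c)" by blast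
  qed
qed

lemma mono_poly_mult_eq_0: "mono_poly u * f = 0 \<Longrightarrow> f = 0" for f :: "('k::field) poly3"
  by (metis lookup_single_eq lookup_zero mult_eq_0_iff zero_neq_one)

lemma linear_mult: "Vector_Spaces.linear pscale pscale (\<lambda>f. (p :: ('k::field) poly3) * f)"
  by (rule Vector_Spaces.linear_iff[THEN iffD2])
    (auto simp: distrib_left pscale_mult_right ps.vector_space_axioms)

lemma dim_mono_poly_mult:
  assumes "fin_dim_subspace pscale W"
  shows "ps.dim ((\<lambda>f. mono_poly u * f) ` W) = ps.dim (W :: ('k::field) poly3 set)"
  using psps.dim_image_inj[OF linear_mult assms] mono_poly_mult_eq_0 by blast

lemma card_tail_mons:
  assumes "c \<le> d"
  shows "card {t \<in> mons d. c * Suc d \<le> revlex_rank d t} = card (mons (d - c))"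
proof -
  have "card {t \<in> mons d. c * Suc d \<le> revlex_rank d t} = ps.dim (tail_space d (c * Suc d) :: rat poly3 set)"
    by (simp add: tail_space_def dim_supported_on)
  also have "\<dots> = ps.dim (homog (d - c) :: rat poly3 set)"
    unfolding x3_power_mult_tail_space[OF assms, symmetric] by (rule dim_mono_poly_mult) simp
  finally show ?thesis by (simp add: dim_homog)
qed

definition restrict_to :: "'a set \<Rightarrow> ('a \<Rightarrow>\<^sub>0 'k::field) \<Rightarrow> ('a \<Rightarrow>\<^sub>0 'k)" where
  "restrict_to T f = Poly_Mapping.mapp (\<lambda>t a. if t \<in> T then a else 0) f"

lemma lookup_restrict_to [simp]: "lookup (restrict_to T f) t = (if t \<in> T then lookup f t else 0)"
  by (auto simp: restrict_to_def lookup_mapp when_def in_keys_iff)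

lemma linear_restrict_to: "Vector_Spaces.linear pscale pscale (restrict_to T)"
  by (rule Vector_Spaces.linear_iff[THEN iffD2])
    (auto intro!: poly_mapping_eqI simp: lookup_add ps.vector_space_axioms)

lemma dim_split_tail_space:
  assumes V: "ps.subspace V" "V \<subseteq> homog d"
  shows "ps.dim V = ps.dim (restrict_to {t \<in> mons d. revlex_rank d t < n} ` V) + ps.dim (V \<inter> tail_space d n)"
    and "fin_dim_subspace pscale (restrict_to {t \<in> mons d. revlex_rank d t < n} ` V)"
proof -
  let ?r = "restrict_to {t \<in> mons d. revlex_rank d t < n}"
  have fV: "fin_dim_subspace pscale V"
    by (rule ps.fin_dim_subspace_mono[OF fin_dim_homog V])
  have "?r f = 0 \<longleftrightarrow> f \<in> tail_space d n" if "f \<in> V" for f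
  proof
    assume 0: "?r f = 0"
    have "n \<le> revlex_rank d t" if "t \<in> keys f" for t
    proof (rule ccontr)
      assume "\<not> n \<le> revlex_rank d t"
      moreover have "t \<in> mons d" using V(2) \<open>f \<in> V\<close> that by (auto simp: homog_def mons_def)
      ultimately have "lookup (?r f) t = lookup f t" by simp
      then show False using 0 that by (simp add: in_keys_iff)
    qed
    then show "f \<in> tail_space d n" using that V(2) by (auto simp: tail_space_iff)
  next
    assume "f \<in> tail_space d n"
    then show "?r f = 0"
      by (intro poly_mapping_eqI) (auto simp: tail_space_iff in_keys_iff not_le[symmetric])
  qed
  then have "{f \<in> V. ?r f = 0} = V \<inter> tail_space d n" by blast
  then show "ps.dim V = ps.dim (?r ` V) + ps.dim (V \<inter> tail_space d n)"
    using psps.rank_nullity[OF linear_restrict_to fV, of "{t \<in> mons d. revlex_rank d t < n}"] by simp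
  show "fin_dim_subspace pscale (?r ` V)"
    by (rule psps.fin_dim_subspace_image[OF linear_restrict_to fV])
qed

section \<open>Orders of vanishing at a general point\<close>

text \<open>
  Subtracting a multiple of \<open>G\<close> one may assume that \<open>F\<close> is zero or has a degree different from that of
  \<open>G\<close>. In the second case the leading coefficients of the two sides are distinct multiples of the same
  nonzero scalar.
\<close>

lemma proportional_if_wronskian_zero:
  fixes F G :: "('k::field_char_0) poly"
  assumes G: "G \<noteq> 0" and w: "pderiv F * G = F * pderiv G"
  obtains c where "F = smult c G"
proof -
  define c where "c = coeff F (degree G) / lead_coeff G"
  define H where "H = F - smult c G"
  have wH: "pderiv H * G = H * pderiv G"
    using w by (simp add: H_def pderiv_diff pderiv_smult algebra_simps)
  have cH: "coeff H (degree G) = 0"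
    using G by (simp add: H_def c_def)
  have "H = 0"
  proof (rule ccontr)
    assume H: "H \<noteq> 0"
    have ne: "degree H \<noteq> degree G"
      using cH H by (metis leading_coeff_0_iff)
    have lc: "lead_coeff (pderiv p) = of_nat (degree p) * lead_coeff p" for p :: "'k poly"
    proof (cases "degree p")
      case 0
      then have "pderiv p = 0" by (simp add: pderiv_eq_0_iff)
      then show ?thesis using 0 by simp
    next
      case (Suc n)
      then show ?thesis by (simp add: degree_pderiv coeff_pderiv)
    qed
    have d0: "degree (pderiv H) + degree G = degree H + degree (pderiv G)" if "degree H \<noteq> 0" "degree G \<noteq> 0"
      using that by (simp add: degree_pderiv)
    have "of_nat (degree H) * lead_coeff H * lead_coeff G = lead_coeff H * (of_nat (degree G) * lead_coeff G)"
      using arg_cong[OF wH, of lead_coeff] by (simp only: lead_coeff_mult lc)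
    then have "(of_nat (degree H) :: 'k) = of_nat (degree G)"
      using G H by simp
    then show False using ne by simp
  qed
  then show ?thesis using that[of c] by (simp add: H_def)
qed

lemma power_dvd_pderiv:
  fixes F :: "('k::field_char_0) poly"
  assumes "p ^ Suc m dvd F"
  shows "p ^ m dvd pderiv F"
proof -
  obtain Q where "F = p ^ Suc m * Q" using assms by (elim dvdE)
  then have "pderiv F = p ^ m * (p * pderiv Q) + p ^ m * smult (of_nat (Suc m)) (pderiv p * Q)"
    by (simp only: pderiv_mult pderiv_power_Suc) (simp add: mult_ac)
  then show ?thesis by (simp only: dvd_add dvd_triv_left)
qed

text \<open>
  The last polynomial \<open>G\<close> is eliminated by passing to \<open>F' G - F G'\<close>, whose order of vanishing drops
  by at most one, while the number of polynomials drops by one as well.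
\<close>

lemma finite_special_points:
  fixes F :: "nat \<Rightarrow> ('k::field_char_0) poly"
  shows "\<exists>A. finite A \<and> (\<forall>s. s \<notin> A \<longrightarrow> (\<forall>c. [:-s, 1:] ^ m dvd (\<Sum>i<m. smult (c i) (F i)) \<longrightarrow>
    (\<Sum>i<m. smult (c i) (F i)) = 0))"
proof (induction m arbitrary: F)
  case 0
  then show ?case by auto
next
  case (Suc m)
  let ?G = "F m"
  show ?case
  proof (cases "?G = 0")
    case True
    obtain A where "finite A" and A: "\<And>s c. s \<notin> A \<Longrightarrow> [:-s, 1:] ^ m dvd (\<Sum>i<m. smult (c i) (F i)) \<Longrightarrow>
        (\<Sum>i<m. smult (c i) (F i)) = 0"
      using Suc.IH[of F] by blast
    have "[:-s, 1:] ^ m dvd P" if "[:-s, 1:] ^ Suc m dvd P" for s and P :: "'k poly"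
      using that by (metis dvd_trans le_imp_power_dvd lessI less_imp_le_nat)
    then show ?thesis
      using \<open>finite A\<close> A True by (intro exI[of _ A]) simp
  next
    case False
    let ?W = "\<lambda>H. pderiv H * ?G - H * pderiv ?G"
    obtain A where "finite A" and A: "\<And>s c. s \<notin> A \<Longrightarrow> [:-s, 1:] ^ m dvd (\<Sum>i<m. smult (c i) (?W (F i))) \<Longrightarrow>
        (\<Sum>i<m. smult (c i) (?W (F i))) = 0"
      using Suc.IH[of "\<lambda>i. ?W (F i)"] by blast
    let ?A = "A \<union> {s. poly ?G s = 0}"
    have "(\<Sum>i<Suc m. smult (c i) (F i)) = 0"
      if s: "s \<notin> ?A" and dv: "[:-s, 1:] ^ Suc m dvd (\<Sum>i<Suc m. smult (c i) (F i))" for s c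
    proof -
      let ?P = "\<Sum>i<Suc m. smult (c i) (F i)"
      have pderiv_sum: "pderiv (sum f A) = (\<Sum>i\<in>A. pderiv (f i))" for f :: "nat \<Rightarrow> 'k poly" and A
        by (induction A rule: infinite_finite_induct) (simp_all add: pderiv_add)
      have "?W ?P = (\<Sum>i<Suc m. smult (c i) (?W (F i)))"
        by (simp add: pderiv_add pderiv_sum pderiv_smult algebra_simps sum_distrib_left sum_subtractf
            smult_diff_right)
      then have W: "?W ?P = (\<Sum>i<m. smult (c i) (?W (F i)))"
        by (simp add: mult.commute)
      have "[:-s, 1:] ^ m dvd ?P"
        using dv by (metis dvd_trans le_imp_power_dvd lessI less_imp_le_nat)
      then have "[:-s, 1:] ^ m dvd ?W ?P"
        using power_dvd_pderiv[OF dv] by (intro dvd_diff dvd_mult2)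
      then have "?W ?P = 0"
        using A[of s c] s unfolding W by blast
      then obtain a where a: "?P = smult a ?G"
        using proportional_if_wronskian_zero[OF False, of ?P] by (metis eq_iff_diff_eq_0)
      have "[:-s, 1:] dvd ?P"
        using dv by (metis dvd_mult_left power_Suc)
      then have "poly ?P s = 0"
        by (simp only: poly_eq_0_iff_dvd)
      then have "a * poly ?G s = 0" unfolding a by simp
      then have "a = 0" using s by simp
      then show ?thesis using a by simp
    qed
    moreover have "finite ?A"
      using \<open>finite A\<close> poly_roots_finite[OF False] by simp
    ultimately show ?thesis by blast
  qed
qed

lemma exists_general_shift:
  fixes F :: "nat \<Rightarrow> ('k::field_char_0) poly"
  obtains s where "\<And>c. (\<forall>j<m. coeff (pcompose (\<Sum>i<m. smult (c i) (F i)) [:s, 1:]) j = 0) \<Longrightarrow>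
    (\<Sum>i<m. smult (c i) (F i)) = 0"
proof -
  obtain A where "finite A" and A: "\<And>s c. s \<notin> A \<Longrightarrow> [:-s, 1:] ^ m dvd (\<Sum>i<m. smult (c i) (F i)) \<Longrightarrow>
      (\<Sum>i<m. smult (c i) (F i)) = 0"
    using finite_special_points[of m F] by blast
  obtain s where s: "s \<notin> A"
    using ex_new_if_finite[OF infinite_UNIV_char_0 \<open>finite A\<close>] by blast
  have "[:-s, 1:] ^ m dvd P" if P: "\<forall>j<m. coeff (pcompose P [:s, 1:]) j = 0" for P :: "'k poly"
  proof -
    have "monom 1 m dvd pcompose P [:s, 1:]"
      using P by (simp add: monom_1_dvd_iff')
    then obtain Q where Q: "pcompose P [:s, 1:] = monom 1 m * Q" by (elim dvdE)
    have "P = pcompose (pcompose P [:s, 1:]) [:-s, 1:]"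
      by (simp add: pcompose_assoc[symmetric] pcompose_pCons)
    also have "\<dots> = [:-s, 1:] ^ m * pcompose Q [:-s, 1:]"
    proof -
      have pcompose_power: "pcompose (p ^ n) q = pcompose p q ^ n" for p q :: "'k poly" and n
        by (induction n) (simp_all add: pcompose_mult one_pCons pcompose_pCons)
      show ?thesis
        by (simp add: Q pcompose_mult monom_altdef pcompose_power pcompose_pCons pcompose_smult)
    qed
    finally show ?thesis by (metis dvd_triv_left)
  qed
  then show ?thesis using that[of s] A[OF s] by blast
qed

section \<open>Evaluation of polynomials and the action of matrices\<close>

definition monomial_value :: "('x \<Rightarrow> 'r::comm_semiring_1) \<Rightarrow> ('x \<Rightarrow>\<^sub>0 nat) \<Rightarrow> 'r" where
  "monomial_value \<sigma> t = (\<Prod>i\<in>keys t. \<sigma> i ^ lookup t i)"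

lemma monomial_value_superset:
  "finite A \<Longrightarrow> keys t \<subseteq> A \<Longrightarrow> monomial_value \<sigma> t = (\<Prod>i\<in>A. \<sigma> i ^ lookup t i)"
  unfolding monomial_value_def by (intro prod.mono_neutral_left) (auto simp: in_keys_iff)

lemma monomial_value_add: "monomial_value \<sigma> (s + t) = monomial_value \<sigma> s * monomial_value \<sigma> t"
proof -
  let ?A = "keys s \<union> keys t"
  have "keys (s + t) \<subseteq> ?A" by (rule keys_add)
  then show ?thesis
    by (simp add: monomial_value_superset[of ?A] lookup_add power_add prod.distrib)
qed

lemma monomial_value_zero [simp]: "monomial_value \<sigma> 0 = 1"
  by (simp add: monomial_value_def)

lemma monomial_value_single [simp]: "monomial_value \<sigma> (Poly_Mapping.single i n) = \<sigma> i ^ n"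
  by (cases "n = 0") (simp_all add: monomial_value_def)

definition semiring_hom :: "('k::comm_semiring_1 \<Rightarrow> 'r::comm_semiring_1) \<Rightarrow> bool" where
  "semiring_hom c \<longleftrightarrow> c 0 = 0 \<and> c 1 = 1 \<and> (\<forall>a b. c (a + b) = c a + c b) \<and> (\<forall>a b. c (a * b) = c a * c b)"

lemma semiring_hom_id: "semiring_hom id"
  by (simp add: semiring_hom_def)

lemma semiring_hom_single: "semiring_hom (Poly_Mapping.single (0 :: 'a::comm_monoid_add) :: 'k::comm_semiring_1 \<Rightarrow> _)"
  by (simp add: semiring_hom_def single_add mult_single)

lemma poly_eval_superset:
  assumes "semiring_hom c" "finite A" "keys f \<subseteq> A"
  shows "poly_eval c \<sigma> f = (\<Sum>t\<in>A. c (lookup f t) * monomial_value \<sigma> t)"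
  unfolding poly_eval_def monomial_value_def[symmetric]
  using assms by (intro sum.mono_neutral_left) (auto simp: in_keys_iff semiring_hom_def)

lemma poly_eval_add:
  assumes "semiring_hom c"
  shows "poly_eval c \<sigma> (f + g) = poly_eval c \<sigma> f + poly_eval c \<sigma> g"
proof -
  let ?A = "keys f \<union> keys g"
  have "keys (f + g) \<subseteq> ?A" by (rule keys_add)
  moreover have "c (a + b) = c a + c b" for a b using assms by (simp add: semiring_hom_def)
  ultimately show ?thesis
    by (simp add: poly_eval_superset[OF assms, of ?A] lookup_add distrib_right sum.distrib)
qed

lemma poly_eval_zero [simp]: "poly_eval c \<sigma> 0 = 0"
  by (simp add: poly_eval_def)

lemma poly_eval_single: "semiring_hom c \<Longrightarrow> poly_eval c \<sigma> (Poly_Mapping.single t a) = c a * monomial_value \<sigma> t"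
  by (subst poly_eval_superset[of c "{t}"]) auto

lemma poly_eval_sum:
  "semiring_hom c \<Longrightarrow> poly_eval c \<sigma> (sum f A) = (\<Sum>x\<in>A. poly_eval c \<sigma> (f x))"
  by (induction A rule: infinite_finite_induct) (auto simp: poly_eval_add)

lemma poly_mapping_sum_singles: "f = (\<Sum>t\<in>keys f. Poly_Mapping.single t (lookup f t))"
  by (rule sum_single_keys[symmetric]) auto

lemma poly_eval_mult:
  assumes c: "semiring_hom c"
  shows "poly_eval c \<sigma> (f * g) = poly_eval c \<sigma> f * poly_eval c \<sigma> g"
proof -
  have cm: "c (a * b) = c a * c b" for a b using c by (simp add: semiring_hom_def)
  have "f * g = (\<Sum>s\<in>keys f. \<Sum>t\<in>keys g. Poly_Mapping.single (s + t) (lookup f s * lookup g t))"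
    by (subst poly_mapping_sum_singles[of f], subst poly_mapping_sum_singles[of g])
      (simp add: sum_product mult_single)
  then have "poly_eval c \<sigma> (f * g)
      = (\<Sum>s\<in>keys f. \<Sum>t\<in>keys g. (c (lookup f s) * monomial_value \<sigma> s) * (c (lookup g t) * monomial_value \<sigma> t))"
    by (simp add: poly_eval_sum[OF c] poly_eval_single[OF c] monomial_value_add cm mult_ac)
  then show ?thesis
    by (simp add: sum_product poly_eval_def monomial_value_def)
qed

lemma poly_eval_one: "semiring_hom c \<Longrightarrow> poly_eval c \<sigma> 1 = 1"
  using poly_eval_single[of c \<sigma> 0 1] by (simp add: semiring_hom_def)

lemma poly_eval_power: "semiring_hom c \<Longrightarrow> poly_eval c \<sigma> (p ^ n) = poly_eval c \<sigma> p ^ n"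
  by (induction n) (simp_all add: poly_eval_one poly_eval_mult)

lemma poly_eval_prod: "semiring_hom c \<Longrightarrow> poly_eval c \<sigma> (prod p A) = (\<Prod>x\<in>A. poly_eval c \<sigma> (p x))"
  by (induction A rule: infinite_finite_induct) (simp_all add: poly_eval_one poly_eval_mult)

lemma poly_eval_monomial_value:
  "semiring_hom c \<Longrightarrow> poly_eval c \<sigma> (monomial_value \<tau> t) = monomial_value (\<lambda>i. poly_eval c \<sigma> (\<tau> i)) t"
  unfolding monomial_value_def by (simp add: poly_eval_power poly_eval_prod)

definition linear_form :: "('k::field)^3^3 \<Rightarrow> 3 \<Rightarrow> 'k poly3" where
  "linear_form g j = (\<Sum>i\<in>UNIV. Poly_Mapping.single (Poly_Mapping.single i 1) (g $ i $ j))"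

lemma act_eq: "act g = poly_eval (Poly_Mapping.single 0) (linear_form g)"
  by (simp add: act_def linear_form_def[abs_def])

lemma poly_eval_act:
  assumes c: "semiring_hom c"
  shows "poly_eval c \<sigma> (act g f) = poly_eval c (\<lambda>j. \<Sum>i\<in>UNIV. c (g $ i $ j) * \<sigma> i) f"
proof -
  have lf: "poly_eval c \<sigma> (linear_form g j) = (\<Sum>i\<in>UNIV. c (g $ i $ j) * \<sigma> i)" for j
    by (simp add: linear_form_def poly_eval_sum[OF c] poly_eval_single[OF c])
  have "act g f = (\<Sum>t\<in>keys f. Poly_Mapping.single 0 (lookup f t) * monomial_value (linear_form g) t)"
    unfolding act_eq by (rule poly_eval_superset[OF semiring_hom_single]) auto
  then have "poly_eval c \<sigma> (act g f)
      = (\<Sum>t\<in>keys f. c (lookup f t) * monomial_value (\<lambda>j. poly_eval c \<sigma> (linear_form g j)) t)"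
    by (simp add: poly_eval_sum[OF c] poly_eval_mult[OF c] poly_eval_single[OF c] poly_eval_monomial_value[OF c])
  then show ?thesis
    unfolding lf by (simp add: poly_eval_superset[OF c, of "keys f" f])
qed

lemma act_act: "act g (act h f) = act (g ** h) f"
proof -
  have "(\<Sum>i\<in>UNIV. Poly_Mapping.single 0 (h $ i $ j) * linear_form g i) = linear_form (g ** h) j" for j
  proof -
    have "(\<Sum>i\<in>UNIV. Poly_Mapping.single 0 (h $ i $ j) * linear_form g i)
        = (\<Sum>i\<in>UNIV. \<Sum>l\<in>UNIV. Poly_Mapping.single (Poly_Mapping.single l 1) (g $ l $ i * h $ i $ j))"
      by (simp add: linear_form_def sum_distrib_left mult_single mult.commute)
    also have "\<dots> = (\<Sum>l\<in>UNIV. \<Sum>i\<in>UNIV. Poly_Mapping.single (Poly_Mapping.single l 1) (g $ l $ i * h $ i $ j))"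
      by (rule sum.swap)
    also have "\<dots> = linear_form (g ** h) j"
    proof -
      have s: "(\<Sum>i\<in>A. Poly_Mapping.single u (p i)) = Poly_Mapping.single u (\<Sum>i\<in>A. p i)"
        for u :: mon3 and p :: "3 \<Rightarrow> 'a" and A
        by (induction A rule: infinite_finite_induct) (simp_all add: single_add)
      show ?thesis by (simp add: linear_form_def matrix_matrix_mult_def s)
    qed
    finally show ?thesis .
  qed
  then show ?thesis
    unfolding act_eq[of g] poly_eval_act[OF semiring_hom_single] act_eq[of "g ** h"] by simp
qed

lemma act_mat_1: "act (mat 1) f = f"
proof -
  have lf: "linear_form (mat 1) = (\<lambda>j. mono_poly (Poly_Mapping.single j 1))"
    by (simp add: fun_eq_iff linear_form_def mat_def if_distrib sum.delta cong: if_cong)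
  have sp: "mono_poly (Poly_Mapping.single j 1) ^ n = mono_poly (Poly_Mapping.single j n)" for j :: 3 and n
    by (induction n) (simp_all add: mult_single single_add[symmetric])
  have pr: "(\<Prod>i\<in>A. mono_poly (p i)) = mono_poly (sum p A)" for p :: "3 \<Rightarrow> mon3" and A
    by (induction A rule: infinite_finite_induct) (simp_all add: mult_single)
  have "monomial_value (linear_form (mat 1)) t = (mono_poly t :: 'a poly3)" for t
    unfolding monomial_value_def lf sp pr using sum_single_keys[of "keys t" t] by simp
  then show ?thesis
    unfolding act_eq poly_eval_superset[OF semiring_hom_single finite_keys order_refl]
    by (simp add: mult_single poly_mapping_sum_singles[symmetric])
qed

lemma act_add: "act g (f + h) = act g f + act g h"
  unfolding act_eq by (rule poly_eval_add[OF semiring_hom_single])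

lemma act_mult: "act g (f * h) = act g f * act g h"
  unfolding act_eq by (rule poly_eval_mult[OF semiring_hom_single])

lemma act_zero [simp]: "act g 0 = 0"
  by (simp add: act_eq)

lemma act_pscale: "act g (pscale a f) = pscale a (act g f)"
  unfolding pscale_eq_mult act_mult by (simp add: act_eq poly_eval_single[OF semiring_hom_single])

lemma linear_act: "Vector_Spaces.linear pscale pscale (act g)"
  by (rule Vector_Spaces.linear_iff[THEN iffD2]) (auto simp: act_add act_pscale ps.vector_space_axioms)

lemma act_power: "act g (f ^ n) = act g f ^ n"
proof (induction n)
  case 0
  then show ?case by (simp add: act_eq poly_eval_one[OF semiring_hom_single])
qed (simp add: act_mult)

lemma act_diff: "act g (f - h) = act g f - act g h"
  by (metis act_add add_diff_cancel_right' diff_add_cancel)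

lemma act_sum: "act g (sum f A) = (\<Sum>x\<in>A. act g (f x))"
  by (induction A rule: infinite_finite_induct) (auto simp: act_add)

lemma act_var: "act g (mono_poly (Poly_Mapping.single j 1)) = linear_form g j"
  by (simp add: act_eq poly_eval_single[OF semiring_hom_single])

lemma act_homog: 
  assumes "f \<in> homog d"
  shows "act g f \<in> homog d"
proof -
  have lf: "linear_form g j \<in> homog 1" for j
    unfolding linear_form_def by (intro homog_sum homog_single) simp
  have pr: "(\<Prod>i\<in>A. p i) \<in> homog (\<Sum>i\<in>A. n i)" if "\<And>i. p i \<in> homog (n i)" "finite A"
    for p :: "3 \<Rightarrow> 'a poly3" and A n
    using that(2,1) by (induction A rule: finite_induct) (auto simp: homog_one intro: homog_mult)
  have "monomial_value (linear_form g) t \<in> homog (mdeg t)" for t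
  proof -
    have "monomial_value (linear_form g) t = (\<Prod>i\<in>UNIV. linear_form g i ^ lookup t i)"
      by (rule monomial_value_superset) auto
    then show ?thesis
      unfolding mdeg_def using pr[of "\<lambda>i. linear_form g i ^ lookup t i" "lookup t" UNIV]
        homog_power[OF lf] by simp
  qed
  then have "pscale (lookup f t) (monomial_value (linear_form g) t) \<in> homog d" if "t \<in> keys f" for t
    using assms that homog_pscale by (fastforce simp: homog_def)
  then show ?thesis
    unfolding act_eq poly_eval_superset[OF semiring_hom_single finite_keys order_refl]
    by (intro homog_sum) (simp add: pscale_eq_mult)
qed

lemma act_inverse:
  assumes "invertible g"
  obtains h where "invertible h" "\<And>f. act g (act h f) = f" "\<And>f. act h (act g f) = f"
proof -
  obtain h where h: "g ** h = mat 1" "h ** g = mat 1"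
    using assms by (auto simp: invertible_def)
  then have "invertible h" by (auto simp: invertible_def)
  then show ?thesis using that h by (simp add: act_act act_mat_1)
qed

section \<open>Polynomial functions on matrices\<close>

inductive polyfun :: "(('k::field)^3^3 \<Rightarrow> 'k) \<Rightarrow> bool" where
  const: "polyfun (\<lambda>_. c)"
| entry: "polyfun (\<lambda>g. g $ i $ j)"
| add: "polyfun p \<Longrightarrow> polyfun q \<Longrightarrow> polyfun (\<lambda>g. p g + q g)"
| mult: "polyfun p \<Longrightarrow> polyfun q \<Longrightarrow> polyfun (\<lambda>g. p g * q g)"

lemma polyfun_sum: "(\<And>x. x \<in> A \<Longrightarrow> polyfun (f x)) \<Longrightarrow> polyfun (\<lambda>g. \<Sum>x\<in>A. f x g)"
  by (induction A rule: infinite_finite_induct) (auto intro: polyfun.intros)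

lemma polyfun_prod: "(\<And>x. x \<in> A \<Longrightarrow> polyfun (f x)) \<Longrightarrow> polyfun (\<lambda>g. \<Prod>x\<in>A. f x g)"
  by (induction A rule: infinite_finite_induct) (auto intro: polyfun.intros)

lemma polyfun_power: "polyfun f \<Longrightarrow> polyfun (\<lambda>g. f g ^ n)"
  by (induction n) (auto intro: polyfun.intros)

lemma polyfun_minus: "polyfun p \<Longrightarrow> polyfun q \<Longrightarrow> polyfun (\<lambda>g. p g - q g)"
  using polyfun.add[OF _ polyfun.mult[OF polyfun.const[of "- 1"]]] by fastforce

lemma polyfun_poly_eval: "polyfun (\<lambda>g. poly_eval id (\<lambda>(i, j). g $ i $ j) p)"
proof -
  have "polyfun (\<lambda>g. \<Prod>x\<in>keys t. (case x of (i, j) \<Rightarrow> g $ i $ j) ^ lookup t x)" for t :: "3 \<times> 3 \<Rightarrow>\<^sub>0 nat"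
    by (rule polyfun_prod, rule polyfun_power) (simp add: case_prod_beta polyfun.entry)
  then show ?thesis
    unfolding poly_eval_def by (intro polyfun_sum polyfun.mult polyfun.const)
qed

lemma polyfun_imp_poly_eval:
  assumes "polyfun f"
  shows "\<exists>p. \<forall>g. f g = poly_eval id (\<lambda>(i, j). g $ i $ j) p"
  using assms
proof induction
  case (const c)
  show ?case
    by (rule exI[of _ "Poly_Mapping.single 0 c"], unfold poly_eval_single[OF semiring_hom_id]) simp
next
  case (entry i j)
  show ?case
    by (rule exI[of _ "Poly_Mapping.single (Poly_Mapping.single (i, j) 1) 1"],
        unfold poly_eval_single[OF semiring_hom_id]) simp
next
  case (add p q)
  then obtain P Q where "\<forall>g. p g = poly_eval id (\<lambda>(i, j). g $ i $ j) P"
    "\<forall>g. q g = poly_eval id (\<lambda>(i, j). g $ i $ j) Q" by blast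
  then show ?case
    by (intro exI[of _ "P + Q"], unfold poly_eval_add[OF semiring_hom_id]) simp
next
  case (mult p q)
  then obtain P Q where "\<forall>g. p g = poly_eval id (\<lambda>(i, j). g $ i $ j) P"
    "\<forall>g. q g = poly_eval id (\<lambda>(i, j). g $ i $ j) Q" by blast
  then show ?case
    by (intro exI[of _ "P * Q"], unfold poly_eval_mult[OF semiring_hom_id]) simp
qed

lemma polyfun_on_line:
  assumes "polyfun f"
  shows "\<exists>P. \<forall>t. f (\<chi> i j. a $ i $ j + t * b $ i $ j) = poly P t"
  using assms
proof induction
  case (const c)
  show ?case by (rule exI[of _ "[:c:]"]) simp
next
  case (entry i j)
  show ?case by (rule exI[of _ "[:a $ i $ j, b $ i $ j:]"]) (simp add: mult.commute)
next
  case (add p q)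
  then show ?case by (metis poly_add)
next
  case (mult p q)
  then show ?case by (metis poly_mult)
qed

text \<open>On the line through \<open>a\<close> and \<open>b\<close>, each of the two functions has finitely many zeros.\<close>

lemma polyfun_common_nonzero:
  fixes f h :: "('k::field_char_0)^3^3 \<Rightarrow> 'k"
  assumes "polyfun f" "polyfun h" "f a \<noteq> 0" "h b \<noteq> 0"
  shows "\<exists>g. f g \<noteq> 0 \<and> h g \<noteq> 0"
proof -
  define l where "l t = (\<chi> i j. a $ i $ j + t * (b - a) $ i $ j)" for t
  obtain P where P: "\<And>t. f (l t) = poly P t"
    unfolding l_def using polyfun_on_line[OF assms(1)] by blast
  obtain Q where Q: "\<And>t. h (l t) = poly Q t"
    unfolding l_def using polyfun_on_line[OF assms(2)] by blast
  have "l 0 = a" "l 1 = b"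
    by (simp_all add: l_def vec_eq_iff)
  then have "P \<noteq> 0" "Q \<noteq> 0"
    using P[of 0] Q[of 1] assms by auto
  then have "finite {t. poly (P * Q) t = 0}"
    by (intro poly_roots_finite) simp
  then obtain t where "poly (P * Q) t \<noteq> 0"
    using ex_new_if_finite[OF infinite_UNIV_char_0] by blast
  then have "f (l t) \<noteq> 0 \<and> h (l t) \<noteq> 0" by (simp add: P Q)
  then show ?thesis by blast
qed

lemma polyfun_common_nonzero_finite:
  fixes f :: "'a \<Rightarrow> ('k::field_char_0)^3^3 \<Rightarrow> 'k"
  assumes "finite A" "\<And>x. x \<in> A \<Longrightarrow> polyfun (f x) \<and> (\<exists>g. f x g \<noteq> 0)"
  shows "\<exists>g. \<forall>x\<in>A. f x g \<noteq> 0"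
  using assms
proof (induction A rule: finite_induct)
  case (insert x A)
  have fin: "(\<Prod>y\<in>A. f y g) \<noteq> 0 \<longleftrightarrow> (\<forall>y\<in>A. f y g \<noteq> 0)" for g
    using insert.hyps(1) by simp
  obtain a where "f x a \<noteq> 0" using insert.prems by blast
  moreover obtain b where "(\<Prod>y\<in>A. f y b) \<noteq> 0"
    using insert fin by blast
  moreover have "polyfun (\<lambda>g. \<Prod>y\<in>A. f y g)"
    using insert.prems by (intro polyfun_prod) blast
  ultimately obtain g where "f x g \<noteq> 0 \<and> (\<Prod>y\<in>A. f y g) \<noteq> 0"
    using polyfun_common_nonzero[of "f x" "\<lambda>g. \<Prod>y\<in>A. f y g" a b] insert.prems by blast
  then show ?case using fin by blast
qed simp

lemma polyfun_det: "polyfun det"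
proof -
  have e: "(det :: 'a^3^3 \<Rightarrow> 'a) = (\<lambda>A.
      A$1$1 * A$2$2 * A$3$3 + A$1$2 * A$2$3 * A$3$1 + A$1$3 * A$2$1 * A$3$2 -
      A$1$1 * A$2$3 * A$3$2 - A$1$2 * A$2$1 * A$3$3 - A$1$3 * A$2$2 * A$3$1)"
    by (simp add: fun_eq_iff det_3)
  show ?thesis
    unfolding e by (intro polyfun_minus polyfun.add polyfun.mult polyfun.entry)
qed

lemma polyfun_lookup_act:
  fixes f :: "('k::field) poly3"
  shows "polyfun (\<lambda>g. lookup (act g f) t)"
proof -
  have lin: "polyfun (\<lambda>g. lookup (linear_form g j * F g) t)" if F: "\<And>s. polyfun (\<lambda>g. lookup (F g) s)"
    for j t and F :: "'k^3^3 \<Rightarrow> 'k poly3"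
  proof -
    have "polyfun (\<lambda>g. lookup (Poly_Mapping.single (Poly_Mapping.single i 1) (g $ i $ j) * F g) t)" for i
    proof (cases "\<exists>s. t = Poly_Mapping.single i 1 + s")
      case True
      then obtain s where s: "t = Poly_Mapping.single i 1 + s" by blast
      show ?thesis
        unfolding s lookup_single_mult_add by (intro polyfun.mult polyfun.entry F)
    next
      case False
      then have "(\<lambda>g. lookup (Poly_Mapping.single (Poly_Mapping.single i 1) (g $ i $ j) * F g) t) = (\<lambda>_. 0)"
        by (intro ext lookup_single_mult_not_add) blast
      then show ?thesis by (simp add: polyfun.const)
    qed
    then show ?thesis
      unfolding linear_form_def sum_distrib_right lookup_sum by (intro polyfun_sum)
  qed
  have pow: "polyfun (\<lambda>g. lookup (linear_form g j ^ n * F g) t)" if F: "\<And>s. polyfun (\<lambda>g. lookup (F g) s)"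
    for j n t and F :: "'k^3^3 \<Rightarrow> 'k poly3"
  proof (induction n arbitrary: t)
    case 0
    show ?case using F by simp
  next
    case (Suc n)
    show ?case
      using lin[of "\<lambda>g. linear_form g j ^ n * F g" j t, OF Suc] by (simp add: mult.assoc)
  qed
  have "polyfun (\<lambda>g :: 'k^3^3. lookup (\<Prod>i\<in>A. linear_form g i ^ n i) t)" for A :: "3 set" and n t
  proof -
    have "finite A" by simp
    then show ?thesis
    proof (induction A arbitrary: t rule: finite_induct)
      case empty
      show ?case by (simp add: polyfun.const)
    next
      case (insert x A)
      show ?case
        using pow[of "\<lambda>g. \<Prod>i\<in>A. linear_form g i ^ n i" x "n x" t, OF insert.IH] insert.hyps by simp
    qed
  qed
  then have "polyfun (\<lambda>g :: 'k^3^3. lookup (monomial_value (linear_form g) s) t)" for s t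
    unfolding monomial_value_def .
  moreover have "act g f = (\<Sum>s\<in>keys f. pscale (lookup f s) (monomial_value (linear_form g) s))" for g
    unfolding act_eq poly_eval_superset[OF semiring_hom_single finite_keys order_refl] pscale_eq_mult ..
  ultimately show ?thesis
    by (simp add: lookup_sum) (intro polyfun_sum polyfun.mult polyfun.const)
qed

text \<open>
  Gaussian elimination without divisions keeps the entries polynomial, and \<open>p\<close> is the product of the
  pivots. At \<open>g\<^sub>0\<close> the elimination only multiplies the rows by earlier pivots, since the entries to be
  used for clearing vanish there; so the pivots are nonzero at \<open>g\<^sub>0\<close>.
\<close>

lemma triangular_kernel_open:
  fixes A :: "'t \<Rightarrow> 't \<Rightarrow> ('k::field)^3^3 \<Rightarrow> 'k" and rank :: "'t \<Rightarrow> nat"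
  assumes "finite T"
    and "\<And>s t. s \<in> T \<Longrightarrow> t \<in> T \<Longrightarrow> polyfun (A t s)"
    and "\<And>t. t \<in> T \<Longrightarrow> A t t g0 \<noteq> 0"
    and "\<And>s t. s \<in> T \<Longrightarrow> t \<in> T \<Longrightarrow> s \<noteq> t \<Longrightarrow> rank t \<le> rank s \<Longrightarrow> A t s g0 = 0"
  shows "\<exists>p. polyfun p \<and> p g0 \<noteq> 0 \<and> (\<forall>g c. p g \<noteq> 0 \<longrightarrow>
    (\<forall>t\<in>T. (\<Sum>s\<in>T. A t s g * c s) = 0) \<longrightarrow> (\<forall>s\<in>T. c s = 0))"
  using assms
proof (induction "card T" arbitrary: T A)
  case 0
  then have "T = {}" by simp
  then show ?case by (intro exI[of _ "\<lambda>_. 1"]) (simp add: polyfun.const)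
next
  case (Suc n)
  then have "T \<noteq> {}" by auto
  then obtain m where m: "m \<in> T" "\<And>s. s \<in> T \<Longrightarrow> rank m \<le> rank s"
    using arg_min_if_finite[OF Suc.prems(1), of rank] by (metis leI)
  define T' where "T' = T - {m}"
  define A' where "A' t s g = A m m g * A t s g - A t m g * A m s g" for t s g
  have T': "finite T'" "card T' = n" "T = insert m T'" "m \<notin> T'"
    using Suc.prems(1) Suc.hyps(2) m(1) by (auto simp: T'_def)
  have row: "A m s g0 = 0" if "s \<in> T'" for s
    using Suc.prems(4)[of s m] m that by (auto simp: T'_def)
  have "\<exists>p. polyfun p \<and> p g0 \<noteq> 0 \<and> (\<forall>g c. p g \<noteq> 0 \<longrightarrow>
      (\<forall>t\<in>T'. (\<Sum>s\<in>T'. A' t s g * c s) = 0) \<longrightarrow> (\<forall>s\<in>T'. c s = 0))"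
  proof (rule Suc.hyps(1)[of T' A'])
    show "n = card T'" "finite T'" using T' by simp_all
    show "polyfun (A' t s)" if "s \<in> T'" "t \<in> T'" for s t
    proof -
      have "s \<in> T" "t \<in> T" using that by (auto simp: T'_def)
      then show ?thesis
        unfolding A'_def using m(1) by (intro polyfun_minus polyfun.mult Suc.prems(2))
    qed
    show "A' t t g0 \<noteq> 0" if "t \<in> T'" for t
      unfolding A'_def using row[OF that] Suc.prems(3)[of t] Suc.prems(3)[OF m(1)] that by (simp add: T'_def)
    show "A' t s g0 = 0" if "s \<in> T'" "t \<in> T'" "s \<noteq> t" "rank t \<le> rank s" for s t
      unfolding A'_def using row[OF that(1)] Suc.prems(4)[of s t] that by (simp add: T'_def)
  qed
  then obtain p where p: "polyfun p" "p g0 \<noteq> 0" and pk: "\<And>g c. p g \<noteq> 0 \<Longrightarrow>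
      (\<forall>t\<in>T'. (\<Sum>s\<in>T'. A' t s g * c s) = 0) \<Longrightarrow> (\<forall>s\<in>T'. c s = 0)"
    by blast
  have "\<forall>s\<in>T. c s = 0" if g: "A m m g * p g \<noteq> 0" and k: "\<forall>t\<in>T. (\<Sum>s\<in>T. A t s g * c s) = 0" for g c
  proof -
    have e: "(\<Sum>s\<in>T'. A t s g * c s) = - (A t m g * c m)" if "t \<in> T" for t
    proof -
      have "(\<Sum>s\<in>T. A t s g * c s) = A t m g * c m + (\<Sum>s\<in>T'. A t s g * c s)"
        unfolding T'(3) using T'(1,4) by simp
      then show ?thesis
        using k[rule_format, OF that] by (simp add: eq_neg_iff_add_eq_0 add.commute)
    qed
    have "(\<Sum>s\<in>T'. A' t s g * c s) = 0" if t: "t \<in> T'" for t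
    proof -
      have "(\<Sum>s\<in>T'. A' t s g * c s)
          = A m m g * (\<Sum>s\<in>T'. A t s g * c s) - A t m g * (\<Sum>s\<in>T'. A m s g * c s)"
        by (simp add: A'_def left_diff_distrib sum_subtractf sum_distrib_left mult.assoc)
      then show ?thesis
        using e[of t] e[OF m(1)] t by (simp add: T'_def)
    qed
    then have c0: "\<forall>s\<in>T'. c s = 0"
      using pk[of g c] g by simp
    then have "A m m g * c m = 0"
      using e[OF m(1)] by simp
    then show ?thesis
      using c0 g by (auto simp: T'_def)
  qed
  moreover have "polyfun (\<lambda>g. A m m g * p g)"
    using Suc.prems(2) m(1) p(1) by (intro polyfun.mult) auto
  moreover have "A m m g0 * p g0 \<noteq> 0"
    using Suc.prems(3)[OF m(1)] p(2) by simp
  ultimately show ?case by blast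
qed

lemma card_le_dim_if_independent_family:
  assumes "finite A" "fin_dim_subspace pscale V" "\<And>a. a \<in> A \<Longrightarrow> w a \<in> V"
    and "\<And>c. (\<Sum>a\<in>A. pscale (c a) (w a)) = 0 \<Longrightarrow> \<forall>a\<in>A. c a = 0"
  shows "card A \<le> ps.dim (V :: ('a \<Rightarrow>\<^sub>0 'k::field) set)"
proof -
  let ?f = "\<lambda>c :: 'b \<Rightarrow>\<^sub>0 'k. \<Sum>a\<in>A. pscale (lookup c a) (w a)"
  have lin: "Vector_Spaces.linear pscale pscale ?f"
    by (rule Vector_Spaces.linear_iff[THEN iffD2])
      (auto simp: lookup_add ps.scale_left_distrib sum.distrib ps.scale_sum_right ps.vector_space_axioms)
  have inj: "c = 0" if c: "c \<in> supported_on A" "?f c = 0" for c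
  proof (rule poly_mapping_eqI)
    fix t
    have "\<forall>a\<in>A. lookup c a = 0" by (rule assms(4)[OF c(2)])
    then show "lookup c t = lookup 0 t"
      using c(1) by (cases "t \<in> A") (simp_all add: supported_on_iff)
  qed
  have "ps.dim (?f ` supported_on A) = ps.dim (supported_on A :: ('b \<Rightarrow>\<^sub>0 'k) set)"
    by (rule psps.dim_image_inj[OF lin fin_dim_supported_on[OF assms(1)] inj])
  then have "ps.dim (?f ` supported_on A) = card A"
    unfolding dim_supported_on[OF assms(1)] .
  moreover have "ps.subspace (?f ` supported_on A)"
    by (rule ps.fin_dim_subspace_subspace,
        rule psps.fin_dim_subspace_image[OF lin fin_dim_supported_on[OF assms(1)]])
  moreover have "?f ` supported_on A \<subseteq> V"
    using ps.fin_dim_subspace_subspace[OF assms(2)] assms(3)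
    by (auto intro!: ps.subspace_sum ps.subspace_scale)
  ultimately show ?thesis
    using ps.dim_mono_fin[OF assms(2), of "?f ` supported_on A"] by simp
qed

text \<open>
  The elements of \<open>g\<^sub>0 V\<close> with distinct initial monomials of rank less than \<open>n\<close> give a triangular
  matrix of coefficients.
\<close>

lemma tail_dim_semicontinuous:
  fixes V :: "('k::field) poly3 set"
  assumes V: "ps.subspace V" "V \<subseteq> homog d"
    and inj: "\<And>f. f \<in> V \<Longrightarrow> act g0 f = 0 \<Longrightarrow> f = 0"
  shows "\<exists>p. polyfun p \<and> p g0 \<noteq> 0 \<and> (\<forall>g. invertible g \<longrightarrow> p g \<noteq> 0 \<longrightarrow>
    ps.dim (act g ` V \<inter> tail_space d n) \<le> ps.dim (act g0 ` V \<inter> tail_space d n))"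
proof -
  have fV: "fin_dim_subspace pscale V"
    by (rule ps.fin_dim_subspace_mono[OF fin_dim_homog V])
  have im: "ps.subspace (act g ` V)" "act g ` V \<subseteq> homog d" for g
    using psps.fin_dim_subspace_image[OF linear_act fV] ps.fin_dim_subspace_subspace act_homog V(2)
    by blast+
  define T where "T = {t \<in> lead_mons d (act g0 ` V). revlex_rank d t < n}"
  have Tm: "T \<subseteq> mons d"
    using lead_mons_subset[OF im(2)] by (auto simp: T_def)
  have fl: "finite (lead_mons d (act g0 ` V))"
    using lead_mons_subset[OF im(2)] finite_subset finite_mons by blast
  then have fT: "finite T" by (simp add: T_def)
  have "\<exists>v\<in>V. t \<in> keys (act g0 v) \<and> (\<forall>s\<in>keys (act g0 v). revlex_rank d t \<le> revlex_rank d s)"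
    if "t \<in> T" for t
    using that by (auto simp: T_def lead_mons_def)
  then obtain v where v: "\<And>t. t \<in> T \<Longrightarrow> v t \<in> V"
    "\<And>t. t \<in> T \<Longrightarrow> t \<in> keys (act g0 (v t))"
    "\<And>t s. t \<in> T \<Longrightarrow> s \<in> keys (act g0 (v t)) \<Longrightarrow> revlex_rank d t \<le> revlex_rank d s"
    by metis
  have "\<exists>p. polyfun p \<and> p g0 \<noteq> 0 \<and> (\<forall>g c. p g \<noteq> 0 \<longrightarrow>
    (\<forall>t\<in>T. (\<Sum>s\<in>T. lookup (act g (v s)) t * c s) = 0) \<longrightarrow> (\<forall>s\<in>T. c s = 0))"
  proof (rule triangular_kernel_open[OF fT, where rank = "revlex_rank d"])
    show "polyfun (\<lambda>g. lookup (act g (v s)) t)" for s t by (rule polyfun_lookup_act)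
    show "lookup (act g0 (v t)) t \<noteq> 0" if "t \<in> T" for t
      using v(2)[OF that] by (simp add: in_keys_iff)
    show "lookup (act g0 (v s)) t = 0" if "s \<in> T" "t \<in> T" "s \<noteq> t" "revlex_rank d t \<le> revlex_rank d s" for s t
    proof (rule ccontr)
      assume "lookup (act g0 (v s)) t \<noteq> 0"
      then have "revlex_rank d s \<le> revlex_rank d t"
        using v(3)[OF that(1)] by (simp add: in_keys_iff)
      then show False
        using that revlex_rank_inj[of s d t] Tm by auto
    qed
  qed
  then obtain p where p: "polyfun p" "p g0 \<noteq> 0" "\<And>g c. p g \<noteq> 0 \<Longrightarrow>
    (\<forall>t\<in>T. (\<Sum>s\<in>T. lookup (act g (v s)) t * c s) = 0) \<Longrightarrow> (\<forall>s\<in>T. c s = 0)"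
    by blast
  let ?r = "restrict_to {t \<in> mons d. revlex_rank d t < n}"
  have "ps.dim (act g ` V \<inter> tail_space d n) \<le> ps.dim (act g0 ` V \<inter> tail_space d n)"
    if g: "invertible g" "p g \<noteq> 0" for g
  proof -
    have inj_g: "f = 0" if "act g f = 0" for f
      using act_inverse[OF g(1)] that by (metis act_zero)
    have "card T \<le> ps.dim (?r ` act g ` V)"
    proof (rule card_le_dim_if_independent_family[OF fT, of _ "\<lambda>t. ?r (act g (v t))"])
      show "fin_dim_subspace pscale (?r ` act g ` V)" by (rule dim_split_tail_space(2)[OF im])
      show "?r (act g (v t)) \<in> ?r ` act g ` V" if "t \<in> T" for t using v(1)[OF that] by blast
      fix c assume c: "(\<Sum>t\<in>T. pscale (c t) (?r (act g (v t)))) = 0"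
      have "(\<Sum>s\<in>T. lookup (act g (v s)) t * c s) = 0" if "t \<in> T" for t
      proof -
        have "lookup (\<Sum>s\<in>T. pscale (c s) (?r (act g (v s)))) t = (\<Sum>s\<in>T. lookup (act g (v s)) t * c s)"
          using that Tm unfolding lookup_sum by (intro sum.cong) (auto simp: T_def mult.commute)
        then show ?thesis using c by simp
      qed
      then show "\<forall>a\<in>T. c a = 0" using p(3)[OF g(2)] by blast
    qed
    moreover have "ps.dim (act g ` V) = ps.dim V"
      by (rule psps.dim_image_inj[OF linear_act fV inj_g])
    moreover have "ps.dim (act g0 ` V) = ps.dim V"
      by (rule psps.dim_image_inj[OF linear_act fV inj])
    moreover have "ps.dim (act g0 ` V) = card T + ps.dim (act g0 ` V \<inter> tail_space d n)"
    proof -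
      have "lead_mons d (act g0 ` V) = T \<union> {t \<in> lead_mons d (act g0 ` V). n \<le> revlex_rank d t}"
        by (auto simp: T_def)
      moreover have "T \<inter> {t \<in> lead_mons d (act g0 ` V). n \<le> revlex_rank d t} = {}"
        by (auto simp: T_def)
      ultimately have "card (lead_mons d (act g0 ` V))
          = card T + card {t \<in> lead_mons d (act g0 ` V). n \<le> revlex_rank d t}"
        using fT fl by (metis (no_types, lifting) card_Un_disjoint finite_Un)
      then show ?thesis
        unfolding card_lead_mons[OF im] dim_inter_tail_space[OF im] .
    qed
    ultimately show ?thesis
      using dim_split_tail_space(1)[OF im, of g n] by simp
  qed
  then show ?thesis using p(1,2) by blast
qed

section \<open>Homogeneous ideals after a change of coordinates\<close>

lemma hom_component_act: "hom_component d (act g f) = act g (hom_component d f)"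
proof -
  let ?D = "insert d (mdeg ` keys f)"
  have "hom_component d (act g f) = hom_component d (act g (\<Sum>e\<in>?D. hom_component e f))"
    by (subst sum_hom_components) auto
  also have "\<dots> = (\<Sum>e\<in>?D. hom_component d (act g (hom_component e f)))"
    by (simp only: act_sum hom_component_sum)
  also have "\<dots> = (\<Sum>e\<in>?D. if e = d then act g (hom_component d f) else 0)"
    by (rule sum.cong) (auto simp: hom_component_of_homog[OF act_homog[OF hom_component_homog]])
  also have "\<dots> = act g (hom_component d f)"
    by (subst sum.delta) auto
  finally show ?thesis .
qed

lemma homogeneous_ideal_act:
  assumes "homogeneous_ideal I" "invertible g"
  shows "homogeneous_ideal (act g ` I)"
proof -
  have I: "ideal I R3" and hom: "\<And>f d. f \<in> I \<Longrightarrow> hom_component d f \<in> I"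
    using assms(1) by (auto simp: homogeneous_ideal_def)
  obtain h where h: "\<And>f. act g (act h f) = f"
    using act_inverse[OF assms(2)] by metis
  have "ideal (act g ` I) R3"
    unfolding ideal_R3_iff
  proof (intro conjI ballI allI)
    show "0 \<in> act g ` I"
      using I unfolding ideal_R3_iff by (metis act_zero image_eqI)
    show "x + y \<in> act g ` I" if "x \<in> act g ` I" "y \<in> act g ` I" for x y
      using that I unfolding ideal_R3_iff by (auto simp: act_add[symmetric])
    show "r * x \<in> act g ` I" if x: "x \<in> act g ` I" for r x
    proof -
      obtain f where f: "f \<in> I" "x = act g f" using x by blast
      have "r * x = act g (act h r * f)" by (simp add: act_mult h f(2))
      then show ?thesis using f(1) I unfolding ideal_R3_iff by blast
    qed
  qed
  then show ?thesis
    using hom by (auto simp: homogeneous_ideal_def hom_component_act)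
qed

lemma act_piece:
  assumes "invertible g"
  shows "act g ` I \<inter> homog d = act g ` (I \<inter> homog d)"
proof -
  obtain h where h: "\<And>f. act h (act g f) = f"
    using act_inverse[OF assms] by metis
  have "f \<in> homog d" if "act g f \<in> homog d" for f
    using act_homog[OF that, of h] h by simp
  then show ?thesis using act_homog by blast
qed

lemma act_eq_0: "invertible g \<Longrightarrow> act g f = 0 \<Longrightarrow> f = 0"
  using act_inverse by (metis act_zero)

lemma dim_act_piece:
  assumes "ideal I R3" "invertible g"
  shows "ps.dim (act g ` I \<inter> homog d) = ps.dim (I \<inter> homog d)"
  unfolding act_piece[OF assms(2)]
  by (rule psps.dim_image_inj[OF linear_act ideal_piece_fin_dim[OF assms(1)] act_eq_0[OF assms(2)]])

text \<open>
  The order compares degrees first, so \<open>f\<close> has the same initial monomial as its component of highest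
  degree.
\<close>

lemma lead_mon_in_ideal_iff:
  assumes "homogeneous_ideal I"
  shows "(\<exists>f\<in>I. is_lead_mon f t) \<longleftrightarrow> t \<in> lead_mons (mdeg t) (I \<inter> homog (mdeg t))"
proof
  assume "\<exists>f\<in>I. is_lead_mon f t"
  then obtain f where f: "f \<in> I" "is_lead_mon f t" by blast
  let ?h = "hom_component (mdeg t) f"
  have k: "keys ?h = {s \<in> keys f. mdeg s = mdeg t}"
    by (auto simp: in_keys_iff lookup_hom_component split: if_splits)
  have "is_lead_mon ?h t"
    using f(2) by (auto simp: is_lead_mon_def k)
  moreover have "?h \<in> I \<inter> homog (mdeg t)"
    using f(1) assms by (simp add: homogeneous_ideal_def)
  ultimately show "t \<in> lead_mons (mdeg t) (I \<inter> homog (mdeg t))"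
    unfolding lead_mons_def using is_lead_mon_iff_rank[OF hom_component_homog] by blast
next
  assume "t \<in> lead_mons (mdeg t) (I \<inter> homog (mdeg t))"
  then obtain f where "f \<in> I" "f \<in> homog (mdeg t)"
    "t \<in> keys f \<and> (\<forall>s\<in>keys f. revlex_rank (mdeg t) t \<le> revlex_rank (mdeg t) s)"
    by (auto simp: lead_mons_def)
  then show "\<exists>f\<in>I. is_lead_mon f t"
    using is_lead_mon_iff_rank by blast
qed

section \<open>Multiples of powers of the last variable\<close>

lemma subspace_piece_ideal: "ideal I R3 \<Longrightarrow> ps.subspace (I \<inter> homog d)"
  using ps.fin_dim_subspace_subspace[OF ideal_piece_fin_dim] .

lemma fin_dim_tail: "ideal I R3 \<Longrightarrow> fin_dim_subspace pscale (I \<inter> homog d \<inter> tail_space d n)"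
  by (rule ps.fin_dim_subspace_mono[OF ideal_piece_fin_dim[of I d]])
    (auto intro: ps.subspace_inter subspace_piece_ideal)

lemma x3_multiples_subset:
  assumes "ideal I R3" "c \<le> d"
  shows "(\<lambda>f. x3_power c * f) ` (I \<inter> homog (d - c)) \<subseteq> I \<inter> homog d \<inter> tail_space d (c * Suc d)"
proof -
  have "(\<lambda>f. x3_power c * f) ` (I \<inter> homog (d - c)) \<subseteq> tail_space d (c * Suc d)"
    using x3_power_mult_tail_space[OF assms(2)] by blast
  then show ?thesis
    using assms(1) tail_space_subset_homog[of d] unfolding ideal_R3_iff by blast
qed

lemma tail_dim_ge_quotient:
  fixes I :: "('k::field) poly3 set"
  assumes "ideal I R3" "c \<le> d"
  shows "ps.dim (I \<inter> homog (d - c)) \<le> ps.dim (I \<inter> homog d \<inter> tail_space d (c * Suc d))"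
proof -
  have "ps.subspace ((\<lambda>f. x3_power c * f) ` (I \<inter> homog (d - c)))"
    by (rule ps.fin_dim_subspace_subspace,
        rule psps.fin_dim_subspace_image[OF linear_mult ideal_piece_fin_dim[OF assms(1)]])
  then show ?thesis
    using ps.dim_mono_fin[OF fin_dim_tail[OF assms(1)] _ x3_multiples_subset[OF assms]]
    by (simp add: dim_mono_poly_mult[OF ideal_piece_fin_dim[OF assms(1)]])
qed

lemma tail_dim_if_injective:
  fixes I :: "('k::field) poly3 set"
  assumes "ideal I R3" "c \<le> d"
    and inj: "\<And>f. f \<in> homog (d - c) \<Longrightarrow> x3_power c * f \<in> I \<Longrightarrow> f \<in> I"
  shows "ps.dim (I \<inter> homog d \<inter> tail_space d (c * Suc d)) = ps.dim (I \<inter> homog (d - c))"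
proof -
  have "I \<inter> homog d \<inter> tail_space d (c * Suc d) \<subseteq> (\<lambda>f. x3_power c * f) ` (I \<inter> homog (d - c))"
    unfolding x3_power_mult_tail_space[OF assms(2), symmetric] using inj by blast
  then have "I \<inter> homog d \<inter> tail_space d (c * Suc d) = (\<lambda>f. x3_power c * f) ` (I \<inter> homog (d - c))"
    using x3_multiples_subset[OF assms(1,2)] by blast
  then show ?thesis
    by (simp add: dim_mono_poly_mult[OF ideal_piece_fin_dim[OF assms(1)]])
qed

lemma card_head_mons:
  assumes "c \<le> d"
  shows "card {t \<in> mons d. revlex_rank d t < c * Suc d} + card (mons (d - c)) = card (mons d)"
proof -
  have "mons d = {t \<in> mons d. revlex_rank d t < c * Suc d} \<union> {t \<in> mons d. c * Suc d \<le> revlex_rank d t}"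
    by auto
  moreover have "{t \<in> mons d. revlex_rank d t < c * Suc d} \<inter> {t \<in> mons d. c * Suc d \<le> revlex_rank d t} = {}"
    by auto
  ultimately have "card (mons d) = card {t \<in> mons d. revlex_rank d t < c * Suc d}
      + card {t \<in> mons d. c * Suc d \<le> revlex_rank d t}"
    by (metis (no_types, lifting) card_Un_disjoint finite_Un finite_mons)
  then show ?thesis by (simp only: card_tail_mons[OF assms])
qed

lemma restrict_to_subset: "restrict_to T ` V \<subseteq> supported_on T"
  by (auto simp: supported_on_iff)

text \<open>
  The image of \<open>I\<^sub>d\<close> modulo \<open>x\<^sub>3\<^sup>c\<close> has at most the dimension of \<open>(R/(x\<^sub>3\<^sup>c))\<^sub>d\<close>, with equality if
  multiplication by \<open>x\<^sub>3\<^sup>c\<close> onto \<open>(R/I)\<^sub>d\<close> is surjective.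
\<close>

lemma tail_dim_ge_codim:
  fixes I :: "('k::field) poly3 set"
  assumes "ideal I R3" "c \<le> d"
  shows "card (mons (d - c)) + ps.dim (I \<inter> homog d)
    \<le> ps.dim (I \<inter> homog d \<inter> tail_space d (c * Suc d)) + card (mons d)"
proof -
  let ?T = "{t \<in> mons d. revlex_rank d t < c * Suc d}"
  note V = subspace_piece_ideal[OF assms(1), of d] Int_lower2[of I "homog d"]
  have "ps.dim (restrict_to ?T ` (I \<inter> homog d)) \<le> ps.dim (supported_on ?T :: 'k poly3 set)"
    by (rule ps.dim_mono_fin[OF fin_dim_supported_on ps.fin_dim_subspace_subspace restrict_to_subset])
      (use dim_split_tail_space(2)[OF V] in simp_all)
  then show ?thesis
    using dim_split_tail_space(1)[OF V, of "c * Suc d"] card_head_mons[OF assms(2)]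
    by (simp add: dim_supported_on)
qed

lemma tail_dim_if_surjective:
  fixes I :: "('k::field) poly3 set"
  assumes "ideal I R3" "c \<le> d"
    and surj: "\<And>h. h \<in> homog d \<Longrightarrow> \<exists>f\<in>homog (d - c). h - x3_power c * f \<in> I"
  shows "card (mons (d - c)) + ps.dim (I \<inter> homog d)
    = ps.dim (I \<inter> homog d \<inter> tail_space d (c * Suc d)) + card (mons d)"
proof -
  let ?T = "{t \<in> mons d. revlex_rank d t < c * Suc d}"
  note V = subspace_piece_ideal[OF assms(1), of d] Int_lower2[of I "homog d"]
  have "supported_on ?T \<subseteq> restrict_to ?T ` (I \<inter> homog d)"
  proof
    fix h :: "'k poly3" assume h: "h \<in> supported_on ?T"
    then have hd: "h \<in> homog d" by (auto simp: homog_eq_supported_on supported_on_def)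
    then obtain f where f: "f \<in> homog (d - c)" "h - x3_power c * f \<in> I" using surj by blast
    have x: "x3_power c * f \<in> tail_space d (c * Suc d)"
      using x3_power_mult_tail_space[OF assms(2)] f(1) by blast
    have "h = restrict_to ?T (h - x3_power c * f)"
    proof (rule poly_mapping_eqI)
      fix t
      have "t \<notin> keys (x3_power c * f)" if "t \<in> ?T"
      proof
        assume "t \<in> keys (x3_power c * f)"
        then have "c * Suc d \<le> revlex_rank d t" using x unfolding tail_space_iff by blast
        then show False using that by simp
      qed
      then have "lookup (x3_power c * f) t = 0" if "t \<in> ?T"
        using that by (simp add: in_keys_iff)
      then show "lookup h t = lookup (restrict_to ?T (h - x3_power c * f)) t"
        using h by (auto simp: lookup_minus supported_on_iff)
    qed
    moreover have "h - x3_power c * f \<in> homog d"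
      using hd x tail_space_subset_homog by (intro homog_diff) auto
    ultimately show "h \<in> restrict_to ?T ` (I \<inter> homog d)" using f(2) by blast
  qed
  then have "restrict_to ?T ` (I \<inter> homog d) = supported_on ?T"
    using restrict_to_subset by blast
  then show ?thesis
    using dim_split_tail_space(1)[OF V, of "c * Suc d"] card_head_mons[OF assms(2)]
    by (simp add: dim_supported_on)
qed

section \<open>The strong Lefschetz property and the last variable\<close>

lemma x3_power_eq: "x3_power c = (x3_power 1 :: ('k::field) poly3) ^ c"
proof (induction c)
  case (Suc c)
  have "x3_power (Suc c) = (x3_power 1 * x3_power c :: 'k poly3)"
    by (simp add: mult_single single_add[symmetric])
  then show ?case by (simp only: power_Suc Suc[symmetric])
qed simp

lemma exists_matrix_column:
  fixes l :: "3 \<Rightarrow> 'k::field"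
  assumes "l i \<noteq> 0"
  obtains g :: "'k^3^3" where "invertible g" "\<And>i. g $ i $ 2 = l i"
proof -
  have three: "(3::3) = 0" by simp
  note d = distinct_3 distinct_3[symmetric]
  \<comment> \<open>The column is completed by two unit vectors that avoid a nonzero entry of \<open>l\<close>.\<close>
  consider "l 0 \<noteq> 0" | "l 1 \<noteq> 0" | "l 2 \<noteq> 0"
    using assms UNIV_3_eq by (metis UNIV_I empty_iff insert_iff)
  then show ?thesis
  proof cases
    case 1
    let ?g = "(\<chi> i j. if j = 2 then l i else if j = 0 then (if i = 2 then 1 else 0) else (if i = 1 then 1 else 0)) :: 'k^3^3"
    have "det ?g = - l 0" unfolding det_3 three using d by simp
    then have "invertible ?g" using 1 by (simp add: invertible_det_nz)
    then show ?thesis using that[of ?g] by simp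
  next
    case 2
    let ?g = "(\<chi> i j. if j = 2 then l i else if j = 1 then (if i = 2 then 1 else 0) else (if i = 0 then 1 else 0)) :: 'k^3^3"
    have "det ?g = - l 1" unfolding det_3 three using d by simp
    then have "invertible ?g" using 2 by (simp add: invertible_det_nz)
    then show ?thesis using that[of ?g] by simp
  next
    case 3
    let ?g = "(\<chi> i j. if j = 2 then l i else if j = 1 then (if i = 1 then 1 else 0) else (if i = 0 then 1 else 0)) :: 'k^3^3"
    have "det ?g = l 2" unfolding det_3 three using d by simp
    then have "invertible ?g" using 3 by (simp add: invertible_det_nz)
    then show ?thesis using that[of ?g] by simp
  qed
qed

lemma exists_coordinate_change_to_x3:
  fixes L :: "('k::field) poly3"
  assumes "L \<in> homog 1" "L \<noteq> 0"
  obtains g where "invertible g" "act g L = x3_power 1"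
proof -
  let ?l = "\<lambda>i. lookup L (Poly_Mapping.single i 1)"
  have m1: "\<exists>i. t = Poly_Mapping.single i 1" if "mdeg t = 1" for t
  proof -
    have "lookup t 0 + lookup t 1 + lookup t 2 = 1" using that by (simp add: mdeg_eq)
    then consider "lookup t 0 = 1 \<and> lookup t 1 = 0 \<and> lookup t 2 = 0"
      | "lookup t 0 = 0 \<and> lookup t 1 = 1 \<and> lookup t 2 = 0"
      | "lookup t 0 = 0 \<and> lookup t 1 = 0 \<and> lookup t 2 = 1"
      by linarith
    then have "\<exists>i. \<forall>j. lookup t j = lookup (Poly_Mapping.single i 1) j"
      unfolding ex_3 all_3 using distinct_3 distinct_3[symmetric]
      by cases (simp_all add: lookup_single when_def)
    then show ?thesis by (metis poly_mapping_eqI)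
  qed
  have "L = linear_form (\<chi> i j. ?l i) 2"
  proof (rule poly_mapping_eqI)
    fix t
    show "lookup L t = lookup (linear_form (\<chi> i j. ?l i) 2) t"
    proof (cases "mdeg t = 1")
      case True
      then obtain i where i: "t = Poly_Mapping.single i 1" using m1 by blast
      have "Poly_Mapping.single j 1 = Poly_Mapping.single i (1::nat) \<longleftrightarrow> j = i" for j :: 3
        by (metis lookup_single_eq lookup_single_not_eq one_neq_zero)
      then show ?thesis
        by (simp add: linear_form_def lookup_sum i lookup_single when_def)
    next
      case False
      then have "lookup L t = 0" using assms(1) by (auto simp: homog_iff)
      moreover have "Poly_Mapping.single i 1 \<noteq> t" for i :: 3
        using False mdeg_single by metis
      ultimately show ?thesis
        by (simp add: linear_form_def lookup_sum lookup_single when_def)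
    qed
  qed
  moreover obtain i where "?l i \<noteq> 0"
  proof -
    obtain t where "lookup L t \<noteq> 0" using assms(2) by (metis lookup_zero poly_mapping_eqI)
    then show ?thesis using m1 assms(1) that unfolding homog_iff by metis
  qed
  then obtain h :: "'k^3^3" where h: "invertible h" "\<And>i. h $ i $ 2 = ?l i"
    using exists_matrix_column[of ?l i] by blast
  ultimately have "act h (x3_power 1) = L"
    unfolding act_var by (simp add: linear_form_def)
  then show ?thesis
    using act_inverse[OF h(1)] that by metis
qed

lemma homog_Suc_subset_ideal:
  assumes "ideal I R3" "homog 1 \<subseteq> I"
  shows "homog (Suc n) \<subseteq> I"
proof
  fix f :: "'a poly3" assume f: "f \<in> homog (Suc n)"
  have "Poly_Mapping.single t (lookup f t) \<in> I" if t: "t \<in> keys f" for t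
  proof -
    have "mdeg t \<noteq> 0" using f t by (auto simp: homog_def)
    then obtain i where i: "lookup t i \<noteq> 0" unfolding mdeg_def by (metis sum.neutral)
    let ?x = "Poly_Mapping.single i (1::nat)"
    have "t = (t - ?x) + ?x"
      by (rule poly_mapping_eqI) (use i in \<open>auto simp: lookup_add lookup_minus lookup_single when_def\<close>)
    then have "Poly_Mapping.single t (lookup f t) = Poly_Mapping.single (t - ?x) (lookup f t) * mono_poly ?x"
      by (simp add: mult_single)
    moreover have "mono_poly ?x \<in> I"
      using assms(2) homog_single[of ?x 1 1] by auto
    ultimately show ?thesis using assms(1) unfolding ideal_R3_iff by metis
  qed
  then show "f \<in> I"
    by (subst poly_mapping_sum_singles) (rule ideal_sum[OF assms(1)])
qed

text \<open>
  A nonzero Lefschetz element can be moved to \<open>x\<^sub>3\<close> by a change of coordinates. If zero is a Lefschetz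
  element, then all forms of positive degree lie in \<open>I\<close>, and \<open>x\<^sub>3\<close> is a Lefschetz element as well.
\<close>

lemma strong_lefschetz_x3:
  fixes I :: "('k::field) poly3 set"
  assumes "homogeneous_ideal I" "strong_lefschetz I"
  obtains g where "invertible g" "\<And>d i. 1 \<le> i \<Longrightarrow>
    (\<forall>f\<in>homog d. x3_power i * f \<in> act g ` I \<longrightarrow> f \<in> act g ` I) \<or>
    (\<forall>h\<in>homog (d + i). \<exists>f\<in>homog d. h - x3_power i * f \<in> act g ` I)"
proof -
  have I: "ideal I R3" using assms(1) by (simp add: homogeneous_ideal_def)
  let ?P = "\<lambda>L d i. (\<forall>f\<in>homog d. L ^ i * f \<in> I \<longrightarrow> f \<in> I) \<or>
    (\<forall>h\<in>homog (d + i). \<exists>f\<in>homog d. h - L ^ i * f \<in> I)"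
  obtain L0 where L0: "L0 \<in> homog 1" "\<And>d i. 1 \<le> i \<Longrightarrow> ?P L0 d i"
    using assms(2) unfolding strong_lefschetz_iff[OF I] by blast
  obtain L where L: "L \<in> homog 1" "L \<noteq> 0" "\<And>d i. 1 \<le> i \<Longrightarrow> ?P L d i"
  proof (cases "L0 = 0")
    case False
    then show ?thesis using that L0 by blast
  next
    case True
    have "homog 1 \<subseteq> I"
    proof -
      consider "\<forall>f\<in>homog 0. L0 ^ 1 * f \<in> I \<longrightarrow> f \<in> I" | "\<forall>h\<in>homog (0 + 1). \<exists>f\<in>homog 0. h - L0 ^ 1 * f \<in> I"
        using L0(2)[of 1 0] by auto
      then show ?thesis
      proof cases
        case 1
        have "0 \<in> I" using I by (simp add: ideal_R3_iff)
        moreover have "(1 :: 'k poly3) \<in> homog 0" by (rule homog_one)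
        ultimately have "1 \<in> I" using 1 True by simp
        then show ?thesis using I unfolding ideal_R3_iff by (metis mult.right_neutral subsetI)
      next
        case 2
        then show ?thesis using True by auto
      qed
    qed
    then have "homog (d + i) \<subseteq> I" if "1 \<le> i" for d i
      using homog_Suc_subset_ideal[OF I, of "d + i - 1"] that by simp
    then have "?P (x3_power 1) d i" if "1 \<le> i" for d i
      using that by (intro disjI2 ballI bexI[of _ 0]) auto
    moreover have "x3_power 1 \<in> homog 1" by (rule homog_single) simp
    moreover have "x3_power 1 \<noteq> (0 :: 'k poly3)"
      by (metis lookup_single_eq lookup_zero zero_neq_one)
    ultimately show ?thesis using that by blast
  qed
  obtain g where g: "invertible g" "act g L = x3_power 1"
    using exists_coordinate_change_to_x3[OF L(1,2)] .
  obtain h where h: "\<And>f. act g (act h f) = f" "\<And>f. act h (act g f) = f"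
    using act_inverse[OF g(1)] by metis
  have gL: "x3_power i * f = act g (L ^ i * act h f)" for i f
    by (simp only: act_mult act_power g(2) x3_power_eq[symmetric] h(1))
  have mem: "f \<in> act g ` I \<longleftrightarrow> act h f \<in> I" for f
    using h by (metis (no_types, lifting) image_iff)
  have "(\<forall>f\<in>homog d. x3_power i * f \<in> act g ` I \<longrightarrow> f \<in> act g ` I) \<or>
    (\<forall>p\<in>homog (d + i). \<exists>f\<in>homog d. p - x3_power i * f \<in> act g ` I)" if i: "1 \<le> i" for d i
    using L(3)[OF i, of d]
  proof
    assume inj: "\<forall>f\<in>homog d. L ^ i * f \<in> I \<longrightarrow> f \<in> I"
    have "f \<in> act g ` I" if "f \<in> homog d" "x3_power i * f \<in> act g ` I" for f
      using that inj act_homog[OF that(1), of h] unfolding gL mem h(2) by blast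
    then show ?thesis by blast
  next
    assume surj: "\<forall>p\<in>homog (d + i). \<exists>f\<in>homog d. p - L ^ i * f \<in> I"
    have "\<exists>f\<in>homog d. p - x3_power i * f \<in> act g ` I" if p: "p \<in> homog (d + i)" for p
    proof -
      obtain f where f: "f \<in> homog d" "act h p - L ^ i * f \<in> I"
        using surj act_homog[OF p, of h] by blast
      have "p - x3_power i * act g f \<in> act g ` I"
        unfolding mem act_diff gL h(2) using f(2) by simp
      then show ?thesis using act_homog[OF f(1)] by blast
    qed
    then show ?thesis by blast
  qed
  then show ?thesis using that[OF g(1)] by blast
qed

text \<open>
  The dimension of the space of multiples of \<open>x\<^sub>3\<^sup>c\<close> of degree \<open>d\<close> in an ideal with Hilbert function
  \<open>h\<close> for which multiplication by \<open>x\<^sub>3\<^sup>c\<close> on the quotient has maximal rank.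
\<close>

definition expected_tail_dim :: "(nat \<Rightarrow> nat) \<Rightarrow> nat \<Rightarrow> nat \<Rightarrow> nat" where
  "expected_tail_dim h d c =
     (if c \<le> d then max (h (d - c)) (card (mons (d - c)) + h d - card (mons d)) else 0)"

text \<open>
  Whatever the rank of the multiplication map, the multiples of \<open>x\<^sub>3\<^sup>c\<close> contain \<open>x\<^sub>3\<^sup>c (g I)\<^sub>d\<^sub>-\<^sub>c\<close>, and
  their codimension in \<open>x\<^sub>3\<^sup>c R\<^sub>d\<^sub>-\<^sub>c\<close> is at most that of \<open>(g I)\<^sub>d\<close> in \<open>R\<^sub>d\<close>.
\<close>

lemma expected_tail_dim_le:
  fixes I :: "('k::field) poly3 set"
  assumes "homogeneous_ideal I" "invertible g"
  shows "expected_tail_dim (\<lambda>d. ps.dim (I \<inter> homog d)) d c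
    \<le> ps.dim (act g ` I \<inter> homog d \<inter> tail_space d (c * Suc d))"
proof -
  have I: "ideal I R3" using assms(1) by (simp add: homogeneous_ideal_def)
  have J: "ideal (act g ` I) R3"
    using homogeneous_ideal_act[OF assms] by (simp add: homogeneous_ideal_def)
  show ?thesis
    using tail_dim_ge_quotient[OF J, of c d] tail_dim_ge_codim[OF J, of c d]
    unfolding expected_tail_dim_def dim_act_piece[OF I assms(2)] by auto
qed

lemma expected_tail_dim_attained:
  fixes I :: "('k::field) poly3 set"
  assumes "homogeneous_ideal I" "strong_lefschetz I"
  obtains g where "invertible g" "\<And>d c. ps.dim (act g ` I \<inter> homog d \<inter> tail_space d (c * Suc d))
    = expected_tail_dim (\<lambda>d. ps.dim (I \<inter> homog d)) d c"
proof -
  have I: "ideal I R3" using assms(1) by (simp add: homogeneous_ideal_def)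
  obtain g where g: "invertible g" and SL: "\<And>d i. 1 \<le> i \<Longrightarrow>
    (\<forall>f\<in>homog d. x3_power i * f \<in> act g ` I \<longrightarrow> f \<in> act g ` I) \<or>
    (\<forall>h\<in>homog (d + i). \<exists>f\<in>homog d. h - x3_power i * f \<in> act g ` I)"
    using strong_lefschetz_x3[OF assms] by metis
  have J: "ideal (act g ` I) R3"
    using homogeneous_ideal_act[OF assms(1) g] by (simp add: homogeneous_ideal_def)
  let ?h = "\<lambda>d. ps.dim (I \<inter> homog d)"
  have "ps.dim (act g ` I \<inter> homog d \<inter> tail_space d (c * Suc d)) \<le> expected_tail_dim ?h d c" for d c
  proof (cases "c \<le> d")
    case False
    then have "Suc d * Suc d \<le> c * Suc d" by (intro mult_le_mono) auto
    moreover have "0 \<in> act g ` I"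
      using J unfolding ideal_R3_iff by blast
    ultimately have "act g ` I \<inter> homog d \<inter> tail_space d (c * Suc d) = {0}"
      using tail_space_end[of d "c * Suc d"] by auto
    then show ?thesis by simp
  next
    case cd: True
    show ?thesis
    proof (cases "c = 0")
      case True
      then show ?thesis
        by (simp add: expected_tail_dim_def tail_space_0 Int_assoc dim_act_piece[OF I g])
    next
      case False
      then consider
          "\<forall>f\<in>homog (d - c). x3_power c * f \<in> act g ` I \<longrightarrow> f \<in> act g ` I"
        | "\<forall>h\<in>homog d. \<exists>f\<in>homog (d - c). h - x3_power c * f \<in> act g ` I"
        using SL[of c "d - c"] cd by auto
      then show ?thesis
      proof cases
        case 1
        then have "ps.dim (act g ` I \<inter> homog d \<inter> tail_space d (c * Suc d)) = ?h (d - c)"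
          using tail_dim_if_injective[OF J cd] by (simp add: dim_act_piece[OF I g])
        then show ?thesis using cd by (simp add: expected_tail_dim_def)
      next
        case 2
        then have "card (mons (d - c)) + ?h d
            = ps.dim (act g ` I \<inter> homog d \<inter> tail_space d (c * Suc d)) + card (mons d)"
          using tail_dim_if_surjective[OF J cd] by (simp add: dim_act_piece[OF I g])
        then show ?thesis using cd by (simp add: expected_tail_dim_def)
      qed
    qed
  qed
  then show ?thesis
    using that[OF g] expected_tail_dim_le[OF assms(1) g] by (metis le_antisym)
qed

section \<open>General coordinates in the first two variables\<close>

definition shear :: "'k::field \<Rightarrow> 'k^3^3" where
  "shear s = (\<chi> i j. if i = j then 1 else if i = 0 \<and> j = 1 then s else 0)"

lemma invertible_shear: "invertible (shear s)"
proof -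
  have "(3::3) = 0" by simp
  then have "det (shear s) = 1"
    unfolding det_3 shear_def using distinct_3 distinct_3[symmetric] by simp
  then show ?thesis by (simp add: invertible_det_nz)
qed

text \<open>
  Dehomogenization with respect to \<open>x\<^sub>1\<close>, after \<open>x\<^sub>2 \<mapsto> x\<^sub>2 + s x\<^sub>1\<close>; the result is a polynomial
  in \<open>x\<^sub>3\<close> whose coefficients are polynomials in \<open>x\<^sub>2\<close>.
\<close>

definition dehomogenize :: "'k::field \<Rightarrow> 'k poly3 \<Rightarrow> 'k poly poly" where
  "dehomogenize s = poly_eval (\<lambda>a. [:[:a:]:])
     (\<lambda>i. if i = 0 then 1 else if i = 1 then [:[:s, 1:]:] else [:0, 1:])"

lemma semiring_hom_const: "semiring_hom (\<lambda>a :: 'k::field. [:[:a:]:])"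
  by (simp add: semiring_hom_def one_pCons)

lemma dehomogenize_shear: "dehomogenize 0 (act (shear s) f) = dehomogenize s f"
proof -
  let ?v = "\<lambda>i :: 3. if i = 0 then 1 else if i = 1 then [:[:0, 1:]:] else [:0, 1:] :: 'a poly poly"
  have "(\<Sum>i\<in>UNIV. [:[:shear s $ i $ j:]:] * ?v i)
      = (if j = 0 then 1 else if j = 1 then [:[:s, 1:]:] else [:0, 1:])" for j
  proof -
    consider "j = 0" | "j = 1" | "j = 2" using UNIV_3_eq by (metis UNIV_I empty_iff insert_iff)
    then show ?thesis
      unfolding UNIV_3_eq shear_def using distinct_3 distinct_3[symmetric]
      by cases (simp_all add: one_pCons)
  qed
  then show ?thesis
    unfolding dehomogenize_def poly_eval_act[OF semiring_hom_const] by simp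
qed

lemma coeff_dehomogenize:
  "coeff (dehomogenize s f) c =
     (\<Sum>t\<in>keys f. if lookup t 2 = c then smult (lookup f t) ([:s, 1:] ^ lookup t 1) else 0)"
proof -
  let ?v = "\<lambda>i :: 3. if i = 0 then 1 else if i = 1 then [:[:s, 1:]:] else [:0, 1:] :: 'a poly poly"
  have pc: "[:p:] ^ n = [:p ^ n:]" for p :: "'a poly" and n
    by (induction n) (simp_all add: one_pCons)
  have "monomial_value ?v t = monom ([:s, 1:] ^ lookup t 1) (lookup t 2)" for t
  proof -
    have "monomial_value ?v t = (\<Prod>i\<in>UNIV. ?v i ^ lookup t i)"
      by (rule monomial_value_superset) auto
    also have "\<dots> = [:[:s, 1:] ^ lookup t 1:] * [:0, 1:] ^ lookup t 2"
      unfolding UNIV_3_eq using distinct_3 distinct_3[symmetric] by (simp add: pc)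
    also have "\<dots> = monom ([:s, 1:] ^ lookup t 1) (lookup t 2)"
      unfolding monom_altdef by simp
    finally show ?thesis .
  qed
  moreover have "coeff ([:[:a:]:] * monom q n) c = (if n = c then smult a q else 0)" for a :: 'a and q n
    by (simp add: coeff_smult)
  ultimately show ?thesis
    unfolding dehomogenize_def poly_eval_superset[OF semiring_hom_const finite_keys order_refl] coeff_sum
    by (simp only:)
qed

lemma coeff_dehomogenize_shift: "coeff (dehomogenize s f) c = pcompose (coeff (dehomogenize 0 f) c) [:s, 1:]"
proof -
  have pw: "pcompose ([:0, 1:] ^ n) [:s, 1:] = [:s, 1:] ^ n" for n
    by (induction n) (simp_all add: pcompose_mult one_pCons pcompose_pCons)
  have "pcompose (if b then smult a ([:0, 1:] ^ n) else 0) [:s, 1:] = (if b then smult a ([:s, 1:] ^ n) else 0)"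
    for b a n by (simp add: pcompose_smult pw)
  then show ?thesis
    unfolding coeff_dehomogenize pcompose_sum by simp
qed

lemma coeff_coeff_dehomogenize:
  assumes "f \<in> homog d" "t \<in> mons d"
  shows "coeff (coeff (dehomogenize 0 f) (lookup t 2)) (lookup t 1) = lookup f t"
proof -
  have "coeff (coeff (dehomogenize 0 f) (lookup t 2)) (lookup t 1)
      = (\<Sum>u\<in>keys f. if u = t then lookup f t else 0)"
    unfolding coeff_dehomogenize coeff_sum
  proof (rule sum.cong[OF refl])
    fix u assume "u \<in> keys f"
    then have "u \<in> mons d" using assms(1) by (auto simp: homog_def mons_def)
    then have *: "u = t \<longleftrightarrow> lookup u 2 = lookup t 2 \<and> lookup u 1 = lookup t 1"
      using mons_eqI[OF _ assms(2)] by blast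
    have "[:0, 1:] ^ n = monom (1::'a) n" for n unfolding monom_altdef by simp
    then show "coeff (if lookup u 2 = lookup t 2 then smult (lookup f u) ([:0, 1:] ^ lookup u 1) else 0)
        (lookup t 1) = (if u = t then lookup f t else 0)"
      using * by (cases "u = t") auto
  qed
  then show ?thesis by (auto simp: in_keys_iff)
qed

lemma dehomogenize_sum: "dehomogenize s (sum f A) = (\<Sum>x\<in>A. dehomogenize s (f x))"
  unfolding dehomogenize_def by (rule poly_eval_sum[OF semiring_hom_const])

lemma coeff_dehomogenize_pscale:
  "coeff (dehomogenize s (pscale a f)) c = smult a (coeff (dehomogenize s f) c)"
  unfolding pscale_eq_mult dehomogenize_def poly_eval_mult[OF semiring_hom_const]
    poly_eval_single[OF semiring_hom_const] by simp

lemma tail_space_iff_dehomogenize: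
  assumes "f \<in> homog d"
  shows "f \<in> tail_space d (c * Suc d) \<longleftrightarrow> (\<forall>e<c. coeff (dehomogenize 0 f) e = 0)"
proof -
  have k: "\<And>t. t \<in> keys f \<Longrightarrow> t \<in> mons d" using assms by (auto simp: homog_def mons_def)
  have "f \<in> tail_space d (c * Suc d) \<longleftrightarrow> (\<forall>t\<in>keys f. c \<le> lookup t 2)"
    using assms k revlex_rank_ge_Suc_iff by (auto simp: tail_space_iff)
  also have "\<dots> \<longleftrightarrow> (\<forall>e<c. coeff (dehomogenize 0 f) e = 0)"
  proof
    assume *: "\<forall>t\<in>keys f. c \<le> lookup t 2"
    show "\<forall>e<c. coeff (dehomogenize 0 f) e = 0"
      unfolding coeff_dehomogenize using * by (intro allI impI sum.neutral) auto
  next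
    assume *: "\<forall>e<c. coeff (dehomogenize 0 f) e = 0"
    show "\<forall>t\<in>keys f. c \<le> lookup t 2"
    proof (intro ballI, rule ccontr)
      fix t assume t: "t \<in> keys f" "\<not> c \<le> lookup t 2"
      then have "lookup f t = 0"
        using coeff_coeff_dehomogenize[OF assms k[OF t(1)]] * by simp
      then show False using t(1) by (simp add: in_keys_iff)
    qed
  qed
  finally show ?thesis .
qed

lemma inj_on_exponent_1:
  "inj_on (\<lambda>t. lookup t 1) {t \<in> mons d. lookup t 2 = c}"
  using mons_eqI by (intro inj_onI) auto

text \<open>
  Let \<open>m\<close> be the number of initial monomials of \<open>V\<close> with \<open>x\<^sub>3\<close>-exponent \<open>c\<close>. The coefficients
  of \<open>x\<^sub>3\<^sup>c\<close> in the multiples of \<open>x\<^sub>3\<^sup>c\<close> in \<open>V\<close> form an \<open>m\<close>-dimensional space of forms in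
  \<open>x\<^sub>1, x\<^sub>2\<close>. After a general shear none of them but zero vanishes to order \<open>m\<close> at \<open>x\<^sub>2 = 0\<close>.
\<close>

lemma exists_shear_small_tail:
  fixes V :: "('k::field_char_0) poly3 set"
  assumes V: "ps.subspace V" "V \<subseteq> homog d"
    and m: "ps.dim (V \<inter> tail_space d (c * Suc d)) = m + ps.dim (V \<inter> tail_space d (Suc c * Suc d))"
      "m \<le> Suc d"
  shows "\<exists>s. ps.dim (act (shear s) ` V \<inter> tail_space d (c * Suc d + m))
    \<le> ps.dim (V \<inter> tail_space d (Suc c * Suc d))"
proof -
  let ?W0 = "V \<inter> tail_space d (c * Suc d)" and ?W1 = "V \<inter> tail_space d (Suc c * Suc d)"
  let ?F = "\<lambda>f. coeff (dehomogenize 0 f) c"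
  have fin: "fin_dim_subspace pscale (V \<inter> tail_space d n)" for n
    by (rule ps.fin_dim_subspace_mono[OF fin_dim_homog[of d]]) (use V in \<open>auto intro: ps.subspace_inter\<close>)
  have W1_sub: "?W1 \<subseteq> ?W0"
    using tail_space_antimono[of "c * Suc d" "Suc c * Suc d" d] by auto
  have W1_iff: "f \<in> ?W1 \<longleftrightarrow> f \<in> ?W0 \<and> ?F f = 0" for f
    using tail_space_iff_dehomogenize[of f d c] tail_space_iff_dehomogenize[of f d "Suc c"] V(2)
    by (auto simp: less_Suc_eq)
  obtain C where C: "C \<subseteq> ?W1" "ps.independent C" "ps.span C = ?W1" "finite C" "card C = ps.dim ?W1"
    by (rule ps.fin_dim_basis[OF fin])
  have CW0: "C \<subseteq> ?W0" using C(1) W1_sub by (rule subset_trans)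
  obtain B where B: "C \<subseteq> B" "B \<subseteq> ?W0" "ps.independent B" "ps.span B = ?W0" "finite B" "card B = ps.dim ?W0"
    by (rule ps.fin_dim_basis_extend[OF fin C(2) CW0])
  have "card (B - C) = m"
    using B(1,5,6) C(4,5) m(1) by (simp add: card_Diff_subset)
  then obtain e where e: "bij_betw e {..<m} (B - C)"
    using ex_bij_betw_nat_finite[of "B - C"] B(5) by (auto simp: atLeast0LessThan)
  have decomp: "\<exists>a. ?F f = (\<Sum>i<m. smult (a i) (?F (e i)))" if f: "f \<in> ?W0" for f
  proof -
    obtain r where r: "f = (\<Sum>b\<in>B. pscale (r b) b)"
      using f B(4,5) ps.span_finite[of B] by auto
    have z: "?F b = 0" if "b \<in> C" for b using C(1) W1_iff that by blast
    have "?F f = (\<Sum>b\<in>B. smult (r b) (?F b))"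
      unfolding r by (simp add: dehomogenize_sum coeff_sum coeff_dehomogenize_pscale)
    also have "\<dots> = (\<Sum>b\<in>B - C. smult (r b) (?F b))"
      using B(5) z by (intro sum.mono_neutral_right) auto
    also have "\<dots> = (\<Sum>i<m. smult (r (e i)) (?F (e i)))"
      by (rule sum.reindex_bij_betw[OF e, symmetric])
    finally show ?thesis by (rule exI[of _ "\<lambda>i. r (e i)"])
  qed
  \<comment> \<open>The shear is chosen for the span of the \<open>?F (e i)\<close>, which contains \<open>?F f\<close> for every \<open>f \<in> ?W0\<close>.\<close>
  obtain s where s: "\<forall>a. (\<forall>j<m. coeff (pcompose (\<Sum>i<m. smult (a i) (?F (e i))) [:s, 1:]) j = 0) \<longrightarrow>
      (\<Sum>i<m. smult (a i) (?F (e i))) = 0"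
    by (rule exists_general_shift[of m "\<lambda>i. ?F (e i)"]) blast
  have "act (shear s) ` V \<inter> tail_space d (c * Suc d + m) \<subseteq> act (shear s) ` ?W1"
  proof
    fix h assume h: "h \<in> act (shear s) ` V \<inter> tail_space d (c * Suc d + m)"
    then obtain f where f: "f \<in> V" "h = act (shear s) f" by blast
    have hd: "h \<in> homog d" "f \<in> homog d" using f V(2) act_homog by auto
    have sh: "coeff (dehomogenize 0 h) b = pcompose (coeff (dehomogenize 0 f) b) [:s, 1:]" for b
      unfolding f(2) dehomogenize_shear coeff_dehomogenize_shift[symmetric] ..
    have "h \<in> tail_space d (c * Suc d)"
      using h by (auto simp: tail_space_iff)
    then have "\<forall>b<c. coeff (dehomogenize 0 f) b = 0"
      unfolding tail_space_iff_dehomogenize[OF hd(1)] sh by (simp add: pcompose_eq_0_iff)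
    then have fW0: "f \<in> ?W0"
      using f(1) tail_space_iff_dehomogenize[OF hd(2)] by blast
    have "coeff (coeff (dehomogenize 0 h) c) j = 0" if j: "j < m" for j
    proof (cases "c + j \<le> d")
      case True
      let ?t = "Poly_Mapping.single (0::3) (d - c - j) + Poly_Mapping.single 1 j + Poly_Mapping.single 2 c :: mon3"
      have t: "?t \<in> mons d" "lookup ?t 1 = j" "lookup ?t 2 = c"
        using True distinct_3 distinct_3[symmetric]
        by (simp_all add: mons_def lookup_add lookup_single when_def)
      have "\<not> c * Suc d + m \<le> revlex_rank d ?t"
        using revlex_rank_ge_iff_Suc[OF t(1) m(2), of c] t j by simp
      then have "lookup h ?t = 0"
        using h by (auto simp: tail_space_iff in_keys_iff)
      then show ?thesis using coeff_coeff_dehomogenize[OF hd(1) t(1)] t by simp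
    next
      case False
      have "coeff (if lookup t 2 = c then smult (lookup h t) ([:0, 1:] ^ lookup t 1) else 0) j = 0"
        if "t \<in> keys h" for t
      proof -
        have "mdeg t = d" using that hd(1) by (auto simp: homog_def)
        then have "lookup t 2 = c \<Longrightarrow> lookup t 1 \<noteq> j" using False by (auto simp: mdeg_eq)
        moreover have "[:0, 1:] ^ n = monom (1::'k) n" for n unfolding monom_altdef by simp
        ultimately show ?thesis by simp
      qed
      then show ?thesis
        unfolding coeff_dehomogenize coeff_sum by (intro sum.neutral) blast
    qed
    moreover obtain a where a: "?F f = (\<Sum>i<m. smult (a i) (?F (e i)))"
      using decomp[OF fW0] by blast
    ultimately have "?F f = 0"
      using s[rule_format, of a] unfolding sh by simp
    then have "f \<in> ?W1" using W1_iff fW0 by blast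
    then show "h \<in> act (shear s) ` ?W1" using f(2) by blast
  qed
  moreover have "fin_dim_subspace pscale (act (shear s) ` ?W1)"
    by (rule psps.fin_dim_subspace_image[OF linear_act fin])
  moreover have "ps.subspace (act (shear s) ` V \<inter> tail_space d (c * Suc d + m))"
  proof -
    have "fin_dim_subspace pscale V"
      by (rule ps.fin_dim_subspace_mono[OF fin_dim_homog V])
    then have "ps.subspace (act (shear s) ` V)"
      using psps.fin_dim_subspace_image[OF linear_act] ps.fin_dim_subspace_subspace by blast
    then show ?thesis by (intro ps.subspace_inter) simp_all
  qed
  moreover have "ps.dim (act (shear s) ` ?W1) = ps.dim ?W1"
    by (rule psps.dim_image_inj[OF linear_act fin act_eq_0[OF invertible_shear]])
  ultimately have "ps.dim (act (shear s) ` V \<inter> tail_space d (c * Suc d + m)) \<le> ps.dim ?W1"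
    using ps.dim_mono_fin by metis
  then show ?thesis by blast
qed

section \<open>The generic initial ideal of an ideal with the strong Lefschetz property\<close>

text \<open>
  The difference is the number of initial monomials with \<open>x\<^sub>3\<close>-exponent exactly \<open>lookup t 2\<close>.
\<close>

definition expected_lead_mons :: "(nat \<Rightarrow> nat) \<Rightarrow> nat \<Rightarrow> mon3 set" where
  "expected_lead_mons h d = {t \<in> mons d. lookup t 1
     < expected_tail_dim h d (lookup t 2) - expected_tail_dim h d (Suc (lookup t 2))}"

definition minimal_tails :: "('k::field) poly3 set \<Rightarrow> ('k^3^3) \<Rightarrow> bool" where
  "minimal_tails I g \<longleftrightarrow> invertible g \<and> (\<forall>g' d n. invertible g' \<longrightarrow>
     ps.dim (act g ` I \<inter> homog d \<inter> tail_space d n) \<le> ps.dim (act g' ` I \<inter> homog d \<inter> tail_space d n))"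

text \<open>
  The number of initial monomials with a given \<open>x\<^sub>3\<close>-exponent is known from the maximal rank property,
  and by comparison with general shears they are the largest ones.
\<close>

lemma lead_mons_if_minimal_tails:
  fixes I :: "('k::field_char_0) poly3 set"
  assumes I: "homogeneous_ideal I" and SL: "strong_lefschetz I" and g: "minimal_tails I g"
  shows "lead_mons d (act g ` I \<inter> homog d) = expected_lead_mons (\<lambda>d. ps.dim (I \<inter> homog d)) d"
proof -
  let ?h = "\<lambda>d. ps.dim (I \<inter> homog d)" and ?V = "act g ` I \<inter> homog d"
  have inv: "invertible g" using g by (simp add: minimal_tails_def)
  have min: "ps.dim (?V \<inter> tail_space d n) \<le> ps.dim (act g' ` I \<inter> homog d \<inter> tail_space d n)"
    if "invertible g'" for g' n using g that by (simp add: minimal_tails_def)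
  have J: "ideal (act g ` I) R3"
    using homogeneous_ideal_act[OF I inv] by (simp add: homogeneous_ideal_def)
  note V = subspace_piece_ideal[OF J, of d] Int_lower2[of "act g ` I" "homog d"]
  have tail: "ps.dim (?V \<inter> tail_space d (c * Suc d)) = expected_tail_dim ?h d c" for c
  proof -
    obtain g' where g': "invertible g'"
      "\<forall>d c. ps.dim (act g' ` I \<inter> homog d \<inter> tail_space d (c * Suc d)) = expected_tail_dim ?h d c"
      by (rule expected_tail_dim_attained[OF I SL]) blast
    show ?thesis
      using min[OF g'(1), of "c * Suc d"] expected_tail_dim_le[OF I inv, of d c] unfolding g'(2)[rule_format]
      by (rule le_antisym)
  qed
  let ?L = "lead_mons d ?V"
  have Lm: "?L \<subseteq> mons d" by (rule lead_mons_subset[OF V(2)])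
  then have finL: "finite ?L" using finite_subset finite_mons by blast
  have row: "{t \<in> ?L. lookup t 2 = c} = {t \<in> mons d. lookup t 2 = c \<and>
      lookup t 1 < expected_tail_dim ?h d c - expected_tail_dim ?h d (Suc c)}" for c
  proof -
    let ?R = "{t \<in> ?L. lookup t 2 = c}"
    define m where "m = card ?R"
    have ge: "{t \<in> ?L. c * Suc d \<le> revlex_rank d t} = ?R \<union> {t \<in> ?L. Suc c * Suc d \<le> revlex_rank d t}"
      using Lm revlex_rank_ge_Suc_iff[of _ d c] revlex_rank_ge_Suc_iff[of _ d "Suc c"]
      by (auto simp del: mult_Suc mult_Suc_right)
    have disj: "?R \<inter> {t \<in> ?L. Suc c * Suc d \<le> revlex_rank d t} = {}"
      using Lm revlex_rank_ge_Suc_iff[of _ d "Suc c"] by (auto simp del: mult_Suc mult_Suc_right)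
    have dims: "ps.dim (?V \<inter> tail_space d (c * Suc d)) = m + ps.dim (?V \<inter> tail_space d (Suc c * Suc d))"
      unfolding dim_inter_tail_space[OF V] ge m_def using finL disj by (intro card_Un_disjoint) auto
    have inj: "inj_on (\<lambda>t. lookup t 1) ?R"
      by (rule inj_on_subset[OF inj_on_exponent_1[of d c]]) (use Lm in blast)
    have "(\<lambda>t. lookup t 1) ` ?R \<subseteq> {..d}"
      by (auto dest!: subsetD[OF Lm] mons_exponents_le)
    then have "m \<le> card {..d}"
      unfolding m_def by (rule card_inj_on_le[OF inj]) simp
    then have md: "m \<le> Suc d" by simp
    obtain s where s: "ps.dim (act (shear s) ` ?V \<inter> tail_space d (c * Suc d + m))
        \<le> ps.dim (?V \<inter> tail_space d (Suc c * Suc d))"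
      using exists_shear_small_tail[OF V dims md] by blast
    have inv': "invertible (shear s ** g)"
      using invertible_mult[OF invertible_shear inv] .
    have "act (shear s) ` ?V = act (shear s ** g) ` I \<inter> homog d"
      unfolding act_piece[OF inv] act_piece[OF inv'] image_image act_act ..
    then have le: "ps.dim (?V \<inter> tail_space d (c * Suc d + m)) \<le> ps.dim (?V \<inter> tail_space d (Suc c * Suc d))"
      using min[OF inv', of "c * Suc d + m"] s by simp
    have sub: "{t \<in> ?L. Suc c * Suc d \<le> revlex_rank d t} \<subseteq> {t \<in> ?L. c * Suc d + m \<le> revlex_rank d t}"
      using md by auto
    \<comment> \<open>so no initial monomial has a rank between \<open>c * (d + 1) + m\<close> and \<open>(c + 1) * (d + 1)\<close>\<close>
    have eq: "{t \<in> ?L. Suc c * Suc d \<le> revlex_rank d t} = {t \<in> ?L. c * Suc d + m \<le> revlex_rank d t}"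
      using le unfolding dim_inter_tail_space[OF V]
      by (intro card_seteq[OF _ sub]) (use finL in simp_all)
    have "lookup t 1 < m" if "t \<in> ?R" for t
    proof (rule ccontr)
      assume "\<not> lookup t 1 < m"
      moreover have t: "t \<in> mons d" "t \<in> ?L" "lookup t 2 = c" using that Lm by auto
      ultimately have "c * Suc d + m \<le> revlex_rank d t"
        using revlex_rank_ge_iff_Suc[OF t(1) md, of c] by simp
      then have "t \<in> {t \<in> ?L. Suc c * Suc d \<le> revlex_rank d t}" using t(2) unfolding eq by simp
      then show False using disj that by blast
    qed
    then have sub': "?R \<subseteq> {t \<in> mons d. lookup t 2 = c \<and> lookup t 1 < m}"
      using Lm by blast
    have "inj_on (\<lambda>t. lookup t 1) {t \<in> mons d. lookup t 2 = c \<and> lookup t 1 < m}"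
      by (rule inj_on_subset[OF inj_on_exponent_1[of d c]]) blast
    then have "card {t \<in> mons d. lookup t 2 = c \<and> lookup t 1 < m} \<le> card {..<m}"
      by (rule card_inj_on_le) auto
    then have "?R = {t \<in> mons d. lookup t 2 = c \<and> lookup t 1 < m}"
      using sub' by (intro card_seteq) (simp_all add: m_def)
    moreover have "m = expected_tail_dim ?h d c - expected_tail_dim ?h d (Suc c)"
      using dims unfolding tail by simp
    ultimately show ?thesis by simp
  qed
  have "t \<in> ?L \<longleftrightarrow> t \<in> expected_lead_mons ?h d" for t
    using row[of "lookup t 2"] by (auto simp: expected_lead_mons_def set_eq_iff)
  then show ?thesis by blast
qed

text \<open>
  Only finitely many conditions are needed, since \<open>I\<close> contains all forms of high degree, and each
  of them holds where a nonzero polynomial function does not vanish.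
\<close>

lemma minimal_tails_generic:
  fixes I :: "('k::field_char_0) poly3 set"
  assumes I: "homogeneous_ideal I" and D: "\<And>d. d \<ge> D \<Longrightarrow> homog d \<subseteq> I"
  obtains p where "polyfun p" "\<exists>g. invertible g \<and> p g \<noteq> 0"
    "\<And>g. invertible g \<Longrightarrow> p g \<noteq> 0 \<Longrightarrow> minimal_tails I g"
proof -
  have Ii: "ideal I R3" using I by (simp add: homogeneous_ideal_def)
  let ?\<nu> = "\<lambda>g d n. ps.dim (act g ` I \<inter> homog d \<inter> tail_space d n)"
  have one: "invertible (mat 1 :: 'k^3^3)" by (auto simp: invertible_def)
  have "\<exists>p g0. polyfun p \<and> invertible g0 \<and> p g0 \<noteq> 0 \<and>
      (\<forall>g g'. invertible g \<longrightarrow> invertible g' \<longrightarrow> p g \<noteq> 0 \<longrightarrow> ?\<nu> g d n \<le> ?\<nu> g' d n)" for d n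
  proof -
    obtain g0 where g0: "invertible g0" "\<And>g'. invertible g' \<Longrightarrow> ?\<nu> g0 d n \<le> ?\<nu> g' d n"
      using ex_has_least_nat[of invertible "mat 1" "\<lambda>g. ?\<nu> g d n"] one by blast
    obtain p where p: "polyfun p" "p g0 \<noteq> 0" "\<And>g. invertible g \<Longrightarrow> p g \<noteq> 0 \<Longrightarrow>
        ps.dim (act g ` (I \<inter> homog d) \<inter> tail_space d n) \<le> ps.dim (act g0 ` (I \<inter> homog d) \<inter> tail_space d n)"
      using tail_dim_semicontinuous[OF subspace_piece_ideal[OF Ii] Int_lower2 act_eq_0[OF g0(1)], where d = d and n = n] by blast
    have "?\<nu> g d n \<le> ?\<nu> g' d n" if "invertible g" "invertible g'" "p g \<noteq> 0" for g g'
      using p(3)[OF that(1,3)] g0(2)[OF that(2)]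
      by (simp add: act_piece[OF that(1)] act_piece[OF g0(1)])
    then show ?thesis using p(1,2) g0(1) by blast
  qed
  then obtain p g0 where p: "\<And>d n. polyfun (p d n)" "\<And>d n. invertible (g0 d n)" "\<And>d n. p d n (g0 d n) \<noteq> 0"
    "\<And>d n g g'. invertible g \<Longrightarrow> invertible g' \<Longrightarrow> p d n g \<noteq> 0 \<Longrightarrow> ?\<nu> g d n \<le> ?\<nu> g' d n"
    by metis
  let ?A = "SIGMA d:{..<D}. {..<Suc d * Suc d}"
  define P where "P g = (\<Prod>(d, n)\<in>?A. p d n g)" for g
  have Pn: "P g \<noteq> 0 \<longleftrightarrow> (\<forall>(d, n)\<in>?A. p d n g \<noteq> 0)" for g
    unfolding P_def by (subst prod_zero_iff) auto
  have "polyfun P"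
    unfolding P_def[abs_def] case_prod_beta by (intro polyfun_prod p(1))
  moreover have "\<exists>g. invertible g \<and> P g \<noteq> 0"
  proof -
    \<comment> \<open>The determinant is added to the family, to obtain an invertible matrix.\<close>
    let ?f = "\<lambda>x g. case x of None \<Rightarrow> det g | Some (d, n) \<Rightarrow> p d n g"
    have "\<exists>g. \<forall>x\<in>insert None (Some ` ?A). ?f x g \<noteq> 0"
    proof (rule polyfun_common_nonzero_finite)
      fix x assume "x \<in> insert None (Some ` ?A)"
      show "polyfun (?f x) \<and> (\<exists>g. ?f x g \<noteq> 0)"
      proof (cases x)
        case None
        have "\<exists>g :: 'k^3^3. det g \<noteq> 0" by (rule exI[of _ "mat 1"]) simp
        then show ?thesis using polyfun_det None by simp
      next
        case (Some y)
        have "\<exists>g. p d n g \<noteq> 0" for d n using p(3) by blast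
        then show ?thesis using p(1) Some by (cases y) simp
      qed
    qed auto
    then obtain g where g: "\<forall>x\<in>insert None (Some ` ?A). ?f x g \<noteq> 0" by blast
    then have "invertible g" by (simp add: invertible_det_nz)
    moreover have "P g \<noteq> 0" unfolding Pn using g by auto
    ultimately show ?thesis by blast
  qed
  moreover have "minimal_tails I g" if g: "invertible g" "P g \<noteq> 0" for g
    unfolding minimal_tails_def
  proof (intro conjI allI impI)
    fix g' d n assume g': "invertible (g' :: 'k^3^3)"
    consider "D \<le> d" | "Suc d * Suc d \<le> n" | "(d, n) \<in> ?A"
      by (cases "D \<le> d"; cases "Suc d * Suc d \<le> n") (auto simp del: mult_Suc mult_Suc_right)
    then show "?\<nu> g d n \<le> ?\<nu> g' d n"
    proof cases
      case 1
      have "act g ` I \<inter> homog d = homog d" if inv: "invertible g" for g :: "'k^3^3"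
      proof -
        obtain h where h: "\<And>f. act g (act h f) = f" using act_inverse[OF inv] by metis
        have "f \<in> act g ` I" if "f \<in> homog d" for f
          using D[OF 1] act_homog[OF that, of h] h[of f] by (metis image_eqI subsetD)
        then show ?thesis by blast
      qed
      then show ?thesis using g(1) g' by simp
    next
      case 2
      have "act g ` I \<inter> homog d \<inter> tail_space d n \<subseteq> {0}"
        using tail_space_end[OF 2] by blast
      moreover have "0 \<in> act g ` I"
        using Ii unfolding ideal_R3_iff by (metis act_zero image_eqI)
      ultimately have "act g ` I \<inter> homog d \<inter> tail_space d n = {0}"
        by (auto simp: tail_space_iff)
      then show ?thesis by simp
    next
      case 3
      then have "p d n g \<noteq> 0" using g(2) unfolding Pn by auto
      then show ?thesis using p(4)[OF g(1) g'] by blast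
    qed
  qed (use g in simp)
  ultimately show ?thesis using that by blast
qed

lemma zariski_open_meets:
  fixes U U' :: "(('k::field_char_0)^3^3) set"
  assumes "zariski_open_GL3 U" "U \<noteq> {}" "zariski_open_GL3 U'" "U' \<noteq> {}"
  shows "U \<inter> U' \<noteq> {}"
proof -
  let ?e = "\<lambda>p g. poly_eval id (\<lambda>(i, j). g $ i $ j) p :: 'k"
  obtain S where S: "U = {g. invertible g \<and> (\<exists>p\<in>S. ?e p g \<noteq> 0)}"
    using assms(1) unfolding zariski_open_GL3_def by blast
  obtain S' where S': "U' = {g. invertible g \<and> (\<exists>p\<in>S'. ?e p g \<noteq> 0)}"
    using assms(3) unfolding zariski_open_GL3_def by blast
  obtain g p where g: "p \<in> S" "?e p g \<noteq> 0" "det g \<noteq> 0"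
    using assms(2) unfolding S invertible_det_nz by blast
  obtain g' p' where g': "p' \<in> S'" "?e p' g' \<noteq> 0"
    using assms(4) unfolding S' by blast
  have "\<exists>a. det a * ?e p a \<noteq> 0 \<and> ?e p' a \<noteq> 0"
    by (rule polyfun_common_nonzero[where a = g and b = g'])
      (use g g' in \<open>auto intro: polyfun.mult polyfun_det polyfun_poly_eval\<close>)
  then obtain a where "det a \<noteq> 0" "?e p a \<noteq> 0" "?e p' a \<noteq> 0" by auto
  then have "a \<in> U \<inter> U'"
    using g(1) g'(1) unfolding S S' invertible_det_nz by blast
  then show ?thesis by blast
qed

lemma gin_eqI:
  fixes I :: "('k::field_char_0) poly3 set"
  assumes "zariski_open_GL3 U" "U \<noteq> {}" "\<And>g. g \<in> U \<Longrightarrow> initial_ideal (act g ` I) = G"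
  shows "gin I = G"
  unfolding gin_def
proof (rule the_equality)
  show "\<exists>U. zariski_open_GL3 U \<and> U \<noteq> {} \<and> (\<forall>g\<in>U. initial_ideal (act g ` I) = G)"
    using assms by blast
next
  fix G' assume "\<exists>U. zariski_open_GL3 U \<and> U \<noteq> {} \<and> (\<forall>g\<in>U. initial_ideal (act g ` I) = G')"
  then obtain U' where "zariski_open_GL3 U'" "U' \<noteq> {}" "\<And>g. g \<in> U' \<Longrightarrow> initial_ideal (act g ` I) = G'"
    by blast
  then show "G' = G"
    using zariski_open_meets[OF assms(1,2)] assms(3) by blast
qed

theorem gin_eq_expected:
  fixes I :: "('k::field_char_0) poly3 set"
  assumes "homogeneous_ideal I" "\<And>d. d \<ge> D \<Longrightarrow> homog d \<subseteq> I" "strong_lefschetz I"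
  shows "gin I = genideal R3 (mono_poly ` (\<Union>d. expected_lead_mons (\<lambda>d. ps.dim (I \<inter> homog d)) d))"
proof -
  obtain p where p: "polyfun p" "\<exists>g. invertible g \<and> p g \<noteq> 0"
    "\<And>g. invertible g \<Longrightarrow> p g \<noteq> 0 \<Longrightarrow> minimal_tails I g"
    using minimal_tails_generic[OF assms(1,2)] by blast
  obtain P where P: "\<And>g. p g = poly_eval id (\<lambda>(i, j). g $ i $ j) P"
    using polyfun_imp_poly_eval[OF p(1)] by blast
  let ?U = "{g. invertible g \<and> p g \<noteq> 0}"
  show ?thesis
  proof (rule gin_eqI)
    show "zariski_open_GL3 ?U"
      unfolding zariski_open_GL3_def P by (intro exI[of _ "{P}"]) simp
    show "?U \<noteq> {}" using p(2) by blast
    fix g assume g: "g \<in> ?U"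
    then have J: "homogeneous_ideal (act g ` I)"
      using homogeneous_ideal_act[OF assms(1)] by blast
    have "(\<exists>f\<in>act g ` I. is_lead_mon f t) \<longleftrightarrow>
        t \<in> (\<Union>d. expected_lead_mons (\<lambda>d. ps.dim (I \<inter> homog d)) d)" for t
      unfolding lead_mon_in_ideal_iff[OF J]
      using lead_mons_if_minimal_tails[OF assms(1,3) p(3)] g
      by (auto simp: expected_lead_mons_def mons_def)
    then show "initial_ideal (act g ` I)
        = genideal R3 (mono_poly ` (\<Union>d. expected_lead_mons (\<lambda>d. ps.dim (I \<inter> homog d)) d))"
      unfolding initial_ideal_def image_def by (intro arg_cong[where f = "genideal R3"]) blast
  qed
qed

section \<open>Minimal generators of monomial ideals\<close>

lemma genideal_R3_mono: "S \<subseteq> genideal R3 T \<Longrightarrow> genideal R3 S \<subseteq> genideal R3 T"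
  using ring.genideal_minimal[OF ring_R3 ring.genideal_ideal[OF ring_R3]] by simp

lemma subset_genideal_R3: "S \<subseteq> genideal R3 S"
  using ring.genideal_self[OF ring_R3] by simp

text \<open>The polynomials all of whose monomials are multiples of elements of \<open>M\<close> form an ideal.\<close>

lemma keys_monomial_ideal:
  assumes "f \<in> genideal R3 (mono_poly ` M)" "t \<in> keys (f :: ('k::field) poly3)"
  shows "\<exists>s\<in>M. \<exists>u. t = u + s"
proof -
  let ?N = "{f :: 'k poly3. \<forall>t\<in>keys f. \<exists>s\<in>M. \<exists>u. t = u + s}"
  have "ideal ?N R3"
    unfolding ideal_R3_iff
  proof (intro conjI ballI allI)
    show "f + g \<in> ?N" if "f \<in> ?N" "g \<in> ?N" for f g
      using that keys_add[of f g] by blast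
    show "r * f \<in> ?N" if "f \<in> ?N" for r f
    proof -
      have "\<exists>s\<in>M. \<exists>u. t = u + s" if t: "t \<in> keys (r * f)" for t
      proof -
        obtain a b where "a \<in> keys r" "b \<in> keys f" "t = a + b"
          using t keys_mult[of r f] by blast
        moreover obtain s u where "s \<in> M" "b = u + s"
          using \<open>f \<in> ?N\<close> \<open>b \<in> keys f\<close> by blast
        ultimately show ?thesis by (metis add.assoc)
      qed
      then show ?thesis by blast
    qed
  qed simp
  moreover have "mono_poly ` M \<subseteq> ?N"
  proof -
    have "s = 0 + s" for s :: mon3 by simp
    then show ?thesis by fastforce
  qed
  ultimately have "genideal R3 (mono_poly ` M) \<subseteq> ?N"
    by (rule ring.genideal_minimal[OF ring_R3])
  then show ?thesis using assms by blast
qed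

text \<open>
  The generators are the elements of \<open>M\<close> that are minimal for divisibility. Every element of \<open>M\<close> is a
  multiple of one of them by induction on the degree, and none of them is a multiple of another.
\<close>

lemma exists_minimal_monomial_generators:
  "\<exists>S. is_minimal_monomial_generators S (genideal R3 (mono_poly ` M) :: ('k::field) poly3 set)"
proof -
  define M0 where "M0 = {t \<in> M. \<forall>s\<in>M. \<forall>u. t = u + s \<longrightarrow> s = t}"
  have "\<exists>s\<in>M0. \<exists>u. t = u + s" if "t \<in> M" for t
    using that
  proof (induction "mdeg t" arbitrary: t rule: less_induct)
    case less
    show ?case
    proof (cases "t \<in> M0")
      case True
      then show ?thesis by (metis add_0)
    next
      case False
      then obtain s u where s: "s \<in> M" "t = u + s" "s \<noteq> t" using less.prems by (auto simp: M0_def)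
      then have "u \<noteq> 0" by auto
      then have "mdeg s < mdeg t" using mdeg_eq_zero_iff[of u] s(2) by simp
      then obtain s' u' where "s' \<in> M0" "s = u' + s'" using less.hyps[OF _ s(1)] by blast
      then show ?thesis using s(2) by (metis add.assoc)
    qed
  qed
  note div = this
  let ?G = "genideal R3 (mono_poly ` M0) :: 'k poly3 set"
  have G: "ideal ?G R3"
    by (rule ring.genideal_ideal[OF ring_R3]) simp
  have "mono_poly t \<in> ?G" if t: "t \<in> M" for t
  proof -
    obtain s u where s: "s \<in> M0" "t = u + s" using div[OF t] by blast
    have "(mono_poly s :: 'k poly3) \<in> mono_poly ` M0" using s(1) by (rule imageI)
    then have "mono_poly s \<in> ?G" by (rule subsetD[OF subset_genideal_R3])
    then have "mono_poly u * mono_poly s \<in> ?G" using G by (simp add: ideal_R3_iff)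
    then show ?thesis using s(2) by (simp add: mult_single)
  qed
  then have "genideal R3 (mono_poly ` M) \<subseteq> (genideal R3 (mono_poly ` M0) :: 'k poly3 set)"
    by (intro genideal_R3_mono) blast
  moreover have "genideal R3 (mono_poly ` M0) \<subseteq> (genideal R3 (mono_poly ` M) :: 'k poly3 set)"
    by (intro genideal_R3_mono subset_trans[OF _ subset_genideal_R3]) (auto simp: M0_def)
  ultimately have eq: "genideal R3 (mono_poly ` M0) = (genideal R3 (mono_poly ` M) :: 'k poly3 set)"
    by blast
  have "genideal R3 T \<noteq> (genideal R3 (mono_poly ` M) :: 'k poly3 set)" if T: "T \<subset> mono_poly ` M0" for T
  proof
    assume gT: "genideal R3 T = (genideal R3 (mono_poly ` M) :: 'k poly3 set)"
    define N where "N = {t \<in> M0. (mono_poly t :: 'k poly3) \<in> T}"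
    have TN: "T = mono_poly ` N" using T by (auto simp: N_def)
    obtain t where t: "t \<in> M0" "(mono_poly t :: 'k poly3) \<notin> T" using T by blast
    have "(mono_poly t :: 'k poly3) \<in> genideal R3 (mono_poly ` N)"
      using subset_genideal_R3[of "mono_poly ` M"] t(1) gT unfolding TN by (auto simp: M0_def)
    then obtain s u where s: "s \<in> N" "t = u + s"
      using keys_monomial_ideal[of "mono_poly t" N t] by auto
    then have "s = t" using t(1) by (auto simp: M0_def N_def)
    then show False using s(1) t(2) by (simp add: N_def)
  qed
  then have "is_minimal_monomial_generators (mono_poly ` M0) (genideal R3 (mono_poly ` M) :: 'k poly3 set)"
    unfolding is_minimal_monomial_generators_def using eq by blast
  then show ?thesis by blast
qed

section \<open>Betti numbers determine the generic initial ideal\<close>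

lemma high_degrees_transfer:
  fixes I J :: "('k::field) poly3 set"
  assumes "ideal J R3" "homog d \<subseteq> I" "ps.dim (I \<inter> homog d) = ps.dim (J \<inter> homog d)"
  shows "homog d \<subseteq> J"
proof -
  have "ps.dim (homog d :: 'k poly3 set) \<le> ps.dim (J \<inter> homog d)"
    using assms(2,3) by (simp add: Int_absorb1)
  then have "J \<inter> homog d = homog d"
    by (intro ps.subspace_eq_of_dim_ge[OF fin_dim_homog subspace_piece_ideal[OF assms(1)]]) auto
  then show ?thesis by blast
qed

theorem proposition4p6:
  shows "(\<exists>\<Phi> :: (nat \<Rightarrow> nat \<Rightarrow> nat) \<Rightarrow> ('k::field_char_0) poly3 set.
            \<forall>I. homogeneous_artinian_ideal I \<and> strong_lefschetz I \<longrightarrow>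
                is_minimal_monomial_generators (\<Phi> (graded_betti I)) (gin I))
       \<and> (\<forall>(I :: 'k poly3 set) J.
            homogeneous_artinian_ideal I \<and> strong_lefschetz I \<and>
            homogeneous_ideal J \<and> strong_lefschetz J \<and>
            (\<forall>i j. graded_betti J i j = graded_betti I i j) \<longrightarrow>
            gin I = gin J)"
proof (rule conjI)
  have main: "gin I = gin J"
    if I: "homogeneous_artinian_ideal I" "strong_lefschetz I"
      and J: "homogeneous_ideal J" "strong_lefschetz J"
      and betti: "\<And>i j. graded_betti J i j = graded_betti I i j" for I J :: "'k poly3 set"
  proof -
    have hI: "homogeneous_ideal I" using I(1) by (simp add: homogeneous_artinian_ideal_def)
    have h: "ps.dim (I \<inter> homog d) = ps.dim (J \<inter> homog d)" for d
      using hilbert_function_determined_by_betti[OF hI J(1)] betti by simp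
    obtain D where D: "\<And>d. d \<ge> D \<Longrightarrow> homog d \<subseteq> I"
      using artinian_contains_high_degrees[OF I(1)] by blast
    have DJ: "homog d \<subseteq> J" if "d \<ge> D" for d
      using high_degrees_transfer[OF _ D[OF that] h] J(1) by (simp add: homogeneous_ideal_def)
    have "gin I = genideal R3 (mono_poly ` (\<Union>d. expected_lead_mons (\<lambda>d. ps.dim (I \<inter> homog d)) d))"
      by (rule gin_eq_expected[OF hI D I(2)])
    also have "\<dots> = genideal R3 (mono_poly ` (\<Union>d. expected_lead_mons (\<lambda>d. ps.dim (J \<inter> homog d)) d))"
      by (simp only: h)
    also have "\<dots> = gin J"
      by (rule gin_eq_expected[OF J(1) DJ J(2), symmetric])
    finally show ?thesis .
  qed
  show "\<forall>(I :: 'k poly3 set) J.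
      homogeneous_artinian_ideal I \<and> strong_lefschetz I \<and>
      homogeneous_ideal J \<and> strong_lefschetz J \<and>
      (\<forall>i j. graded_betti J i j = graded_betti I i j) \<longrightarrow> gin I = gin J"
    using main by blast
  have gens: "\<exists>S. is_minimal_monomial_generators S (gin I)"
    if I: "homogeneous_artinian_ideal I" "strong_lefschetz I" for I :: "'k poly3 set"
  proof -
    have hI: "homogeneous_ideal I" using I(1) by (simp add: homogeneous_artinian_ideal_def)
    obtain D where D: "\<And>d. d \<ge> D \<Longrightarrow> homog d \<subseteq> I"
      using artinian_contains_high_degrees[OF I(1)] by blast
    have "gin I = genideal R3 (mono_poly ` (\<Union>d. expected_lead_mons (\<lambda>d. ps.dim (I \<inter> homog d)) d))"
      by (rule gin_eq_expected[OF hI D I(2)])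
    then show ?thesis by (simp only: exists_minimal_monomial_generators)
  qed
  define \<Phi> :: "(nat \<Rightarrow> nat \<Rightarrow> nat) \<Rightarrow> 'k poly3 set" where
    "\<Phi> b = (SOME S. \<exists>I :: 'k poly3 set. homogeneous_artinian_ideal I \<and> strong_lefschetz I \<and>
      graded_betti I = b \<and> is_minimal_monomial_generators S (gin I))" for b
  have "is_minimal_monomial_generators (\<Phi> (graded_betti I)) (gin I)"
    if I: "homogeneous_artinian_ideal I" "strong_lefschetz I" for I
  proof -
    have "\<exists>S. \<exists>J :: 'k poly3 set. homogeneous_artinian_ideal J \<and> strong_lefschetz J \<and>
        graded_betti J = graded_betti I \<and> is_minimal_monomial_generators S (gin J)"
      using gens[OF I] I by blast
    from someI_ex[OF this] obtain J :: "'k poly3 set" where J: "homogeneous_artinian_ideal J" "strong_lefschetz J"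
      "graded_betti J = graded_betti I" "is_minimal_monomial_generators (\<Phi> (graded_betti I)) (gin J)"
      unfolding \<Phi>_def by blast
    have "gin I = gin J"
      using main[OF I _ J(2)] J(1,3) by (simp add: homogeneous_artinian_ideal_def)
    then show ?thesis using J(4) by simp
  qed
  then show "\<exists>\<Phi> :: (nat \<Rightarrow> nat \<Rightarrow> nat) \<Rightarrow> 'k poly3 set.
      \<forall>I. homogeneous_artinian_ideal I \<and> strong_lefschetz I \<longrightarrow>
        is_minimal_monomial_generators (\<Phi> (graded_betti I)) (gin I)"
    by blast
qed

end
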